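(* Let $1<p\le q<\infty$, $\alpha>-1/2$ and $\beta,\gamma\in\mathbb{R}$. The inequality $$\Vert y^{-\beta}\mathscr{H}_\alpha f\Vert_q\lesssim\Vert x^\gamma f\Vert_p$$ holds for every admissible $f\in GM$ (with a constant depending on $f$ only through the constants $C_0,\lambda$ in the $GM$ condition) if and only if $$\beta=\gamma+\frac1q-\frac1{p'},\qquad \frac1q+\alpha-\frac12<\beta<\frac1q+\alpha+\frac32.$$
   Context: The transform $\mathscr{H}_\alpha$ is $\mathscr{H}_\alpha f(y)=\int_0^\infty(xy)^{1/2}f(x)\mathbf{H}_\alpha(xy)\,dx$, $y>0$, where $\mathbf{H}_\alpha$ is the Struve function $$\mathbf{H}_\alpha(x)=\Big(\frac x2\Big)^{\alpha+1}\sum_{k=0}^\infty\frac{(-1)^k(x/2)^{2k}}{\Gamma(k+3/2)\Gamma(k+\alpha+3/2)}.$$ The integral is understood as improper at infinity. General monotone functions: a function $f:(0,\infty)\to\mathbb{C}$ locally of bounded variation is in $GM$ (with constants $C_0,\lambda>1$) if $\int_x^{2x}|df(t)|\le\frac{C_0}{x}\int_{x/\lambda}^{\lambda x}|f(t)|\,dt$ for all $x>0$, where $\int|df(t)|$ is a Stieltjes integral (total variation); $f\in GM$ means this holds for some $C_0,\lambda>1$. Here $f\in GM$ is admissible if $\int_0^1x^{\alpha+3/2}|f(x)|\,dx+\int_1^\infty x^{\alpha-1/2}|f(x)|\,dx<\infty$. Notation: $\Vert g\Vert_p=\big(\int_0^\infty|g(x)|^p\,dx\big)^{1/p}$ (possibly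 $+\infty$), $p'=p/(p-1)$. *)

theory Defs
  imports "HOL-Analysis.Analysis"
begin

text \<open>
  Functions on \<open>(0,\<infinity>)\<close> are total functions on \<^typ>\<open>real\<close>; every notion below depends only on their
  values at positive arguments.
\<close>

definition struve_H :: "real \<Rightarrow> real \<Rightarrow> real" where
  "struve_H \<alpha> x = (x / 2) powr (\<alpha> + 1) *
     (\<Sum>k. (-1) ^ k * (x / 2) ^ (2 * k) / (Gamma (real k + 3/2) * Gamma (real k + \<alpha> + 3/2)))"

text \<open>
  The integral is improper at infinity only: a limit of Lebesgue integrals over \<open>(0,T)\<close>. The
  interval integral up to \<open>\<infinity>\<close> of the library would demand absolute integrability.
\<close>

definition struve_transform :: "real \<Rightarrow> (real \<Rightarrow> complex) \<Rightarrow> real \<Rightarrow> complex" where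
  "struve_transform \<alpha> f y =
     Lim at_top (\<lambda>T. LINT x:{0<..<T}|lborel. complex_of_real ((x * y) powr (1/2)) * f x *
                                            complex_of_real (struve_H \<alpha> (x * y)))"

text \<open>The total variation of \<open>f\<close> over the closed interval \<open>[a,b]\<close>.\<close>

definition total_var :: "(real \<Rightarrow> complex) \<Rightarrow> real \<Rightarrow> real \<Rightarrow> ennreal" where
  "total_var f a b =
     (SUP (n, t) \<in> {(n :: nat, t :: nat \<Rightarrow> real). mono t \<and> range t \<subseteq> {a..b}}.
        \<Sum>i<n. ennreal (norm (f (t (Suc i)) - f (t i))))"

definition locally_bounded_variation :: "(real \<Rightarrow> complex) \<Rightarrow> bool" where
  "locally_bounded_variation f \<longleftrightarrow> (\<forall>a b. 0 < a \<and> a < b \<longrightarrow> total_var f a b < \<infinity>)"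

definition general_monotone :: "real \<Rightarrow> real \<Rightarrow> (real \<Rightarrow> complex) \<Rightarrow> bool" where
  "general_monotone C\<^sub>0 lam f \<longleftrightarrow>
     locally_bounded_variation f \<and>
     (\<forall>x>0. total_var f x (2 * x) \<le>
        ennreal (C\<^sub>0 / x) * (\<integral>\<^sup>+t\<in>{x / lam..lam * x}. ennreal (norm (f t)) \<partial>lborel))"

definition admissible :: "real \<Rightarrow> (real \<Rightarrow> complex) \<Rightarrow> bool" where
  "admissible \<alpha> f \<longleftrightarrow>
     (\<integral>\<^sup>+x\<in>{0<..<1}. ennreal (x powr (\<alpha> + 3/2) * norm (f x)) \<partial>lborel) +
     (\<integral>\<^sup>+x\<in>{1<..}. ennreal (x powr (\<alpha> - 1/2) * norm (f x)) \<partial>lborel) < \<infinity>"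

definition Lp_norm :: "real \<Rightarrow> (real \<Rightarrow> complex) \<Rightarrow> ennreal" where
  "Lp_norm p g =
     (let I = (\<integral>\<^sup>+x\<in>{0<..}. ennreal (norm (g x) powr p) \<partial>lborel)
      in if I = \<infinity> then \<infinity> else ennreal (enn2real I powr (1 / p)))"

definition conj_exponent :: "real \<Rightarrow> real" where
  "conj_exponent p = p / (p - 1)"

end

theory Submission
  imports Defs
begin

text \<open>
  Write \<open>K s = s powr (1/2) * H s\<close>, where \<open>H\<close> is the Struve function of order \<open>\<alpha>\<close>. The recursion for
  the coefficients of the power series shows that \<open>K\<close> solves
  \<open>K'' + K = c s powr (\<alpha> - 1/2) + (\<alpha>\<^sup>2 - 1/4) K / s\<^sup>2\<close> with \<open>c > 0\<close>. All information about the Struve function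
  comes from this equation and from the first coefficient: \<open>K\<close> is of exact order
  \<open>s powr (\<alpha> + 3/2)\<close> at zero, and at infinity an energy estimate gives
  \<open>K s = c s powr (\<alpha> - 1/2) + w s\<close>, where \<open>w\<close> almost solves \<open>w'' + w = 0\<close>
  (\<open>struve_kernel_asymptotics\<close>).

  Sufficiency. The variation of a general monotone function on \<open>[x,\<infinity>)\<close> is bounded by the integral of
  \<open>\<bar>f t\<bar> / t\<close> over a slightly larger half-line (\<open>general_monotone_tail_bound\<close>). Integration by parts
  against an oscillating part of \<open>K\<close> with bounded primitive therefore gains a factor \<open>1 / (x y)\<close>, and this is
  smaller than \<open>(x y) powr (\<alpha> - 1/2)\<close> for \<open>x y \<ge> 1\<close> because \<open>\<alpha> > -1/2\<close>. Consequently the oscillation can be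
  forgotten: the transform of \<open>f\<close> at \<open>y\<close> is bounded by a multiple of the integral of
  \<open>\<bar>f x\<bar> * min ((x y) powr (\<alpha> + 3/2)) ((x y) powr (\<alpha> - 1/2))\<close> (\<open>struve_transform_bound\<close>). This positive
  operator is a convolution on the multiplicative group \<open>(0,\<infinity>)\<close>. With the weights of the theorem its
  kernel is integrable exactly if \<open>\<beta>\<close> lies in the stated open interval, and Young's inequality applies
  (\<open>power_weight_kernel_inequality\<close>).

  Necessity. The indicators of \<open>[R, 2 * R]\<close> are general monotone, with constants independent of \<open>R\<close>, and
  their transforms are dilates of a single function. Comparing powers of \<open>R\<close> gives the equation for \<open>\<beta>\<close>.
  That single function is bounded below by multiples of \<open>y powr (\<alpha> + 3/2)\<close> at zero and of
  \<open>y powr (\<alpha> - 1/2)\<close> at infinity, so finiteness of the left-hand norm confines \<open>\<beta>\<close> to the interval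
  (\<open>struve_transform_inequality_necessary\<close>).
\<close>

section \<open>Struve's differential equation\<close>

definition struve_coeff :: "real \<Rightarrow> nat \<Rightarrow> real" where
  "struve_coeff \<alpha> k = (-1) ^ k / (Gamma (real k + 3/2) * Gamma (real k + \<alpha> + 3/2))"

definition struve_series :: "real \<Rightarrow> real \<Rightarrow> real" where
  "struve_series \<alpha> z = (\<Sum>k. struve_coeff \<alpha> k * z ^ k)"

text \<open>
The kernel of the transform: the integrand is \<open>f x\<close> times this function at \<open>x * y\<close>.
\<close>

definition struve_kernel :: "real \<Rightarrow> real \<Rightarrow> real" where
  "struve_kernel \<alpha> s = s powr (1/2) * struve_H \<alpha> s"

text \<open>
Both Gamma factors advance by \<open>\<Gamma>(z + 1) = z \<Gamma>(z)\<close>. This two-term recursion is the only property of the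
coefficients, besides the positivity of the first one, that the proof uses.
\<close>

lemma struve_coeff_rec:
  assumes "\<alpha> > -1/2"
  shows "(real k + 3/2) * (real k + \<alpha> + 3/2) * struve_coeff \<alpha> (Suc k) = - struve_coeff \<alpha> k"
proof -
  have 1: "Gamma (real (Suc k) + 3/2) = (real k + 3/2) * Gamma (real k + 3/2)"
    using Gamma_plus1[of "real k + 3/2"] nonpos_Ints_nonpos[of "real k + 3/2"] by (auto simp: add_ac)
  have 2: "Gamma (real (Suc k) + \<alpha> + 3/2) = (real k + \<alpha> + 3/2) * Gamma (real k + \<alpha> + 3/2)"
    using Gamma_plus1[of "real k + \<alpha> + 3/2"] nonpos_Ints_nonpos[of "real k + \<alpha> + 3/2"] assms by (auto simp: add_ac)
  define A B x y where "A = Gamma (real k + 3/2)" and "B = Gamma (real k + \<alpha> + 3/2)"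
    and "x = real k + 3/2" and "y = real k + \<alpha> + 3/2"
  have "A > 0" "B > 0" "x > 0" "y > 0"
    using assms by (auto intro!: Gamma_real_pos simp: A_def B_def x_def y_def)
  then have "x * y * ((-1) ^ Suc k / ((x * A) * (y * B))) = - ((-1) ^ k / (A * B))"
    by (simp add: field_simps)
  then show ?thesis
    unfolding struve_coeff_def 1 2 unfolding A_def B_def x_def y_def .
qed

lemma struve_coeff_0_pos: "\<alpha> > -1/2 \<Longrightarrow> struve_coeff \<alpha> 0 > 0"
  unfolding struve_coeff_def by (auto intro!: divide_pos_pos mult_pos_pos Gamma_real_pos)

lemma summable_struve_series:
  assumes "\<alpha> > -1/2"
  shows "summable (\<lambda>k. struve_coeff \<alpha> k * z ^ k)"
proof (rule summable_ratio_test)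
  show "1/2 < (1::real)" by simp
  fix k assume "k \<ge> nat \<lceil>2 * \<bar>z\<bar>\<rceil>"
  then have k: "real k \<ge> 2 * \<bar>z\<bar>" by linarith
  define c where "c = (real k + 3/2) * (real k + \<alpha> + 3/2)"
  have "(real k + 3/2) * 1 \<le> (real k + 3/2) * (real k + \<alpha> + 3/2)"
    using assms by (intro mult_left_mono) auto
  then have c: "c \<ge> 2 * \<bar>z\<bar>" "c > 0" using k unfolding c_def[symmetric] by auto
  have "struve_coeff \<alpha> (Suc k) = - struve_coeff \<alpha> k / c"
    using struve_coeff_rec[OF assms, of k] c by (simp add: field_simps c_def)
  then have "norm (struve_coeff \<alpha> (Suc k) * z ^ Suc k) = (\<bar>z\<bar> / c) * norm (struve_coeff \<alpha> k * z ^ k)"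
    using c by (simp add: abs_mult power_abs)
  also have "\<dots> \<le> 1/2 * norm (struve_coeff \<alpha> k * z ^ k)"
    using c by (intro mult_right_mono) (auto simp: field_simps)
  finally show "norm (struve_coeff \<alpha> (Suc k) * z ^ Suc k) \<le> 1/2 * norm (struve_coeff \<alpha> k * z ^ k)" .
qed

lemma struve_series_DERIV:
  assumes "\<alpha> > -1/2"
  shows "(struve_series \<alpha> has_real_derivative (\<Sum>n. diffs (struve_coeff \<alpha>) n * z ^ n)) (at z)"
  using termdiffs_strong_converges_everywhere[OF summable_struve_series[OF assms]]
  unfolding struve_series_def[abs_def] .

text \<open>
With \<open>\<theta> = z d/dz\<close> the left-hand side is \<open>(\<theta> + 1/2) (\<theta> + \<alpha> + 1/2) S\<close>. That operator multiplies the
\<open>k\<close>-th coefficient by \<open>(k + 1/2) (k + \<alpha> + 1/2)\<close>, so by the recursion it turns the series into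
\<open>- z S\<close> plus its constant term.
\<close>

lemma struve_series_ode:
  assumes "\<alpha> > -1/2"
  defines "S \<equiv> struve_series \<alpha>"
  obtains S1 S2 where
    "\<And>z. (S has_real_derivative S1 z) (at z)" "\<And>z. (S1 has_real_derivative S2 z) (at z)"
    "\<And>z. z\<^sup>2 * S2 z + (\<alpha> + 2) * z * S1 z + (\<alpha> + 1/2) / 2 * S z
        = (\<alpha> + 1/2) / 2 * struve_coeff \<alpha> 0 - z * S z"
proof -
  define c where "c = struve_coeff \<alpha>"
  define S1 where "S1 z = (\<Sum>n. diffs c n * z ^ n)" for z
  define S2 where "S2 z = (\<Sum>n. diffs (diffs c) n * z ^ n)" for z
  have sm: "summable (\<lambda>n. c n * z ^ n)" for z
    unfolding c_def by (rule summable_struve_series[OF assms(1)])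
  note sm1 = termdiff_converges_all[OF sm]
  note sm2 = termdiff_converges_all[OF sm1]
  have Seq: "S z = (\<Sum>n. c n * z ^ n)" for z by (simp add: S_def struve_series_def c_def)
  have 1: "(S has_real_derivative S1 z) (at z)" for z
    using struve_series_DERIV[OF assms(1)] unfolding S1_def S_def c_def .
  have 2: "(S1 has_real_derivative S2 z) (at z)" for z
    using termdiffs_strong_converges_everywhere[OF sm1, of z] unfolding S1_def[abs_def] S2_def .
  \<comment> \<open>The identity divided by z: every coefficient of the left-hand side collapses by the recursion.\<close>
  have 3: "z * S2 z + (\<alpha> + 2) * S1 z + (\<alpha> + 1/2) / 2 * (\<Sum>n. c (Suc n) * z ^ n) = - S z" for z
  proof -
    have "(\<lambda>n. z * (of_nat n * diffs c n * z ^ (n - Suc 0))) sums (z * S2 z)"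
      unfolding S2_def by (intro sums_mult diffs_equiv sm2)
    also have "(\<lambda>n. z * (of_nat n * diffs c n * z ^ (n - Suc 0))) = (\<lambda>n. of_nat n * diffs c n * z ^ n)"
    proof
      fix n show "z * (of_nat n * diffs c n * z ^ (n - Suc 0)) = of_nat n * diffs c n * z ^ n"
        by (cases n) auto
    qed
    finally have a: "(\<lambda>n. of_nat n * diffs c n * z ^ n) sums (z * S2 z)" .
    have b: "(\<lambda>n. (\<alpha> + 2) * (diffs c n * z ^ n)) sums ((\<alpha> + 2) * S1 z)"
      unfolding S1_def by (intro sums_mult summable_sums sm1)
    have d: "(\<lambda>n. (\<alpha> + 1/2) / 2 * (c (Suc n) * z ^ n)) sums ((\<alpha> + 1/2) / 2 * (\<Sum>n. c (Suc n) * z ^ n))"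
      by (intro sums_mult summable_sums powser_split_head(3) sm)
    have "of_nat n * diffs c n * z ^ n + (\<alpha> + 2) * (diffs c n * z ^ n) + (\<alpha> + 1/2) / 2 * (c (Suc n) * z ^ n)
        = - (c n * z ^ n)" for n
    proof -
      have "of_nat n * diffs c n * z ^ n + (\<alpha> + 2) * (diffs c n * z ^ n) + (\<alpha> + 1/2) / 2 * (c (Suc n) * z ^ n)
        = ((real n + 3/2) * (real n + \<alpha> + 3/2) * c (Suc n)) * z ^ n"
        by (simp add: diffs_def field_simps)
      then show ?thesis using struve_coeff_rec[OF assms(1), of n] by (simp add: c_def)
    qed
    with sums_add[OF sums_add[OF a b] d]
    have "(\<lambda>n. - (c n * z ^ n)) sums (z * S2 z + (\<alpha> + 2) * S1 z + (\<alpha> + 1/2) / 2 * (\<Sum>n. c (Suc n) * z ^ n))"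
      by simp
    moreover have "(\<lambda>n. - (c n * z ^ n)) sums (- S z)"
      unfolding Seq by (intro sums_minus summable_sums sm)
    ultimately show ?thesis by (rule sums_unique2)
  qed
  have 4: "z\<^sup>2 * S2 z + (\<alpha> + 2) * z * S1 z + (\<alpha> + 1/2) / 2 * S z
        = (\<alpha> + 1/2) / 2 * struve_coeff \<alpha> 0 - z * S z" for z
  proof -
    have "z * (\<Sum>n. c (Suc n) * z ^ n) = S z - c 0"
      using powser_split_head(2)[OF sm[of z]] by (simp add: Seq mult_ac)
    moreover have "z * (z * S2 z + (\<alpha> + 2) * S1 z + (\<alpha> + 1/2) / 2 * (\<Sum>n. c (Suc n) * z ^ n)) = - z * S z"
      by (simp only: 3)
    then have "z\<^sup>2 * S2 z + (\<alpha> + 2) * z * S1 z + (\<alpha> + 1/2) / 2 * (z * (\<Sum>n. c (Suc n) * z ^ n)) = - z * S z"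
      by (simp add: algebra_simps power2_eq_square)
    ultimately have "z\<^sup>2 * S2 z + (\<alpha> + 2) * z * S1 z + (\<alpha> + 1/2) / 2 * (S z - c 0) = - z * S z"
      by simp
    then show ?thesis unfolding c_def by (simp add: field_simps)
  qed
  from that[OF 1 2 4] show thesis .
qed

lemma struve_kernel_eq_series:
  assumes "s > 0"
  shows "struve_kernel \<alpha> s = 2 powr (-(\<alpha>+1)) * s powr (\<alpha> + 3/2) * struve_series \<alpha> (s\<^sup>2 / 4)"
proof -
  have "(s/2) ^ (2*k) = (s\<^sup>2/4)^k" for k
    by (simp add: power_mult power_divide)
  then have "(\<Sum>k. (-1) ^ k * (s / 2) ^ (2 * k) / (Gamma (real k + 3/2) * Gamma (real k + \<alpha> + 3/2)))
      = struve_series \<alpha> (s\<^sup>2 / 4)"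
    unfolding struve_series_def struve_coeff_def by (simp add: mult_ac)
  moreover have "s powr (1/2) * (s/2) powr (\<alpha>+1) = 2 powr (-(\<alpha>+1)) * s powr (\<alpha> + 3/2)"
  proof -
    have "(s/2) powr (\<alpha>+1) = s powr (\<alpha>+1) / 2 powr (\<alpha>+1)"
      by (rule powr_divide)
    also have "\<dots> = 2 powr (-(\<alpha>+1)) * s powr (\<alpha>+1)"
      by (simp only: powr_minus divide_inverse mult.commute)
    also have "s powr (1/2) * (2 powr (-(\<alpha>+1)) * s powr (\<alpha>+1))
        = 2 powr (-(\<alpha>+1)) * (s powr (1/2) * s powr (\<alpha>+1))"
      by (rule mult.left_commute)
    also have "s powr (1/2) * s powr (\<alpha>+1) = s powr (1/2 + (\<alpha>+1))"
      by (rule powr_add[symmetric])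
    also have "1/2 + (\<alpha>+1) = \<alpha> + 3/2" by simp
    finally show ?thesis .
  qed
  ultimately show ?thesis
    unfolding struve_kernel_def struve_H_def by (simp only: mult.assoc[symmetric])
qed

lemma powr_add_nat: "s > 0 \<Longrightarrow> s powr (a + real n) = s ^ n * s powr a"
  by (simp add: powr_add powr_realpow)

text \<open>
Struve's equation in Liouville normal form: multiplying by the square root removes the first-order
term. The inhomogeneity \<open>c * s powr (\<alpha> - 1/2)\<close> is the source of the non-oscillating part of the
kernel at infinity, and \<open>c\<close> is positive because \<open>\<alpha> > -1/2\<close>.
\<close>

lemma struve_kernel_ode:
  assumes "\<alpha> > -1/2"
  obtains c K1 where "c > 0"
    "\<And>s. s > 0 \<Longrightarrow> (struve_kernel \<alpha> has_real_derivative K1 s) (at s)"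
    "\<And>s. s > 0 \<Longrightarrow> (K1 has_real_derivative
        c * s powr (\<alpha> - 1/2) - struve_kernel \<alpha> s + (\<alpha>\<^sup>2 - 1/4) * struve_kernel \<alpha> s / s\<^sup>2) (at s)"
proof -
  define S where "S = struve_series \<alpha>"
  define \<kappa> where "\<kappa> = 2 powr (-(\<alpha>+1))"
  obtain S1 S2 where S: "\<And>z. (S has_real_derivative S1 z) (at z)" "\<And>z. (S1 has_real_derivative S2 z) (at z)"
    and ode: "\<And>z. z\<^sup>2 * S2 z + (\<alpha> + 2) * z * S1 z + (\<alpha> + 1/2) / 2 * S z
        = (\<alpha> + 1/2) / 2 * struve_coeff \<alpha> 0 - z * S z"
    using struve_series_ode[OF assms] unfolding S_def by blast
  have dS: "((\<lambda>s. S (s\<^sup>2/4)) has_real_derivative S1 (s\<^sup>2/4) * (s/2)) (at s)" for s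
    by (rule DERIV_chain2[OF S(1)]) (auto intro!: derivative_eq_intros)
  have dS1: "((\<lambda>s. S1 (s\<^sup>2/4)) has_real_derivative S2 (s\<^sup>2/4) * (s/2)) (at s)" for s
    by (rule DERIV_chain2[OF S(2)]) (auto intro!: derivative_eq_intros)
  define K1 where "K1 s = \<kappa> * ((\<alpha> + 3/2) * s powr (\<alpha> + 1/2) * S (s\<^sup>2/4)
     + 1/2 * s powr (\<alpha> + 5/2) * S1 (s\<^sup>2/4))" for s
  have Keq: "struve_kernel \<alpha> s = \<kappa> * s powr (\<alpha> + 3/2) * S (s\<^sup>2/4)" if "s > 0" for s
    using struve_kernel_eq_series[OF that] by (simp add: S_def \<kappa>_def)
  show thesis
  proof (rule that)
    show "2 * \<kappa> * struve_coeff \<alpha> 0 * (\<alpha> + 1/2) > 0"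
      using assms struve_coeff_0_pos[OF assms] by (auto simp: \<kappa>_def)
    fix s :: real assume s: "s > 0"
    have pw: "s powr (\<alpha> + 3/2) = s\<^sup>2 * s powr (\<alpha> - 1/2)" "s powr (\<alpha> + 1/2) = s * s powr (\<alpha> - 1/2)"
      "s powr (\<alpha> + 5/2) = s ^ 3 * s powr (\<alpha> - 1/2)"
      using powr_add_nat[OF s, of "\<alpha> - 1/2" 2] powr_add_nat[OF s, of "\<alpha> - 1/2" 1]
        powr_add_nat[OF s, of "\<alpha> - 1/2" 3] by (simp_all add: add.commute)
    have dp: "((\<lambda>s. s powr (a + 1)) has_real_derivative (a + 1) * s powr a) (at s)" for a
      using has_real_derivative_powr[OF s, of "a + 1"] by simp
    have d1: "((\<lambda>s. s powr (\<alpha> + 3/2)) has_real_derivative (\<alpha> + 3/2) * s powr (\<alpha> + 1/2)) (at s)"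
      using dp[of "\<alpha> + 1/2"] by (simp add: add.assoc)
    have d2: "((\<lambda>s. s powr (\<alpha> + 5/2)) has_real_derivative (\<alpha> + 5/2) * s powr (\<alpha> + 3/2)) (at s)"
      using dp[of "\<alpha> + 3/2"] by (simp add: add.assoc)
    have d0: "((\<lambda>s. s powr (\<alpha> + 1/2)) has_real_derivative (\<alpha> + 1/2) * s powr (\<alpha> - 1/2)) (at s)"
      using dp[of "\<alpha> - 1/2"] by (simp add: add.commute)
    have "((\<lambda>s. \<kappa> * (s powr (\<alpha> + 3/2) * S (s\<^sup>2/4))) has_real_derivative K1 s) (at s)"
      by (rule DERIV_cong[OF DERIV_cmult[OF DERIV_mult[OF d1 dS]]])
         (simp add: K1_def pw algebra_simps power3_eq_cube power2_eq_square)
    then show "(struve_kernel \<alpha> has_real_derivative K1 s) (at s)"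
      by (rule has_field_derivative_transform_within_open[where S="{0<..}"]) (use s Keq in auto)
    define P where "P = s powr (\<alpha> - 1/2)"
    have "(K1 has_real_derivative \<kappa> * (((\<alpha> + 3/2) * ((\<alpha> + 1/2) * P) * S (s\<^sup>2/4) + S1 (s\<^sup>2/4) * (s/2) * ((\<alpha> + 3/2) * (s * P)))
        + (1/2 * ((\<alpha> + 5/2) * (s\<^sup>2 * P)) * S1 (s\<^sup>2/4) + S2 (s\<^sup>2/4) * (s/2) * (1/2 * (s ^ 3 * P))))) (at s)"
      unfolding K1_def[abs_def] P_def pw(1)[symmetric] pw(2)[symmetric] pw(3)[symmetric]
      by (intro DERIV_cmult DERIV_add DERIV_mult d0 d1 d2 dS dS1)
    moreover have "\<kappa> * (((\<alpha> + 3/2) * ((\<alpha> + 1/2) * P) * S (s\<^sup>2/4) + S1 (s\<^sup>2/4) * (s/2) * ((\<alpha> + 3/2) * (s * P)))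
        + (1/2 * ((\<alpha> + 5/2) * (s\<^sup>2 * P)) * S1 (s\<^sup>2/4) + S2 (s\<^sup>2/4) * (s/2) * (1/2 * (s ^ 3 * P))))
      = (2 * \<kappa> * struve_coeff \<alpha> 0 * (\<alpha> + 1/2)) * P
       - struve_kernel \<alpha> s + (\<alpha>\<^sup>2 - 1/4) * struve_kernel \<alpha> s / s\<^sup>2" (is "?L = ?R")
    proof -
      define z A B C where "z = s\<^sup>2/4" and "A = S z" and "B = S1 z" and "C = S2 z"
      have sz: "s\<^sup>2 = 4 * z" by (simp add: z_def)
      have s4: "s * s ^ 3 = 16 * z\<^sup>2" by (simp add: z_def power2_eq_square power3_eq_cube)
      have "?L = \<kappa> * P * ((\<alpha> + 3/2) * (\<alpha> + 1/2) * A + (\<alpha> + 2) * s\<^sup>2 * B + (s * s ^ 3) / 4 * C)"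
        unfolding z_def[symmetric] A_def[symmetric] B_def[symmetric] C_def[symmetric]
        by (simp add: field_simps power2_eq_square power3_eq_cube)
      also have "\<dots> = \<kappa> * P * ((\<alpha> + 3/2) * (\<alpha> + 1/2) * A + 4 * (z\<^sup>2 * C + (\<alpha> + 2) * z * B))"
        unfolding sz s4 by (simp add: field_simps)
      also have "z\<^sup>2 * C + (\<alpha> + 2) * z * B = (\<alpha> + 1/2) / 2 * struve_coeff \<alpha> 0 - z * A - (\<alpha> + 1/2) / 2 * A"
        using ode[of z] unfolding A_def B_def C_def by linarith
      also have "\<kappa> * P * ((\<alpha> + 3/2) * (\<alpha> + 1/2) * A + 4 * ((\<alpha> + 1/2) / 2 * struve_coeff \<alpha> 0 - z * A - (\<alpha> + 1/2) / 2 * A))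
        = (2 * \<kappa> * struve_coeff \<alpha> 0 * (\<alpha> + 1/2)) * P - \<kappa> * (s\<^sup>2 * P) * A + (\<alpha>\<^sup>2 - 1/4) * (\<kappa> * P * A)"
        unfolding sz by (simp add: field_simps power2_eq_square)
      also have "\<kappa> * (s\<^sup>2 * P) * A = struve_kernel \<alpha> s"
        using Keq[OF s] by (simp add: pw P_def A_def z_def)
      also have "\<kappa> * P * A = struve_kernel \<alpha> s / s\<^sup>2"
        using Keq[OF s] s by (simp add: pw P_def A_def z_def)
      finally show ?thesis by simp
    qed
    ultimately show "(K1 has_real_derivative (2 * \<kappa> * struve_coeff \<alpha> 0 * (\<alpha> + 1/2)) * s powr (\<alpha> - 1/2)
       - struve_kernel \<alpha> s + (\<alpha>\<^sup>2 - 1/4) * struve_kernel \<alpha> s / s\<^sup>2) (at s)"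
      unfolding P_def by simp
  qed
qed

section \<open>The Struve kernel at zero and at infinity\<close>

lemma continuous_on_struve_kernel:
  assumes "\<alpha> > -1/2"
  shows "continuous_on {0<..} (struve_kernel \<alpha>)"
proof -
  obtain c K1 where "c > 0" "\<And>s. s > 0 \<Longrightarrow> (struve_kernel \<alpha> has_real_derivative K1 s) (at s)"
    "\<And>s. s > 0 \<Longrightarrow> (K1 has_real_derivative
        c * s powr (\<alpha> - 1/2) - struve_kernel \<alpha> s + (\<alpha>\<^sup>2 - 1/4) * struve_kernel \<alpha> s / s\<^sup>2) (at s)"
    using struve_kernel_ode[OF assms] by blast
  then show ?thesis
    by (intro continuous_at_imp_continuous_on ballI) (auto intro: DERIV_isCont)
qed

lemma struve_kernel_near_0:
  assumes "\<alpha> > -1/2"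
  obtains B b s0 where "B > 0" "b > 0" "s0 > 0"
    "\<forall>s. 0 < s \<and> s \<le> 1 \<longrightarrow> \<bar>struve_kernel \<alpha> s\<bar> \<le> B * s powr (\<alpha> + 3/2)"
    "\<forall>s. 0 < s \<and> s \<le> s0 \<longrightarrow> b * s powr (\<alpha> + 3/2) \<le> struve_kernel \<alpha> s"
proof -
  define S where "S s = struve_series \<alpha> (s\<^sup>2 / 4)" for s
  have "isCont (struve_series \<alpha>) z" for z
    using struve_series_DERIV[OF assms] by (rule DERIV_isCont)
  then have cS: "isCont S s" for s
    unfolding S_def[abs_def] by (intro continuous_intros isCont_o2[of _ "\<lambda>s. s\<^sup>2/4"]) auto
  have S0: "S 0 > 0"
    using struve_coeff_0_pos[OF assms] by (simp add: S_def struve_series_def powser_zero[of "struve_coeff \<alpha>"])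
  have "continuous_on {0..1} S" using cS by (simp add: continuous_at_imp_continuous_on)
  then have "compact (S ` {0..1})" by (intro compact_continuous_image) auto
  then obtain B where B: "B > 0" "\<And>s. s \<in> {0..1} \<Longrightarrow> \<bar>S s\<bar> \<le> B"
    using compact_imp_bounded bounded_pos by (metis (no_types, lifting) image_eqI real_norm_def)
  have "eventually (\<lambda>s. S s > S 0 / 2) (at 0)"
    using cS[of 0] S0 unfolding isCont_def by (intro order_tendstoD(1)) auto
  then obtain s0 where s0: "s0 > 0" "\<And>s. s \<noteq> 0 \<Longrightarrow> dist s 0 < s0 \<Longrightarrow> S s > S 0 / 2"
    unfolding eventually_at by auto
  define \<kappa> where "\<kappa> = 2 powr (-(\<alpha>+1))"
  have \<kappa>: "\<kappa> > 0" by (simp add: \<kappa>_def)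
  have K: "struve_kernel \<alpha> s = \<kappa> * S s * s powr (\<alpha> + 3/2)" if "s > 0" for s
    using struve_kernel_eq_series[OF that] by (simp add: S_def \<kappa>_def)
  show thesis
  proof (rule that[of "\<kappa> * B" "\<kappa> * (S 0 / 2)" "s0 / 2"])
    show "\<kappa> * B > 0" "\<kappa> * (S 0 / 2) > 0" "s0 / 2 > 0" using \<kappa> B S0 s0 by auto
    show "\<forall>s. 0 < s \<and> s \<le> 1 \<longrightarrow> \<bar>struve_kernel \<alpha> s\<bar> \<le> \<kappa> * B * s powr (\<alpha> + 3/2)"
      using \<kappa> B(2) by (auto simp: K abs_mult intro!: mult_right_mono mult_left_mono)
    show "\<forall>s. 0 < s \<and> s \<le> s0 / 2 \<longrightarrow> \<kappa> * (S 0 / 2) * s powr (\<alpha> + 3/2) \<le> struve_kernel \<alpha> s"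
    proof (intro allI impI)
      fix s assume "0 < s \<and> s \<le> s0 / 2"
      then show "\<kappa> * (S 0 / 2) * s powr (\<alpha> + 3/2) \<le> struve_kernel \<alpha> s"
        using \<kappa> s0(2)[of s] s0(1) K[of s] by (auto intro!: mult_right_mono mult_left_mono)
    qed
  qed
qed

text \<open>
Subtracting from the kernel \<open>K\<close> the leading term \<open>c * s powr (\<alpha> - 1/2)\<close> of the inhomogeneity leaves
\<open>w\<close> with \<open>w'' + w = r\<close>, where \<open>r = (d w + e s powr (\<alpha> - 1/2)) / s\<^sup>2\<close>. Hence the energy
\<open>E = w\<^sup>2 + w'\<^sup>2\<close> has \<open>E' = 2 w' r \<le> m E / s\<^sup>2 + \<bar>e\<bar> s powr (2 \<alpha> - 1) / s\<^sup>2\<close>. The factor \<open>m / s\<^sup>2\<close> is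
integrable at infinity, so Gronwall's argument costs only a constant, and the last term integrates to
at most a multiple of \<open>\<rho>\<^sup>2\<close>.
\<close>

lemma struve_kernel_asymptotics:
  assumes "\<alpha> > -1/2"
  defines "\<rho> \<equiv> \<lambda>s. max 1 (s powr (\<alpha> - 1/2))"
  obtains c w w1 r B where "c > 0" "B > 0"
    "\<forall>s>0. struve_kernel \<alpha> s = c * s powr (\<alpha> - 1/2) + w s"
    "\<forall>s>0. (w has_real_derivative w1 s) (at s)"
    "\<forall>s>0. (w1 has_real_derivative - w s + r s) (at s)"
    "continuous_on {0<..} r"
    "\<forall>s\<ge>1. \<bar>w s\<bar> \<le> B * \<rho> s"
    "\<forall>s\<ge>1. \<bar>w1 s\<bar> \<le> B * \<rho> s"
    "\<forall>s\<ge>1. \<bar>r s\<bar> \<le> B * \<rho> s / s\<^sup>2"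
proof -
  obtain c K1 where c: "c > 0"
    and K1: "\<And>s. s > 0 \<Longrightarrow> (struve_kernel \<alpha> has_real_derivative K1 s) (at s)"
    and K2: "\<And>s. s > 0 \<Longrightarrow> (K1 has_real_derivative
        c * s powr (\<alpha> - 1/2) - struve_kernel \<alpha> s + (\<alpha>\<^sup>2 - 1/4) * struve_kernel \<alpha> s / s\<^sup>2) (at s)"
    using struve_kernel_ode[OF assms(1)] by blast
  define d where "d = \<alpha>\<^sup>2 - 1/4"
  define e where "e = 2 * c * (\<alpha> - 1/2)"
  define p where "p s = s powr (\<alpha> - 1/2)" for s
  define w where "w s = struve_kernel \<alpha> s - c * p s" for s
  define w1 where "w1 s = K1 s - c * ((\<alpha> - 1/2) * s powr (\<alpha> - 3/2))" for s
  define r where "r s = (d * w s + e * p s) / s\<^sup>2" for s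
  define m where "m = \<bar>d\<bar> + \<bar>e\<bar>"
  have dp: "((\<lambda>s. s powr (a + 1)) has_real_derivative (a + 1) * s powr a) (at s)" if "s > 0" for a s
    using has_real_derivative_powr[OF that, of "a + 1"] by simp
  have dw: "(w has_real_derivative w1 s) (at s)" if "s > 0" for s
  proof -
    have "(p has_real_derivative (\<alpha> - 1/2) * s powr (\<alpha> - 3/2)) (at s)"
      using dp[OF that, of "\<alpha> - 3/2"] by (simp add: p_def[abs_def])
    then show ?thesis unfolding w_def[abs_def] w1_def by (intro DERIV_diff DERIV_cmult K1 that)
  qed
  have dw1: "(w1 has_real_derivative - w s + r s) (at s)" if s: "s > 0" for s
  proof -
    have "((\<lambda>s. s powr (\<alpha> - 3/2)) has_real_derivative (\<alpha> - 3/2) * s powr (\<alpha> - 5/2)) (at s)"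
      using dp[OF that, of "\<alpha> - 5/2"] by simp
    then have "(w1 has_real_derivative c * s powr (\<alpha> - 1/2) - struve_kernel \<alpha> s + (\<alpha>\<^sup>2 - 1/4) * struve_kernel \<alpha> s / s\<^sup>2
        - c * ((\<alpha> - 1/2) * ((\<alpha> - 3/2) * s powr (\<alpha> - 5/2)))) (at s)"
      unfolding w1_def[abs_def] by (intro DERIV_diff DERIV_cmult K2 that)
    moreover have "s powr (\<alpha> - 5/2) = p s / s\<^sup>2"
      using powr_add_nat[OF s, of "\<alpha> - 5/2" 2] s by (simp add: p_def)
    then have "c * s powr (\<alpha> - 1/2) - struve_kernel \<alpha> s + (\<alpha>\<^sup>2 - 1/4) * struve_kernel \<alpha> s / s\<^sup>2
        - c * ((\<alpha> - 1/2) * ((\<alpha> - 3/2) * s powr (\<alpha> - 5/2)))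
       = - w s + (d * (w s + c * p s) - c * ((\<alpha> - 1/2) * (\<alpha> - 3/2)) * p s) / s\<^sup>2"
      by (simp add: w_def p_def[symmetric] d_def diff_divide_distrib)
    also have "d * (w s + c * p s) - c * ((\<alpha> - 1/2) * (\<alpha> - 3/2)) * p s = d * w s + e * p s"
      by (simp add: d_def e_def field_simps power2_eq_square)
    ultimately show ?thesis by (simp add: r_def)
  qed
  have pos: "p s \<ge> 0" for s by (simp add: p_def)
  have \<rho>p: "p s \<le> \<rho> s" "\<rho> s \<ge> 1" for s by (auto simp: \<rho>_def p_def)
  define E where "E s = (w s)\<^sup>2 + (w1 s)\<^sup>2" for s
  have dE: "(E has_real_derivative 2 * w1 s * r s) (at s)" if "s > 0" for s
    unfolding E_def[abs_def]
    by (rule derivative_eq_intros dw[OF that] dw1[OF that] refl)+ (simp add: algebra_simps)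
  have E'_le: "2 * w1 s * r s \<le> m * E s / s\<^sup>2 + \<bar>e\<bar> * (p s)\<^sup>2 / s\<^sup>2" if "s > 0" for s
  proof -
    have "2 * w1 s * w s \<le> E s" "- (2 * w1 s * w s) \<le> E s"
      using sum_squares_bound[of "w1 s" "w s"] sum_squares_bound[of "w1 s" "- w s"] by (auto simp: E_def)
    then have "\<bar>2 * w1 s * w s\<bar> \<le> E s" by linarith
    then have "\<bar>d\<bar> * \<bar>2 * w1 s * w s\<bar> \<le> \<bar>d\<bar> * E s" by (intro mult_left_mono) auto
    then have a: "d * (2 * w1 s * w s) \<le> \<bar>d\<bar> * E s"
      by (metis abs_ge_self abs_mult order_trans)
    have "2 * w1 s * p s \<le> E s + (p s)\<^sup>2" "- (2 * w1 s * p s) \<le> E s + (p s)\<^sup>2"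
      using add_increasing[OF zero_le_power2[of "w s"] sum_squares_bound[of "w1 s" "p s"]]
        add_increasing[OF zero_le_power2[of "w s"] sum_squares_bound[of "w1 s" "- p s"]]
      unfolding E_def by (simp_all add: add.assoc)
    then have "\<bar>2 * w1 s * p s\<bar> \<le> E s + (p s)\<^sup>2" by linarith
    then have "\<bar>e\<bar> * \<bar>2 * w1 s * p s\<bar> \<le> \<bar>e\<bar> * (E s + (p s)\<^sup>2)" by (intro mult_left_mono) auto
    then have b: "e * (2 * w1 s * p s) \<le> \<bar>e\<bar> * (E s + (p s)\<^sup>2)"
      by (metis abs_ge_self abs_mult order_trans)
    have "2 * w1 s * r s = (d * (2 * w1 s * w s) + e * (2 * w1 s * p s)) / s\<^sup>2"
      by (simp add: r_def field_simps)
    also have "\<dots> \<le> (m * E s + \<bar>e\<bar> * (p s)\<^sup>2) / s\<^sup>2"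
      using a b by (intro divide_right_mono) (auto simp: m_def algebra_simps)
    finally show ?thesis by (simp add: add_divide_distrib)
  qed
  \<comment> \<open>A primitive of a majorant of the forcing term, comparable with the square of rho.\<close>
  obtain U U' u where U: "\<And>s. s \<ge> 1 \<Longrightarrow> (U has_real_derivative U' s) (at s)" "\<And>s. s \<ge> 1 \<Longrightarrow> (p s)\<^sup>2 / s\<^sup>2 \<le> U' s"
      "\<And>s. s \<ge> 1 \<Longrightarrow> U s \<le> u * (\<rho> s)\<^sup>2" "U 1 \<ge> 0" "u \<ge> 0"
  proof (cases "\<alpha> \<le> 1/2")
    case True
    show thesis
    proof (rule that[of "\<lambda>s. 1 - 1/s" "\<lambda>s. 1/s\<^sup>2" 1])
      fix s :: real assume s: "s \<ge> 1"
      show "((\<lambda>s. 1 - 1/s) has_real_derivative 1 / s\<^sup>2) (at s)"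
        using s by (auto intro!: derivative_eq_intros simp: power2_eq_square field_simps)
      have "p s \<le> s powr 0" unfolding p_def by (intro powr_mono) (use True s in auto)
      then have "p s \<le> 1" using s by simp
      then show "(p s)\<^sup>2 / s\<^sup>2 \<le> 1 / s\<^sup>2" using pos[of s] by (intro divide_right_mono) (auto simp: power_le_one)
      have "1 \<le> (\<rho> s)\<^sup>2" using \<rho>p(2)[of s] by (simp add: one_le_power)
      moreover have "1 - 1/s \<le> 1" using s by simp
      ultimately show "1 - 1/s \<le> 1 * (\<rho> s)\<^sup>2" by linarith
    qed auto
  next
    case False
    show thesis
    proof (rule that[of "\<lambda>s. s powr (2*\<alpha>-1) / (2*\<alpha>-1)" "\<lambda>s. s powr (2*\<alpha>-2)" "1/(2*\<alpha>-1)"])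
      fix s :: real assume s: "s \<ge> 1"
      show "((\<lambda>s. s powr (2*\<alpha>-1) / (2*\<alpha>-1)) has_real_derivative s powr (2*\<alpha>-2)) (at s)"
        using False dp[of s "2*\<alpha>-2"] s DERIV_cdivide[of "\<lambda>s. s powr (2*\<alpha>-1)" "(2*\<alpha>-1) * s powr (2*\<alpha>-2)" s UNIV "2*\<alpha>-1"]
        by simp
      have p2: "(p s)\<^sup>2 = s powr (2*\<alpha>-1)"
        using s by (simp add: p_def power2_eq_square flip: powr_add)
      have "(p s)\<^sup>2 / s\<^sup>2 \<le> (p s)\<^sup>2 / s"
        using s by (intro divide_left_mono) (auto simp: power2_eq_square)
      also have "(p s)\<^sup>2 / s = s powr (2*\<alpha>-2)"
        unfolding p2 using powr_add_nat[of s "2*\<alpha>-2" 1] s by simp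
      finally show "(p s)\<^sup>2 / s\<^sup>2 \<le> s powr (2*\<alpha>-2)" .
      have "(p s)\<^sup>2 \<le> (\<rho> s)\<^sup>2" using \<rho>p[of s] pos[of s] by (intro power_mono)
      then show "s powr (2*\<alpha>-1) / (2*\<alpha>-1) \<le> 1/(2*\<alpha>-1) * (\<rho> s)\<^sup>2"
        using False unfolding p2 by (simp add: divide_right_mono)
    qed (use False in auto)
  qed
  \<comment> \<open>The factor exp (m / s) absorbs the term m E / s^2, so this function is nonincreasing.\<close>
  define V where "V s = E s * exp (m / s) - \<bar>e\<bar> * exp m * U s" for s
  have m0: "m \<ge> 0" by (simp add: m_def)
  have E0: "E s \<ge> 0" for s by (simp add: E_def)
  have dV: "\<exists>y. (V has_real_derivative y) (at s) \<and> y \<le> 0" if s: "s \<ge> 1" for s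
  proof (intro exI conjI)
    have s0: "s > 0" using s by simp
    have "((\<lambda>s. exp (m / s)) has_real_derivative - (m / s\<^sup>2) * exp (m / s)) (at s)"
      using s0 by (auto intro!: derivative_eq_intros simp: power2_eq_square field_simps)
    from DERIV_diff[OF DERIV_mult[OF dE[OF s0] this] DERIV_cmult[OF U(1)[OF s], of "\<bar>e\<bar> * exp m"]]
    show "(V has_real_derivative (2 * w1 s * r s - m * E s / s\<^sup>2) * exp (m / s) - \<bar>e\<bar> * exp m * U' s) (at s)"
      unfolding V_def[abs_def] by (rule DERIV_cong) (simp add: algebra_simps)
    have "(2 * w1 s * r s - m * E s / s\<^sup>2) * exp (m / s) \<le> \<bar>e\<bar> * ((p s)\<^sup>2 / s\<^sup>2) * exp (m / s)"
      using E'_le[OF s0] by (intro mult_right_mono) auto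
    also have "\<dots> \<le> \<bar>e\<bar> * U' s * exp m"
      using U(2)[OF s] s m0 order_trans[OF _ U(2)[OF s]]
      by (intro mult_mono mult_left_mono mult_nonneg_nonneg) (auto simp: divide_le_eq mult_le_cancel_left1)
    finally show "(2 * w1 s * r s - m * E s / s\<^sup>2) * exp (m / s) - \<bar>e\<bar> * exp m * U' s \<le> 0"
      by (simp add: mult_ac)
  qed
  define B2 where "B2 = E 1 * exp m + \<bar>e\<bar> * exp m * u"
  have B2: "B2 \<ge> 0" using E0 U(5) by (simp add: B2_def)
  have EB: "E s \<le> B2 * (\<rho> s)\<^sup>2" if s: "s \<ge> 1" for s
  proof -
    have "V s \<le> V 1" by (rule DERIV_nonpos_imp_nonincreasing[OF s]) (use dV in auto)
    also have "\<dots> \<le> E 1 * exp m" using U(4) by (simp add: V_def)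
    finally have "E s * exp (m / s) \<le> E 1 * exp m + \<bar>e\<bar> * exp m * U s" by (simp add: V_def)
    moreover have "E s * 1 \<le> E s * exp (m / s)" using m0 s E0 by (intro mult_left_mono) auto
    moreover have "\<bar>e\<bar> * exp m * U s \<le> \<bar>e\<bar> * exp m * (u * (\<rho> s)\<^sup>2)" using U(3)[OF s] by (intro mult_left_mono) auto
    moreover have "E 1 * exp m * 1 \<le> E 1 * exp m * (\<rho> s)\<^sup>2" using \<rho>p(2)[of s] E0 by (intro mult_left_mono) (auto simp: one_le_power)
    ultimately show ?thesis by (simp add: B2_def algebra_simps)
  qed
  define B0 where "B0 = sqrt B2"
  have B0: "\<bar>w s\<bar> \<le> B0 * \<rho> s" "\<bar>w1 s\<bar> \<le> B0 * \<rho> s" "B0 \<ge> 0" if s: "s \<ge> 1" for s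
  proof -
    have b: "B0 \<ge> 0" "(B0 * \<rho> s)\<^sup>2 = B2 * (\<rho> s)\<^sup>2" "B0 * \<rho> s \<ge> 0"
      using B2 \<rho>p(2)[of s] by (auto simp: B0_def power_mult_distrib)
    have "(w s)\<^sup>2 \<le> (B0 * \<rho> s)\<^sup>2" "(w1 s)\<^sup>2 \<le> (B0 * \<rho> s)\<^sup>2"
      using EB[OF s] b(2) zero_le_power2[of "w s"] zero_le_power2[of "w1 s"] unfolding E_def by linarith+
    then show "\<bar>w s\<bar> \<le> B0 * \<rho> s" "\<bar>w1 s\<bar> \<le> B0 * \<rho> s" "B0 \<ge> 0"
      using b abs_le_square_iff[of "w s" "B0 * \<rho> s"] abs_le_square_iff[of "w1 s" "B0 * \<rho> s"] by auto
  qed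
  define B where "B = (\<bar>d\<bar> + 1) * B0 + \<bar>e\<bar> + 1"
  have "B0 \<ge> 0" using B0(3)[of 1] by simp
  then have "\<bar>d\<bar> * B0 \<ge> 0" by simp
  with \<open>B0 \<ge> 0\<close> have BB: "B0 \<le> B" "\<bar>d\<bar> * B0 + \<bar>e\<bar> \<le> B" "B > 0"
    unfolding B_def distrib_right using abs_ge_zero[of e] by (simp_all only: mult_1)
  have \<rho>0: "\<rho> s \<ge> 0" for s using \<rho>p(2)[of s] by simp
  have b: "\<bar>w s\<bar> \<le> B * \<rho> s" "\<bar>w1 s\<bar> \<le> B * \<rho> s" "\<bar>r s\<bar> \<le> B * \<rho> s / s\<^sup>2" if s: "s \<ge> 1" for s
  proof -
    have "B0 * \<rho> s \<le> B * \<rho> s" using BB \<rho>0 by (intro mult_right_mono) auto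
    then show "\<bar>w s\<bar> \<le> B * \<rho> s" "\<bar>w1 s\<bar> \<le> B * \<rho> s" using B0[OF s] by linarith+
    have "\<bar>d * w s + e * p s\<bar> \<le> \<bar>d\<bar> * \<bar>w s\<bar> + \<bar>e\<bar> * p s"
      using pos[of s] by (metis abs_mult abs_of_nonneg abs_triangle_ineq)
    also have "\<dots> \<le> \<bar>d\<bar> * (B0 * \<rho> s) + \<bar>e\<bar> * \<rho> s"
      using B0(1)[OF s] \<rho>p(1)[of s] by (intro add_mono mult_left_mono) auto
    also have "\<dots> = (\<bar>d\<bar> * B0 + \<bar>e\<bar>) * \<rho> s" by (simp add: algebra_simps)
    also have "\<dots> \<le> B * \<rho> s" using BB \<rho>0 by (intro mult_right_mono) auto
    finally show "\<bar>r s\<bar> \<le> B * \<rho> s / s\<^sup>2"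
      unfolding r_def by (simp add: abs_divide divide_right_mono)
  qed
  have "continuous_on {0<..} w"
    using dw by (intro continuous_at_imp_continuous_on ballI) (auto intro: DERIV_isCont)
  then have "continuous_on {0<..} r"
    unfolding r_def[abs_def] p_def by (auto intro!: continuous_intros)
  moreover have "struve_kernel \<alpha> s = c * s powr (\<alpha> - 1/2) + w s" for s by (simp add: w_def p_def)
  ultimately show thesis
    using that[of c B w w1 r] c BB(3) b dw dw1 by simp
qed

text \<open>
Beyond \<open>1\<close> the kernel is the sum of an oscillating part \<open>\<phi>\<close>, which has a bounded primitive, and a part
that is absolutely dominated by \<open>s powr (\<alpha> - 1/2)\<close>. For \<open>\<alpha> \<le> 1/2\<close> the remainder \<open>w\<close> is merely bounded,
which is too big when \<open>\<alpha> < 1/2\<close>; but \<open>w - r = - w''\<close> has the bounded primitive \<open>- w'\<close>, and \<open>r\<close> is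
small. For \<open>\<alpha> > 1/2\<close> the whole kernel is dominated and nothing has to oscillate.
\<close>

lemma struve_kernel_split:
  assumes "\<alpha> > -1/2"
  obtains \<phi> \<Phi> B where "B > 0"
    "continuous_on {0<..} \<phi>"
    "\<forall>s>0. (\<Phi> has_real_derivative \<phi> s) (at s)"
    "\<forall>s\<ge>1. \<bar>\<Phi> s\<bar> \<le> B"
    "\<forall>s\<ge>1. \<bar>struve_kernel \<alpha> s - \<phi> s\<bar> \<le> B * s powr (\<alpha> - 1/2)"
proof -
  obtain c w w1 r B where c: "c > 0" "B > 0"
    and K: "\<forall>s>0. struve_kernel \<alpha> s = c * s powr (\<alpha> - 1/2) + w s"
    and w: "\<forall>s>0. (w has_real_derivative w1 s) (at s)"
      "\<forall>s>0. (w1 has_real_derivative - w s + r s) (at s)"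
    and r: "continuous_on {0<..} r"
    and b: "\<forall>s\<ge>1. \<bar>w s\<bar> \<le> B * max 1 (s powr (\<alpha> - 1/2))"
    "\<forall>s\<ge>1. \<bar>w1 s\<bar> \<le> B * max 1 (s powr (\<alpha> - 1/2))"
    "\<forall>s\<ge>1. \<bar>r s\<bar> \<le> B * max 1 (s powr (\<alpha> - 1/2)) / s\<^sup>2"
    by (rule struve_kernel_asymptotics[OF assms]) (rule that)
  show thesis
  proof (cases "\<alpha> \<le> 1/2")
    case True
    have le1: "s powr (\<alpha> - 1/2) \<le> 1" if "s \<ge> 1" for s :: real
    proof -
      have "s powr (\<alpha> - 1/2) \<le> s powr 0" by (intro powr_mono) (use True that in auto)
      then show ?thesis using that by simp
    qed
    show thesis
    proof (rule that[of "c + B" "\<lambda>s. w s - r s" "\<lambda>s. - w1 s"])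
      show "c + B > 0" using c by simp
      have "continuous_on {0<..} w"
        using w(1) by (intro continuous_at_imp_continuous_on ballI) (auto intro: DERIV_isCont)
      then show "continuous_on {0<..} (\<lambda>s. w s - r s)" by (intro continuous_intros r)
      show "\<forall>s>0. ((\<lambda>s. - w1 s) has_real_derivative w s - r s) (at s)"
        using DERIV_minus w(2) by fastforce
    next
      show "\<forall>s\<ge>1. \<bar>- w1 s\<bar> \<le> c + B"
      proof (intro allI impI)
        fix s :: real assume s: "s \<ge> 1"
        show "\<bar>- w1 s\<bar> \<le> c + B" using b(2)[rule_format, OF s] le1[OF s] c by (simp add: max_def split: if_splits)
      qed
    next
      show "\<forall>s\<ge>1. \<bar>struve_kernel \<alpha> s - (w s - r s)\<bar> \<le> (c + B) * s powr (\<alpha> - 1/2)"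
      proof (intro allI impI)
        fix s :: real assume s: "s \<ge> 1"
        have "s powr (-2) \<le> s powr (\<alpha> - 1/2)" using assms s by (intro powr_mono) auto
        moreover have "s powr (-2) = 1 / s\<^sup>2" using s by (simp add: powr_minus_divide)
        ultimately have "1 / s\<^sup>2 \<le> s powr (\<alpha> - 1/2)" by simp
        then have "B * (1 / s\<^sup>2) \<le> B * s powr (\<alpha> - 1/2)" using c by (intro mult_left_mono) auto
        moreover have "\<bar>r s\<bar> \<le> B / s\<^sup>2" using b(3)[rule_format, OF s] le1[OF s] by (simp add: max_def split: if_splits)
        ultimately have "\<bar>r s\<bar> \<le> B * s powr (\<alpha> - 1/2)" by simp
        moreover have "struve_kernel \<alpha> s - (w s - r s) = c * s powr (\<alpha> - 1/2) + r s"
          using K[rule_format, of s] s by simp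
        moreover have "\<bar>c * s powr (\<alpha> - 1/2)\<bar> = c * s powr (\<alpha> - 1/2)" using c by simp
        ultimately show "\<bar>struve_kernel \<alpha> s - (w s - r s)\<bar> \<le> (c + B) * s powr (\<alpha> - 1/2)"
          using abs_triangle_ineq[of "c * s powr (\<alpha> - 1/2)" "r s"] by (simp add: algebra_simps)
      qed
    qed
  next
    case False
    show thesis
    proof (rule that[of "c + B" "\<lambda>s. 0" "\<lambda>s. 0"])
      show "\<forall>s\<ge>1. \<bar>struve_kernel \<alpha> s - 0\<bar> \<le> (c + B) * s powr (\<alpha> - 1/2)"
      proof (intro allI impI)
        fix s :: real assume s: "s \<ge> 1"
        have "s powr 0 \<le> s powr (\<alpha> - 1/2)" by (intro powr_mono) (use False s in auto)
        then have "max 1 (s powr (\<alpha> - 1/2)) = s powr (\<alpha> - 1/2)" using s by simp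
        then show "\<bar>struve_kernel \<alpha> s - 0\<bar> \<le> (c + B) * s powr (\<alpha> - 1/2)"
          using K[rule_format, of s] s b(1)[rule_format, OF s] c abs_triangle_ineq[of "c * s powr (\<alpha> - 1/2)" "w s"]
          by (simp add: algebra_simps)
      qed
    qed (use c in auto)
  qed
qed

section \<open>Functions of bounded variation\<close>

lemma total_var_upper:
  assumes "mono t" "range t \<subseteq> {a..b}"
  shows "(\<Sum>i<n. ennreal (norm (f (t (Suc i)) - f (t i)))) \<le> total_var f a b"
  unfolding total_var_def using assms by (intro SUP_upper2[of "(n, t)"]) auto

lemma total_var_mono: "a \<le> a' \<Longrightarrow> b' \<le> b \<Longrightarrow> total_var f a' b' \<le> total_var f a b"
  unfolding total_var_def by (rule SUP_subset_mono) fastforce+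

text \<open>
A partition need not contain \<open>b\<close>. Cutting its points off at \<open>b\<close> from above and from below gives
partitions of the two halves, and only the step that crosses \<open>b\<close> needs the triangle inequality.
\<close>

lemma total_var_subadd:
  assumes "a \<le> b" "b \<le> c"
  shows "total_var f a c \<le> total_var f a b + total_var f b c"
  unfolding total_var_def[of f a c]
proof (rule SUP_least, clarify)
  fix n :: nat and t :: "nat \<Rightarrow> real" assume t: "mono t" "range t \<subseteq> {a..c}"
  have r: "a \<le> t i" "t i \<le> c" for i using t(2) by (auto simp: image_subset_iff)
  have step: "norm (f (t (Suc i)) - f (t i)) \<le> norm (f (min b (t (Suc i))) - f (min b (t i)))
      + norm (f (max b (t (Suc i))) - f (max b (t i)))" for i
  proof -
    have ti: "t i \<le> t (Suc i)" using t(1) by (simp add: mono_def)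
    show ?thesis
    proof (cases "t i \<le> b \<and> b \<le> t (Suc i)")
      case True
      then show ?thesis
        using norm_triangle_ineq[of "f b - f (t i)" "f (t (Suc i)) - f b"] by (simp add: min_def max_def)
    next
      case False
      then have "t (Suc i) < b \<or> b < t i" using ti by linarith
      then show ?thesis using ti by (auto simp: min_def max_def)
    qed
  qed
  have "(\<Sum>i<n. ennreal (norm (f (t (Suc i)) - f (t i))))
      \<le> (\<Sum>i<n. ennreal (norm (f (min b (t (Suc i))) - f (min b (t i))))
        + ennreal (norm (f (max b (t (Suc i))) - f (max b (t i)))))"
    by (intro sum_mono) (simp add: step flip: ennreal_plus)
  also have "\<dots> \<le> total_var f a b + total_var f b c"
    unfolding sum.distrib
  proof (intro add_mono)
    show "(\<Sum>i<n. ennreal (norm (f (min b (t (Suc i))) - f (min b (t i))))) \<le> total_var f a b"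
      using r assms t(1) by (intro total_var_upper[of "\<lambda>i. min b (t i)"]) (auto simp: mono_def min.coboundedI2)
    show "(\<Sum>i<n. ennreal (norm (f (max b (t (Suc i))) - f (max b (t i))))) \<le> total_var f b c"
      using r assms t(1) by (intro total_var_upper[of "\<lambda>i. max b (t i)"]) (auto simp: mono_def max.coboundedI2)
  qed
  finally show "(\<Sum>i<n. ennreal (norm (f (t (Suc i)) - f (t i)))) \<le> total_var f a b + total_var f b c" .
qed

text \<open>
Appending the points \<open>x\<close> and \<open>y\<close> to a partition of \<open>[a,x]\<close> adds the increment to its sum.
\<close>

lemma total_var_append:
  assumes "a \<le> x" "x \<le> y"
  shows "total_var f a x + ennreal (norm (f y - f x)) \<le> total_var f a y"
proof -
  let ?S = "{(n :: nat, t :: nat \<Rightarrow> real). mono t \<and> range t \<subseteq> {a..x}}"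
  have ne: "?S \<noteq> {}" using assms by (auto simp: mono_def intro!: exI[of _ "\<lambda>_. a"])
  have "total_var f a x + ennreal (norm (f y - f x)) =
    (SUP p\<in>?S. (case p of (n, t) \<Rightarrow> \<Sum>i<n. ennreal (norm (f (t (Suc i)) - f (t i)))) + ennreal (norm (f y - f x)))"
    unfolding total_var_def by (rule ennreal_SUP_add_left[symmetric, OF ne])
  also have "\<dots> \<le> total_var f a y"
  proof (rule SUP_least, clarify)
    fix n :: nat and t :: "nat \<Rightarrow> real" assume t: "mono t" "range t \<subseteq> {a..x}"
    have r: "a \<le> t i" "t i \<le> x" for i using t(2) by (auto simp: image_subset_iff)
    define u where "u i = (if i \<le> n then t i else if i = Suc n then x else y)" for i
    have u: "mono u" "range u \<subseteq> {a..y}"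
      using r assms t(1) order_trans[OF r(2) assms(2)] by (auto simp: mono_def u_def)
    have "(\<Sum>i<n. ennreal (norm (f (t (Suc i)) - f (t i)))) + ennreal (norm (f y - f x))
      \<le> (\<Sum>i<Suc (Suc n). ennreal (norm (f (u (Suc i)) - f (u i))))"
      by (simp add: u_def add_right_mono)
    also have "\<dots> \<le> total_var f a y" by (rule total_var_upper[OF u])
    finally show "(\<Sum>i<n. ennreal (norm (f (t (Suc i)) - f (t i)))) + ennreal (norm (f y - f x)) \<le> total_var f a y" .
  qed
  finally show ?thesis .
qed

text \<open>
The increments of the variation function dominate those of \<open>f\<close>. This is the only form in which bounded
variation enters the measurability and the oscillation estimates below.
\<close>

lemma variation_function:
  assumes "total_var f a b < \<infinity>"
  defines "v \<equiv> \<lambda>x. enn2real (total_var f a x)"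
  assumes "a \<le> x" "x \<le> y" "y \<le> b"
  shows "norm (f y - f x) \<le> v y - v x"
proof -
  have fin: "total_var f a z < \<infinity>" if "z \<le> b" for z
    using total_var_mono[of a a z b f] that assms(1) by (simp add: order_le_less_trans)
  have eq: "ennreal (v z) = total_var f a z" if "z \<le> b" for z
    using fin[OF that] by (simp add: v_def)
  have v0: "v z \<ge> 0" for z by (simp add: v_def)
  have "ennreal (v x) + ennreal (norm (f y - f x)) \<le> ennreal (v y)"
    using total_var_append[of a x y f] assms eq[of x] eq[of y] by simp
  then have "ennreal (v x + norm (f y - f x)) \<le> ennreal (v y)" by (simp add: v0)
  then have "v x + norm (f y - f x) \<le> v y" using v0 by (subst (asm) ennreal_le_iff) auto
  then show ?thesis by simp
qed

text \<open>
Jordan decomposition: the real and the imaginary part are differences of two nondecreasing functions.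
\<close>

lemma borel_measurable_bounded_variation:
  fixes f :: "real \<Rightarrow> complex"
  assumes "total_var f a b < \<infinity>"
  shows "f \<in> borel_measurable (restrict_space borel {a..b})"
proof -
  define v where "v = (\<lambda>x. enn2real (total_var f a x))"
  have v: "norm (f y - f x) \<le> v y - v x" if "a \<le> x" "x \<le> y" "y \<le> b" for x y
    using variation_function[OF assms that] by (simp add: v_def)
  have *: "g \<in> borel_measurable (restrict_space borel {a..b})"
    if g: "\<And>x y. \<bar>g y - g x\<bar> \<le> norm (f y - f x)" for g :: "real \<Rightarrow> real"
  proof -
    have "mono_on {a..b} v"
      using order_trans[OF norm_ge_zero v] by (auto simp: mono_on_def)
    moreover have "v x + g x \<le> v y + g y" if "a \<le> x" "x \<le> y" "y \<le> b" for x y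
      using v[OF that] g[of y x] by linarith
    then have "mono_on {a..b} (\<lambda>x. v x + g x)" by (auto simp: mono_on_def)
    ultimately have "(\<lambda>x. (v x + g x) - v x) \<in> borel_measurable (restrict_space borel {a..b})"
      by (intro borel_measurable_diff borel_measurable_mono_on_fnc)
    then show ?thesis by simp
  qed
  have "(\<lambda>x. Re (f x)) \<in> borel_measurable (restrict_space borel {a..b})"
    by (rule *) (metis abs_Re_le_cmod minus_complex.simps(1))
  moreover have "(\<lambda>x. Im (f x)) \<in> borel_measurable (restrict_space borel {a..b})"
    by (rule *) (metis abs_Im_le_cmod minus_complex.simps(2))
  ultimately show ?thesis by (simp add: borel_measurable_complex_iff)
qed

lemma borel_measurable_locally_bounded_variation:
  fixes f :: "real \<Rightarrow> complex"
  assumes "locally_bounded_variation f"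
  shows "(\<lambda>x. if 0 < x then f x else 0) \<in> borel_measurable borel"
proof (rule measurable_piecewise_restrict)
  let ?C = "insert {..0} (range (\<lambda>n. {1 / real (Suc n)..real (Suc (Suc n))}))"
  show "countable ?C" by auto
  show "space borel \<subseteq> \<Union> ?C"
  proof
    fix x :: real
    show "x \<in> \<Union> ?C"
    proof (cases "x > 0")
      case True
      obtain n m where "inverse (real (Suc n)) < x" "x < real m"
        using reals_Archimedean[OF True] reals_Archimedean2 by metis
      then have "1 / real (Suc (n + m)) \<le> x" "x \<le> real (Suc (Suc (n + m)))"
        using True by (auto simp: field_simps intro: order_trans[OF less_imp_le])
      then show ?thesis by (auto intro!: exI[of _ "n + m"])
    qed auto
  qed
  fix c assume "c \<in> ?C"
  then show "c \<inter> space borel \<in> sets borel" by auto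
  from \<open>c \<in> ?C\<close> show "(\<lambda>x. if 0 < x then f x else 0) \<in> borel_measurable (restrict_space borel c)"
  proof
    assume c: "c = {..0}"
    have "(\<lambda>x. 0) \<in> borel_measurable (restrict_space borel c)" by simp
    then show ?thesis by (rule measurable_cong[THEN iffD1, rotated]) (auto simp: c space_restrict_space)
  next
    assume "c \<in> range (\<lambda>n. {1 / real (Suc n)..real (Suc (Suc n))})"
    then obtain n where c: "c = {1 / real (Suc n)..real (Suc (Suc n))}" by auto
    have "1 / real (Suc n) \<le> 1" "1 < real (Suc (Suc n))" by auto
    then have "1 / real (Suc n) < real (Suc (Suc n))" by linarith
    then have "total_var f (1 / real (Suc n)) (real (Suc (Suc n))) < \<infinity>"
      using assms unfolding locally_bounded_variation_def by simp
    then have "f \<in> borel_measurable (restrict_space borel c)"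
      unfolding c by (rule borel_measurable_bounded_variation)
    moreover have "x > 0" if "x \<in> c" for x
      using that unfolding c by (auto intro: less_le_trans[of 0 "1 / real (Suc n)"])
    ultimately show ?thesis by (subst measurable_cong[of _ _ f]) (auto simp: space_restrict_space)
  qed
qed

text \<open>
Integration by parts without Stieltjes integrals. Formally the function
\<open>D x = \<integral> f \<phi> - f(x) \<Phi>(x)\<close> has the differential \<open>- \<Phi> df\<close>, whose total mass is at most \<open>B\<close> times the
variation. On an interval of length \<open>\<delta>\<close> the increment of \<open>D\<close> exceeds \<open>B\<close> times the variation by at most
\<open>M \<delta>\<close> times the variation, where \<open>M\<close> bounds \<open>\<phi>\<close>. Summing over ever finer uniform partitions removes
the error.
\<close>

lemma bounded_variation_oscillation:
  fixes f :: "real \<Rightarrow> complex" and \<phi> \<Phi> v :: "real \<Rightarrow> real"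
  assumes ab: "a \<le> b"
    and v: "\<And>x y. a \<le> x \<Longrightarrow> x \<le> y \<Longrightarrow> y \<le> b \<Longrightarrow> norm (f y - f x) \<le> v y - v x"
    and cont: "continuous_on {a..b} \<phi>"
    and deriv: "\<And>x. x \<in> {a..b} \<Longrightarrow> (\<Phi> has_real_derivative \<phi> x) (at x)"
    and bound: "\<And>x. x \<in> {a..b} \<Longrightarrow> \<bar>\<Phi> x\<bar> \<le> B"
    and int: "(\<lambda>x. f x * of_real (\<phi> x)) integrable_on {a..b}"
  shows "norm (integral {a..b} (\<lambda>x. f x * of_real (\<phi> x))) \<le> 2 * B * (norm (f a) + (v b - v a))"
proof -
  define h where "h = (\<lambda>x. f x * of_real (\<phi> x))"
  define D where "D x = integral {a..x} h - f x * of_real (\<Phi> x)" for x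
  have B0: "B \<ge> 0" using bound[of a] ab by auto
  have vab: "v b - v a \<ge> 0" using order_trans[OF norm_ge_zero v[of a b]] ab by simp
  obtain M where M: "\<And>x. x \<in> {a..b} \<Longrightarrow> \<bar>\<phi> x\<bar> \<le> M" "M \<ge> 0"
  proof -
    have "bounded (\<phi> ` {a..b})"
      by (intro compact_imp_bounded compact_continuous_image cont) auto
    then obtain M where "M > 0" "\<And>x. x \<in> {a..b} \<Longrightarrow> \<bar>\<phi> x\<bar> \<le> M"
      unfolding bounded_pos by (auto simp: image_iff)
    then show thesis using that[of M] by auto
  qed
  have step: "norm (D y - D x) \<le> (v y - v x) * (M * (y - x) + B)" if xy: "a \<le> x" "x \<le> y" "y \<le> b" for x y
  proof -
    have hi: "h integrable_on {c..d}" if "a \<le> c" "d \<le> b" for c d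
      using integrable_on_subinterval[OF int, of c d] that by (auto simp: h_def)
    have FTC: "((\<lambda>s. of_real (\<phi> s) :: complex) has_integral (of_real (\<Phi> y) - of_real (\<Phi> x))) {x..y}"
    proof (rule fundamental_theorem_of_calculus[OF xy(2)])
      fix s assume "s \<in> {x..y}"
      then have "(\<Phi> has_real_derivative \<phi> s) (at s within {x..y})"
        using deriv[of s] xy by (auto intro: has_field_derivative_at_within)
      then show "((\<lambda>s. of_real (\<Phi> s) :: complex) has_vector_derivative of_real (\<phi> s)) (at s within {x..y})"
        by (intro has_vector_derivative_of_real) (simp add: has_real_derivative_iff_has_vector_derivative)
    qed
    from has_integral_mult_right[OF this, of "f x"]
    have i2: "((\<lambda>s. f x * of_real (\<phi> s)) has_integral f x * (of_real (\<Phi> y) - of_real (\<Phi> x))) {x..y}" .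
    have i3: "((\<lambda>s. h s - f x * of_real (\<phi> s)) has_integral
        integral {x..y} h - f x * (of_real (\<Phi> y) - of_real (\<Phi> x))) {x..y}"
      by (intro has_integral_diff integrable_integral hi i2) (use xy in auto)
    have "norm (integral {x..y} (\<lambda>s. h s - f x * of_real (\<phi> s))) \<le> integral {x..y} (\<lambda>s. (v y - v x) * M)"
    proof (rule integral_norm_bound_integral)
      show "(\<lambda>s. h s - f x * of_real (\<phi> s)) integrable_on {x..y}" using i3 by blast
      fix s assume s: "s \<in> {x..y}"
      have "norm (h s - f x * of_real (\<phi> s)) = norm (f s - f x) * \<bar>\<phi> s\<bar>"
        by (simp add: h_def norm_mult flip: left_diff_distrib)
      also have "\<dots> \<le> (v y - v x) * M"
      proof (intro mult_mono)
        have "norm (f s - f x) \<le> v s - v x" using s xy by (intro v) auto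
        moreover have "0 \<le> v y - v s" using order_trans[OF norm_ge_zero v[of s y]] s xy by auto
        ultimately show "norm (f s - f x) \<le> v y - v x" by linarith
        then show "0 \<le> v y - v x" using norm_ge_zero order_trans by blast
        show "\<bar>\<phi> s\<bar> \<le> M" using M(1)[of s] s xy by auto
      qed auto
      finally show "norm (h s - f x * of_real (\<phi> s)) \<le> (v y - v x) * M" .
    qed auto
    then have A: "norm (integral {x..y} h - f x * (of_real (\<Phi> y) - of_real (\<Phi> x))) \<le> (v y - v x) * M * (y - x)"
      using integral_unique[OF i3] xy by (simp add: mult_ac)
    have "norm ((f y - f x) * of_real (\<Phi> y)) \<le> (v y - v x) * B"
      unfolding norm_mult using v[OF xy] bound[of y] xy order_trans[OF norm_ge_zero v[OF xy]]
      by (intro mult_mono) auto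
    moreover have "integral {a..x} h + integral {x..y} h = integral {a..y} h"
      using xy hi[of a y] by (intro Henstock_Kurzweil_Integration.integral_combine) auto
    then have "integral {a..y} h = integral {a..x} h + integral {x..y} h" by simp
    then have eq: "D y - D x = (integral {x..y} h - f x * (of_real (\<Phi> y) - of_real (\<Phi> x))) - (f y - f x) * of_real (\<Phi> y)"
      by (simp add: D_def algebra_simps)
    ultimately have "norm (D y - D x) \<le> (v y - v x) * M * (y - x) + (v y - v x) * B"
      unfolding eq using A norm_triangle_ineq4[of "integral {x..y} h - f x * (of_real (\<Phi> y) - of_real (\<Phi> x))" "(f y - f x) * of_real (\<Phi> y)"]
      by linarith
    then show ?thesis by (simp add: algebra_simps)
  qed
  have part: "norm (D b - D a) \<le> (v b - v a) * (M * ((b - a) / real (Suc n)) + B)" for n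
  proof -
    define \<delta> where "\<delta> = (b - a) / real (Suc n)"
    define t where "t i = a + real i * \<delta>" for i
    have \<delta>: "\<delta> \<ge> 0" using ab by (simp add: \<delta>_def)
    have tn: "t (Suc n) = b" "t 0 = a" by (simp_all add: t_def \<delta>_def)
    have "norm (D b - D a) = norm (\<Sum>i<Suc n. D (t (Suc i)) - D (t i))"
      unfolding sum_lessThan_telescope[of "\<lambda>i. D (t i)"] tn ..
    also have "\<dots> \<le> (\<Sum>i<Suc n. (v (t (Suc i)) - v (t i)) * (M * \<delta> + B))"
    proof (rule sum_norm_le)
      fix i assume "i \<in> {..<Suc n}"
      then have "real (Suc i) * \<delta> \<le> real (Suc n) * \<delta>" by (intro mult_right_mono \<delta>) auto
      then have "t (Suc i) \<le> b" using tn(1) by (simp add: t_def)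
      moreover have "a \<le> t i" "t i \<le> t (Suc i)" "t (Suc i) - t i = \<delta>"
        using \<delta> by (auto simp: t_def algebra_simps)
      ultimately show "norm (D (t (Suc i)) - D (t i)) \<le> (v (t (Suc i)) - v (t i)) * (M * \<delta> + B)"
        using step[of "t i" "t (Suc i)"] by simp
    qed
    also have "\<dots> = (v b - v a) * (M * \<delta> + B)"
      unfolding sum_distrib_right[symmetric] sum_lessThan_telescope[of "\<lambda>i. v (t i)"] tn ..
    finally show ?thesis by (simp add: \<delta>_def)
  qed
  have "(\<lambda>n. (v b - v a) * (M * ((b - a) / real (Suc n)) + B)) \<longlonglongrightarrow> (v b - v a) * (M * 0 + B)"
    by (intro tendsto_intros LIMSEQ_Suc lim_const_over_n)
  then have "norm (D b - D a) \<le> (v b - v a) * (M * 0 + B)"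
    by (rule LIMSEQ_le_const) (use part in auto)
  then have D: "norm (D b - D a) \<le> (v b - v a) * B" by simp
  have fb: "norm (f b) \<le> norm (f a) + (v b - v a)"
    using v[of a b] ab norm_triangle_sub[of "f b" "f a"] by simp
  have "integral {a..b} h = (D b - D a) + f b * of_real (\<Phi> b) - f a * of_real (\<Phi> a)"
    by (simp add: D_def)
  then have "norm (integral {a..b} h) \<le> norm (D b - D a) + norm (f b * of_real (\<Phi> b)) + norm (f a * of_real (\<Phi> a))"
    using norm_triangle_ineq4[of "(D b - D a) + f b * of_real (\<Phi> b)" "f a * of_real (\<Phi> a)"]
      norm_triangle_ineq[of "D b - D a" "f b * of_real (\<Phi> b)"] by simp
  also have "\<dots> \<le> (v b - v a) * B + (norm (f a) + (v b - v a)) * B + norm (f a) * B"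
    unfolding norm_mult using D fb bound[of a] bound[of b] ab B0 vab
    by (intro add_mono mult_mono) auto
  finally show ?thesis by (simp add: h_def algebra_simps)
qed

section \<open>Tails of general monotone functions\<close>

text \<open>
Two dyadic blocks that are dilated by \<open>lam\<close> and share a point are at most \<open>2 * m\<close> generations apart.
\<close>

lemma overlap_count:
  fixes x lam t :: real
  assumes "x > 0" "lam > 1" "lam \<le> 2 ^ m"
  shows "(\<Sum>i<n. indicator {2 ^ i * x / lam..lam * (2 ^ i * x)} t :: ennreal) \<le> of_nat (2 * m + 1)"
proof -
  define A where "A = {i \<in> {..<n}. t \<in> {2 ^ i * x / lam..lam * (2 ^ i * x)}}"
  have fin: "finite A" by (simp add: A_def)
  have "(\<Sum>i<n. indicator {2 ^ i * x / lam..lam * (2 ^ i * x)} t :: ennreal) = (\<Sum>i\<in>A. 1)"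
    by (rule sum.mono_neutral_cong_right) (auto simp: A_def indicator_def)
  also have "\<dots> = of_nat (card A)" by simp
  also have "card A \<le> 2 * m + 1"
  proof (cases "A = {}")
    case False
    define k where "k = Min A"
    have k: "k \<in> A" "\<And>i. i \<in> A \<Longrightarrow> k \<le> i" using fin False by (auto simp: k_def)
    have "i \<le> k + 2 * m" if i: "i \<in> A" for i
    proof -
      have "2 ^ i * x / lam \<le> lam * (2 ^ k * x)"
        using i k(1) unfolding A_def by auto
      then have "2 ^ i * x \<le> lam * (2 ^ k * x) * lam" using assms by (simp add: pos_divide_le_eq)
      also have "\<dots> \<le> 2 ^ m * (2 ^ k * x) * 2 ^ m"
        using assms by (intro mult_mono) auto
      also have "\<dots> = 2 ^ (k + 2 * m) * x" by (simp add: power_add mult_2)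
      finally have "(2::real) ^ i \<le> 2 ^ (k + 2 * m)" using assms by simp
      then show ?thesis by simp
    qed
    then have "A \<subseteq> {k..k + 2 * m}" using k(2) by auto
    then have "card A \<le> card {k..k + 2 * m}" by (intro card_mono) auto
    then show ?thesis by simp
  qed auto
  finally show ?thesis by (simp del: of_nat_add of_nat_mult of_nat_Suc)
qed

text \<open>
Summing the defining inequality over dyadic blocks bounds the variation on all of \<open>[x,b]\<close>, uniformly in
\<open>b\<close>: on a block around \<open>y\<close> the factor \<open>1 / y\<close> is at most \<open>lam / t\<close>, and the blocks overlap boundedly often.
The value \<open>f x\<close> is controlled by its average over \<open>[x, 2 * x]\<close> and the variation there. The constant
must not depend on \<open>f\<close>, whence the order of the quantifiers.
\<close>

lemma general_monotone_tail_bound: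
  assumes "C\<^sub>0 > 1" "lam > 1"
  shows "\<exists>D>0. \<forall>f x b. general_monotone C\<^sub>0 lam f \<and> 0 < x \<and> x \<le> b \<longrightarrow>
    ennreal (norm (f x)) + total_var f x b \<le> ennreal D * (\<integral>\<^sup>+t\<in>{x / lam..}. ennreal (norm (f t) / t) \<partial>lborel)"
proof -
  obtain m where m: "lam \<le> 2 ^ m"
    using real_arch_pow[of 2 lam] by (auto intro: less_imp_le)
  define E where "E = C\<^sub>0 * lam * real (2 * m + 1)"
  define D where "D = 2 + E + E"
  have E: "E \<ge> 0" using assms by (auto simp: E_def)
  then have D: "D > 0" by (simp add: D_def)
  have main: "ennreal (norm (f x)) + total_var f x b \<le> ennreal D * (\<integral>\<^sup>+t\<in>{x / lam..}. ennreal (norm (f t) / t) \<partial>lborel)"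
    if GM: "general_monotone C\<^sub>0 lam f" and x: "0 < x" and xb: "x \<le> b" for f x b
  proof -
    define g where "g t = (if 0 < t then f t else 0)" for t
    have [measurable]: "g \<in> borel_measurable borel"
      using borel_measurable_locally_bounded_variation[of f] GM
      by (simp add: g_def[abs_def] general_monotone_def)
    define I where "I = (\<integral>\<^sup>+t\<in>{x / lam..}. ennreal (norm (f t) / t) \<partial>lborel)"
    have Ig: "I = (\<integral>\<^sup>+t\<in>{x / lam..}. ennreal (norm (g t) / t) \<partial>lborel)"
      unfolding I_def using assms x
      by (intro nn_integral_cong) (auto simp: g_def indicator_def intro: less_le_trans[of 0 "x / lam"])
    \<comment> \<open>One block: the weight 1 / y is replaced by a multiple of 1 / t.\<close>
    have tv1: "total_var f y (2 * y) \<le> (\<integral>\<^sup>+t. ennreal (C\<^sub>0 * lam) * (ennreal (norm (g t) / t) * indicator {y / lam..lam * y} t) \<partial>lborel)"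
      if y: "y > 0" for y
    proof -
      have "total_var f y (2 * y) \<le> ennreal (C\<^sub>0 / y) * (\<integral>\<^sup>+t\<in>{y / lam..lam * y}. ennreal (norm (f t)) \<partial>lborel)"
        using GM y by (simp add: general_monotone_def)
      also have "(\<integral>\<^sup>+t\<in>{y / lam..lam * y}. ennreal (norm (f t)) \<partial>lborel) = (\<integral>\<^sup>+t\<in>{y / lam..lam * y}. ennreal (norm (g t)) \<partial>lborel)"
        using assms y
        by (intro nn_integral_cong) (auto simp: g_def indicator_def intro: less_le_trans[of 0 "y / lam"])
      also have "ennreal (C\<^sub>0 / y) * \<dots> = (\<integral>\<^sup>+t. ennreal (C\<^sub>0 / y) * (ennreal (norm (g t)) * indicator {y / lam..lam * y} t) \<partial>lborel)"
        by (rule nn_integral_cmult[symmetric]) measurable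
      also have "\<dots> \<le> (\<integral>\<^sup>+t. ennreal (C\<^sub>0 * lam) * (ennreal (norm (g t) / t) * indicator {y / lam..lam * y} t) \<partial>lborel)"
      proof (intro nn_integral_mono)
        fix t
        show "ennreal (C\<^sub>0 / y) * (ennreal (norm (g t)) * indicator {y / lam..lam * y} t)
          \<le> ennreal (C\<^sub>0 * lam) * (ennreal (norm (g t) / t) * indicator {y / lam..lam * y} t)"
        proof (cases "t \<in> {y / lam..lam * y}")
          case True
          have t: "0 < t" using True y assms by (auto intro: less_le_trans[of 0 "y / lam"])
          have "1 / y \<le> lam / t" using True t y by (simp add: field_simps)
          then have "C\<^sub>0 * norm (g t) * (1 / y) \<le> C\<^sub>0 * norm (g t) * (lam / t)"
            using assms by (intro mult_left_mono) auto
          then show ?thesis using True t assms y by (simp add: ennreal_mult[symmetric] mult_ac)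
        qed auto
      qed
      finally show ?thesis .
    qed
    have dy: "total_var f x (2 ^ n * x) \<le> (\<Sum>i<n. total_var f (2 ^ i * x) (2 * (2 ^ i * x)))" for n
    proof (induction n)
      case 0
      have "total_var f x x = 0"
        unfolding total_var_def by (auto simp: image_subset_iff intro!: antisym[OF SUP_least] sum_nonpos)
      then show ?case by simp
    next
      case (Suc n)
      have le: "x \<le> 2 ^ n * x" using x by simp
      have "total_var f x (2 ^ Suc n * x) \<le> total_var f x (2 ^ n * x) + total_var f (2 ^ n * x) (2 ^ Suc n * x)"
        by (rule total_var_subadd) (use le x in auto)
      also have "\<dots> \<le> (\<Sum>i<n. total_var f (2 ^ i * x) (2 * (2 ^ i * x))) + total_var f (2 ^ n * x) (2 * (2 ^ n * x))"
        using Suc.IH by (intro add_mono) (auto simp: mult_ac)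
      finally show ?case by simp
    qed
    have tv: "total_var f x b \<le> ennreal (C\<^sub>0 * lam * real (2 * m + 1)) * I" if b: "x \<le> b" for b
    proof -
      obtain n where n: "b / x \<le> 2 ^ n"
        using real_arch_pow[of 2 "b / x"] by (auto intro: less_imp_le)
      have "total_var f x b \<le> total_var f x (2 ^ n * x)"
        using n x by (intro total_var_mono) (auto simp: field_simps)
      also note dy[of n]
      also have "(\<Sum>i<n. total_var f (2 ^ i * x) (2 * (2 ^ i * x)))
        \<le> (\<Sum>i<n. \<integral>\<^sup>+t. ennreal (C\<^sub>0 * lam) * (ennreal (norm (g t) / t) * indicator {2 ^ i * x / lam..lam * (2 ^ i * x)} t) \<partial>lborel)"
        using x by (intro sum_mono tv1) auto
      also have "\<dots> = (\<integral>\<^sup>+t. (\<Sum>i<n. ennreal (C\<^sub>0 * lam) * (ennreal (norm (g t) / t) * indicator {2 ^ i * x / lam..lam * (2 ^ i * x)} t)) \<partial>lborel)"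
        by (rule nn_integral_sum[symmetric]) measurable
      also have "\<dots> \<le> (\<integral>\<^sup>+t. ennreal (C\<^sub>0 * lam * real (2 * m + 1)) * (ennreal (norm (g t) / t) * indicator {x / lam..} t) \<partial>lborel)"
      proof (intro nn_integral_mono)
        fix t
        show "(\<Sum>i<n. ennreal (C\<^sub>0 * lam) * (ennreal (norm (g t) / t) * indicator {2 ^ i * x / lam..lam * (2 ^ i * x)} t))
          \<le> ennreal (C\<^sub>0 * lam * real (2 * m + 1)) * (ennreal (norm (g t) / t) * indicator {x / lam..} t)"
        proof (cases "t \<ge> x / lam")
          case True
          have "(\<Sum>i<n. ennreal (C\<^sub>0 * lam) * (ennreal (norm (g t) / t) * indicator {2 ^ i * x / lam..lam * (2 ^ i * x)} t))
            = ennreal (C\<^sub>0 * lam) * ennreal (norm (g t) / t) * (\<Sum>i<n. indicator {2 ^ i * x / lam..lam * (2 ^ i * x)} t)"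
            unfolding sum_distrib_left by (simp add: mult.assoc)
          also have "\<dots> \<le> ennreal (C\<^sub>0 * lam) * ennreal (norm (g t) / t) * of_nat (2 * m + 1)"
            by (intro mult_left_mono overlap_count x assms m) auto
          also have "of_nat (2 * m + 1) = ennreal (real (2 * m + 1))" by (rule ennreal_of_nat_eq_real_of_nat)
          also have "ennreal (C\<^sub>0 * lam) * ennreal (norm (g t) / t) * ennreal (real (2 * m + 1))
            = ennreal (C\<^sub>0 * lam * real (2 * m + 1)) * ennreal (norm (g t) / t)"
            using assms by (subst (2) ennreal_mult) (auto simp: mult_ac)
          finally show ?thesis using True by simp
        next
          case False
          have "t \<notin> {2 ^ i * x / lam..lam * (2 ^ i * x)}" for i
          proof -
            have "x / lam \<le> 2 ^ i * x / lam" using x assms by (intro divide_right_mono) auto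
            then show ?thesis using False by auto
          qed
          then show ?thesis by simp
        qed
      qed
      also have "\<dots> = ennreal (C\<^sub>0 * lam * real (2 * m + 1)) * I"
        unfolding Ig by (rule nn_integral_cmult) measurable
      finally show ?thesis .
    qed
    \<comment> \<open>Averaging the triangle inequality over [x, 2 x].\<close>
    have pt: "ennreal (norm (f x)) \<le> 2 * I + total_var f x (2 * x)"
    proof -
      have "ennreal (norm (f x)) = (\<integral>\<^sup>+t\<in>{x..2 * x}. ennreal (norm (f x) / x) \<partial>lborel)"
        using x by (simp add: nn_integral_cmult_indicator ennreal_mult[symmetric])
      also have "\<dots> \<le> (\<integral>\<^sup>+t. 2 * (ennreal (norm (g t) / t) * indicator {x / lam..} t)
          + total_var f x (2 * x) * ennreal (1 / x) * indicator {x..2 * x} t \<partial>lborel)"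
      proof (intro nn_integral_mono)
        fix t
        show "ennreal (norm (f x) / x) * indicator {x..2 * x} t
          \<le> 2 * (ennreal (norm (g t) / t) * indicator {x / lam..} t)
          + total_var f x (2 * x) * ennreal (1 / x) * indicator {x..2 * x} t"
        proof (cases "t \<in> {x..2 * x}")
          case True
          have t: "t > 0" "x / lam \<le> t"
            using True x assms order_trans[of "x / lam" x t] by (auto simp: field_simps)
          have "total_var f x x + ennreal (norm (f t - f x)) \<le> total_var f x t"
            using True by (intro total_var_append) auto
          also have "\<dots> \<le> total_var f x (2 * x)" using True by (intro total_var_mono) auto
          finally have "ennreal (norm (f t - f x)) \<le> total_var f x (2 * x)"
            by (rule order_trans[rotated]) simp
          moreover have "norm (f x) \<le> norm (f t) + norm (f t - f x)"
            using norm_triangle_sub[of "f x" "f t"] by (simp add: norm_minus_commute)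
          then have "ennreal (norm (f x)) \<le> ennreal (norm (f t)) + ennreal (norm (f t - f x))"
            by (simp flip: ennreal_plus)
          ultimately have "ennreal (norm (f x)) \<le> ennreal (norm (f t)) + total_var f x (2 * x)"
            by (meson add_left_mono order_trans)
          then have "ennreal (norm (f x)) * ennreal (1 / x) \<le> (ennreal (norm (f t)) + total_var f x (2 * x)) * ennreal (1 / x)"
            by (rule mult_right_mono) simp
          also have "\<dots> = ennreal (norm (f t) * (1 / x)) + total_var f x (2 * x) * ennreal (1 / x)"
            using x by (simp add: distrib_right ennreal_mult[symmetric])
          also have "\<dots> \<le> 2 * ennreal (norm (f t) / t) + total_var f x (2 * x) * ennreal (1 / x)"
          proof (rule add_right_mono)
            have "norm (f t) * (1 / x) \<le> norm (f t) * (2 / t)"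
              using True x t by (intro mult_left_mono) (auto simp: field_simps)
            then have "ennreal (norm (f t) * (1 / x)) \<le> ennreal (2 * (norm (f t) / t))"
              by (intro ennreal_leI) (simp add: mult.commute)
            also have "\<dots> = 2 * ennreal (norm (f t) / t)"
              by (subst ennreal_mult) (use t in auto)
            finally show "ennreal (norm (f t) * (1 / x)) \<le> 2 * ennreal (norm (f t) / t)" .
          qed
          also have "ennreal (norm (f x)) * ennreal (1 / x) = ennreal (norm (f x) / x)"
            using x by (simp add: ennreal_mult[symmetric])
          finally show ?thesis using True t by (simp add: g_def)
        qed auto
      qed
      also have "\<dots> = 2 * I + total_var f x (2 * x) * ennreal (1 / x) * ennreal x"
        unfolding Ig using x by (subst nn_integral_add) (auto simp: nn_integral_cmult nn_integral_cmult_indicator)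
      also have "total_var f x (2 * x) * ennreal (1 / x) * ennreal x = total_var f x (2 * x)"
        using x by (simp add: mult.assoc ennreal_mult[symmetric])
      finally show ?thesis .
    qed
    have "ennreal (norm (f x)) + total_var f x b \<le> 2 * I + total_var f x (2 * x) + total_var f x b"
      using pt by (rule add_right_mono)
    also have "\<dots> \<le> 2 * I + ennreal (C\<^sub>0 * lam * real (2 * m + 1)) * I + ennreal (C\<^sub>0 * lam * real (2 * m + 1)) * I"
      using x xb by (intro add_mono tv order_refl) auto
    also have "\<dots> = (2 + ennreal E + ennreal E) * I"
      by (simp only: E_def distrib_right)
    also have "2 + ennreal E + ennreal E = ennreal (2 + E) + ennreal E"
      using ennreal_plus[of 2 E] E by simp
    also have "\<dots> = ennreal D"
      unfolding D_def using E by (intro ennreal_plus[symmetric]) auto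
    finally show ?thesis unfolding I_def .
  qed
  then show ?thesis using D by blast
qed

section \<open>Young's inequality on the multiplicative group\<close>

text \<open>
Jensen's inequality for the measure with density \<open>w\<close>, of total mass \<open>J\<close>. Young's inequality gives the
tangent line bound \<open>u \<le> t ((u / t)\<^sup>p / p + 1 - 1 / p)\<close>. Its integral is optimal for \<open>t\<^sup>p = b / J\<close>, where
\<open>b\<close> is the integral on the right-hand side. The number \<open>r\<close> stands for the possibly infinite integral
of \<open>h\<close>, so that only real powers occur.
\<close>

lemma weighted_jensen:
  fixes w h :: "'a \<Rightarrow> real"
  assumes [measurable]: "w \<in> borel_measurable M" "h \<in> borel_measurable M"
    and w: "\<And>x. x \<in> space M \<Longrightarrow> 0 \<le> w x" and h: "\<And>x. x \<in> space M \<Longrightarrow> 0 \<le> h x"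
    and p: "1 < p" and J: "(\<integral>\<^sup>+x. ennreal (w x) \<partial>M) = ennreal J" "J > 0"
    and r: "0 \<le> r" "ennreal r \<le> (\<integral>\<^sup>+x. ennreal (h x * w x) \<partial>M)"
  shows "ennreal (r powr p) \<le> ennreal (J powr (p - 1)) * (\<integral>\<^sup>+x. ennreal (h x powr p * w x) \<partial>M)"
proof (cases "(\<integral>\<^sup>+x. ennreal (h x powr p * w x) \<partial>M) = \<infinity>")
  case True
  then show ?thesis using J(2) by (simp add: ennreal_mult_top)
next
  case False
  then obtain b where b: "(\<integral>\<^sup>+x. ennreal (h x powr p * w x) \<partial>M) = ennreal b" "b \<ge> 0"
    by (cases "(\<integral>\<^sup>+x. ennreal (h x powr p * w x) \<partial>M)") auto
  \<comment> \<open>A number slightly above b is used instead of b, so that the optimal t is positive even if b = 0.\<close>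
  have le: "r powr p / J powr (p - 1) \<le> b'" if b': "b < b'" for b'
  proof -
    have b'0: "b' > 0" using b b' by linarith
    define t where "t = (b' / J) powr (1 / p)"
    have t: "t > 0" "t powr p = b' / J" using b'0 J p by (auto simp: t_def powr_powr)
    have young: "u \<le> t * (u powr p / (p * t powr p) + (1 - 1 / p))" if "u \<ge> 0" for u
    proof -
      have "(u / t) * 1 \<le> (u / t) powr p / p + 1 powr (p / (p - 1)) / (p / (p - 1))"
        using that t p by (intro Youngs_inequality) (auto simp: field_simps)
      also have "\<dots> = u powr p / (p * t powr p) + (1 - 1 / p)"
        using that t p by (simp add: powr_divide field_simps)
      finally show ?thesis using t by (simp add: field_simps)
    qed
    define c d where "c = t / (p * t powr p)" and "d = t * (1 - 1 / p)"
    have cd: "c \<ge> 0" "d \<ge> 0" using t(1) p by (auto simp: c_def d_def)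
    have "ennreal r \<le> (\<integral>\<^sup>+x. ennreal c * ennreal (h x powr p * w x) + ennreal d * ennreal (w x) \<partial>M)"
    proof (rule order_trans[OF r(2)], rule nn_integral_mono)
      fix x assume x: "x \<in> space M"
      have "h x * w x \<le> t * (h x powr p / (p * t powr p) + (1 - 1 / p)) * w x"
        by (intro mult_right_mono young h w x)
      also have "\<dots> = c * (h x powr p * w x) + d * w x"
        by (simp add: c_def d_def algebra_simps)
      finally have "ennreal (h x * w x) \<le> ennreal (c * (h x powr p * w x) + d * w x)"
        by (rule ennreal_leI)
      also have "\<dots> = ennreal c * ennreal (h x powr p * w x) + ennreal d * ennreal (w x)"
        using cd w[OF x] by (simp add: ennreal_plus ennreal_mult)
      finally show "ennreal (h x * w x) \<le> ennreal c * ennreal (h x powr p * w x) + ennreal d * ennreal (w x)" .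
    qed
    also have "\<dots> = ennreal c * ennreal b + ennreal d * ennreal J"
      unfolding b(1)[symmetric] J(1)[symmetric]
      by (subst nn_integral_add) (auto simp: nn_integral_cmult)
    also have "\<dots> = ennreal (c * b + d * J)"
      using cd b J by (simp add: ennreal_mult[symmetric] ennreal_plus[symmetric] del: ennreal_plus)
    finally have "r \<le> c * b + d * J"
      using cd b J by (subst (asm) ennreal_le_iff) auto
    also have "\<dots> \<le> c * b' + d * J"
      using cd b' by (intro add_right_mono mult_left_mono) auto
    also have "\<dots> = t * J" unfolding c_def d_def t(2) using p b'0 J by (simp add: field_simps)
    finally have "r powr p \<le> (t * J) powr p" using r(1) p by (intro powr_mono2) auto
    also have "\<dots> = b' / J * J powr p" using t J by (simp add: powr_mult)
    also have "\<dots> = b' * J powr (p - 1)" using J by (simp add: powr_diff)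
    finally show ?thesis using J by (simp add: field_simps)
  qed
  have "r powr p / J powr (p - 1) \<le> b" by (rule dense_ge) (rule le)
  then have "r powr p \<le> J powr (p - 1) * b" using J by (simp add: field_simps)
  then show ?thesis unfolding b(1) using b(2) by (simp add: ennreal_mult[symmetric] ennreal_leI)
qed

text \<open>
The kernel \<open>min (s\<^sup>u) (s\<^sup>v)\<close> has finite mass for the multiplicative Haar measure \<open>ds / s\<close>. The invariance
of that measure under dilations makes the mass independent of \<open>y\<close>.
\<close>

lemma min_powr_mass:
  fixes u v :: real
  assumes "u > 0" "v < 0"
  obtains J where "J > 0" "\<And>y. y > 0 \<Longrightarrow>
    (\<integral>\<^sup>+x. ennreal (indicator {0<..} x * min ((x * y) powr u) ((x * y) powr v) / x) \<partial>lborel) = ennreal J"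
proof -
  define n where "n x = indicator {0<..} x * min (x powr u) (x powr v) / x" for x :: real
  have [measurable]: "n \<in> borel_measurable borel" unfolding n_def[abs_def] by measurable
  have n0: "n x \<ge> 0" for x by (auto simp: n_def indicator_def)
  have i1: "(\<integral>\<^sup>+x. ennreal (indicator {0..1} x * x powr (u - 1)) \<partial>lborel) = ennreal (1 / u)"
    using nn_integral_has_integral_lebesgue[OF _ has_integral_powr_from_0[of "u - 1" 1]] assms
    by simp
  have i2: "(\<integral>\<^sup>+x. ennreal (indicator {1..} x * x powr (v - 1)) \<partial>lborel) = ennreal (- 1 / v)"
    using nn_integral_has_integral_lebesgue[OF _ has_integral_powr_to_inf[of "v - 1" 1]] assms
    by simp
  have "(\<integral>\<^sup>+x. ennreal (n x) \<partial>lborel) \<le> (\<integral>\<^sup>+x. ennreal (indicator {0..1} x * x powr (u - 1)) + ennreal (indicator {1..} x * x powr (v - 1)) \<partial>lborel)"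
  proof (rule nn_integral_mono)
    fix x :: real
    consider "x \<le> 0" | "0 < x" "x \<le> 1" | "1 < x" by linarith
    then show "ennreal (n x) \<le> ennreal (indicator {0..1} x * x powr (u - 1)) + ennreal (indicator {1..} x * x powr (v - 1))"
    proof cases
      case 2
      have "n x \<le> x powr u / x" using 2 by (auto simp: n_def divide_right_mono)
      then show ?thesis using 2 by (auto simp: powr_diff intro!: add_increasing2 ennreal_leI)
    next
      case 3
      have "n x \<le> x powr v / x" using 3 by (auto simp: n_def divide_right_mono)
      then show ?thesis using 3 by (auto simp: powr_diff intro!: add_increasing ennreal_leI)
    qed (auto simp: n_def)
  qed
  also have "\<dots> = ennreal (1 / u) + ennreal (- 1 / v)"
    by (subst nn_integral_add) (simp_all add: i1 i2)
  finally have fin: "(\<integral>\<^sup>+x. ennreal (n x) \<partial>lborel) < \<infinity>" by (auto simp: order_le_less_trans)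
  have pos: "(\<integral>\<^sup>+x. ennreal (n x) \<partial>lborel) > 0"
  proof -
    define c where "c = min (2 powr v) 1 * (1 / 2 :: real)"
    have "c > 0" by (simp add: c_def)
    then have "0 < (\<integral>\<^sup>+x. ennreal c * indicator {1..2::real} x \<partial>lborel)"
      by (subst nn_integral_cmult_indicator) auto
    also have "\<dots> \<le> (\<integral>\<^sup>+x. ennreal (n x) \<partial>lborel)"
    proof (rule nn_integral_mono)
      fix x :: real
      show "ennreal c * indicator {1..2} x \<le> ennreal (n x)"
      proof (cases "x \<in> {1..2}")
        case True
        have "2 powr v \<le> x powr v" using True assms by (intro powr_mono2') auto
        moreover have "1 \<le> x powr u" using True assms by (simp add: ge_one_powr_ge_zero)
        ultimately have "c \<le> min (x powr u) (x powr v) * (1 / x)"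
          unfolding c_def using True by (intro mult_mono) (auto simp: field_simps)
        then show ?thesis using True by (auto simp: n_def intro!: ennreal_leI)
      qed auto
    qed
    finally show ?thesis .
  qed
  define J where "J = enn2real (\<integral>\<^sup>+x. ennreal (n x) \<partial>lborel)"
  have J: "ennreal J = (\<integral>\<^sup>+x. ennreal (n x) \<partial>lborel)" using fin by (simp add: J_def)
  have "J > 0" using pos unfolding J[symmetric] by simp
  moreover have "(\<integral>\<^sup>+x. ennreal (indicator {0<..} x * min ((x * y) powr u) ((x * y) powr v) / x) \<partial>lborel) = ennreal J"
    if y: "y > 0" for y
  proof -
    have "ennreal J = ennreal y * (\<integral>\<^sup>+x. ennreal (n (0 + y * x)) \<partial>lborel)"
      unfolding J using nn_integral_real_affine[of "\<lambda>x. ennreal (n x)" y 0] y by simp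
    also have "\<dots> = (\<integral>\<^sup>+x. ennreal y * ennreal (n (0 + y * x)) \<partial>lborel)"
      by (rule nn_integral_cmult[symmetric]) measurable
    also have "\<dots> = (\<integral>\<^sup>+x. ennreal (indicator {0<..} x * min ((x * y) powr u) ((x * y) powr v) / x) \<partial>lborel)"
    proof (intro nn_integral_cong)
      fix x
      have "y * n (0 + y * x) = indicator {0<..} x * min ((x * y) powr u) ((x * y) powr v) / x"
        using y by (auto simp: n_def indicator_def mult.commute zero_less_mult_iff)
      then show "ennreal y * ennreal (n (0 + y * x)) = ennreal (indicator {0<..} x * min ((x * y) powr u) ((x * y) powr v) / x)"
        using y n0 by (simp add: ennreal_mult[symmetric])
    qed
    finally show ?thesis ..
  qed
  ultimately show thesis by (rule that)
qed

lemma powr_interpolate: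
  fixes a b X :: real
  assumes "0 \<le> X" "X \<le> a" "1 \<le> b"
  shows "X powr b \<le> a powr (b - 1) * X"
proof (cases "X = 0")
  case False
  then have "X powr b = X powr (b - 1) * X" using assms by (simp add: powr_diff)
  also have "\<dots> \<le> a powr (b - 1) * X" using assms by (intro mult_right_mono powr_mono2) auto
  finally show ?thesis .
qed simp

text \<open>
A Hardy type inequality, obtained as Young's inequality for convolution on the multiplicative group
\<open>(0,\<infinity>)\<close> with its Haar measure \<open>dx / x\<close>. With \<open>h x = x powr (\<delta> + 1) * g x\<close> and
\<open>N s = s powr (- \<delta>) * min (s powr \<sigma>) (s powr \<tau>)\<close>, the integral operator applied to \<open>g\<close> equals
\<open>y powr \<delta>\<close> times the convolution of \<open>h\<close> and \<open>N\<close>. The weights are such that the two norms in question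
become the unweighted norms of \<open>h\<close> in \<open>L\<^sup>p\<close> and of the convolution in \<open>L\<^sup>q\<close>. The strict inequalities on
\<open>\<delta>\<close> say precisely that \<open>N\<close> is integrable; moreover \<open>N \<le> 1\<close>. Jensen's inequality bounds the \<open>p\<close>-th
power of the convolution by a multiple of \<open>G\<close>, the convolution of \<open>h\<^sup>p\<close> and \<open>N\<close>; this is bounded because
\<open>N \<le> 1\<close>, which pays for the surplus exponent \<open>q - p\<close>, and by Tonelli's theorem it is integrable.
\<close>

lemma power_weight_kernel_inequality:
  fixes p q \<sigma> \<tau> \<gamma> \<delta> :: real
  assumes p: "1 < p" "p \<le> q" and \<delta>: "\<tau> < \<delta>" "\<delta> < \<sigma>"
  shows "\<exists>C>0. \<forall>g r A. g \<in> borel_measurable borel \<and> (\<forall>x. 0 \<le> g x) \<and> 0 \<le> A \<and>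
     (\<integral>\<^sup>+x. ennreal (indicator {0<..} x * (x powr (\<delta> + 1 - 1 / p) * g x) powr p) \<partial>lborel) = ennreal A \<and>
     (\<forall>y>0. 0 \<le> r y \<and> ennreal (r y) \<le>
        (\<integral>\<^sup>+x. ennreal (indicator {0<..} x * g x * min ((x * y) powr \<sigma>) ((x * y) powr \<tau>)) \<partial>lborel)) \<longrightarrow>
     (\<integral>\<^sup>+y. ennreal (indicator {0<..} y * (y powr (- (\<delta> + 1 / q)) * r y) powr q) \<partial>lborel)
        \<le> ennreal (C * A powr (q / p))"
proof -
  obtain J where J: "J > 0" and mass: "\<And>y. y > 0 \<Longrightarrow>
    (\<integral>\<^sup>+x. ennreal (indicator {0<..} x * min ((x * y) powr (\<sigma> - \<delta>)) ((x * y) powr (\<tau> - \<delta>)) / x) \<partial>lborel) = ennreal J"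
    using min_powr_mass[of "\<sigma> - \<delta>" "\<tau> - \<delta>"] \<delta> by auto
  define N where "N s = min (s powr (\<sigma> - \<delta>)) (s powr (\<tau> - \<delta>))" for s :: real
  define w where "w y x = indicator {0<..} x * N (x * y) / x" for x y :: real
  have [measurable]: "N \<in> borel_measurable borel" unfolding N_def[abs_def] by measurable
  have [measurable]: "(\<lambda>(y, x). w y x) \<in> borel_measurable (borel \<Otimes>\<^sub>M borel)"
    unfolding w_def[abs_def] by measurable
  have N: "0 \<le> N s" "N s \<le> 1" if "s > 0" for s
  proof -
    show "0 \<le> N s" by (simp add: N_def)
    show "N s \<le> 1"
    proof (cases "s \<le> 1")
      case True
      then have "s powr (\<sigma> - \<delta>) \<le> 1" using that \<delta> by (intro powr_le1) auto
      then show ?thesis by (simp add: N_def)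
    next
      case False
      then have "s powr (\<tau> - \<delta>) \<le> s powr 0" using \<delta> by (intro powr_mono) auto
      then show ?thesis using False by (simp add: N_def)
    qed
  qed
  have w0: "0 \<le> w y x" if "y > 0" for x y
    using N(1)[of "x * y"] that by (auto simp: w_def indicator_def)
  define C where "C = (J powr (p - 1)) powr (q / p - 1) * J powr (p - 1) * J"
  have C: "C > 0" using J by (simp add: C_def)
  have main: "(\<integral>\<^sup>+y. ennreal (indicator {0<..} y * (y powr (- (\<delta> + 1 / q)) * r y) powr q) \<partial>lborel)
        \<le> ennreal (C * A powr (q / p))"
    if g[measurable]: "g \<in> borel_measurable borel" and g0: "\<forall>x. 0 \<le> g x" and A: "0 \<le> A"
      "(\<integral>\<^sup>+x. ennreal (indicator {0<..} x * (x powr (\<delta> + 1 - 1 / p) * g x) powr p) \<partial>lborel) = ennreal A"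
      and r: "\<forall>y>0. 0 \<le> r y \<and> ennreal (r y) \<le>
        (\<integral>\<^sup>+x. ennreal (indicator {0<..} x * g x * min ((x * y) powr \<sigma>) ((x * y) powr \<tau>)) \<partial>lborel)"
    for g r A
  proof -
    define h where "h x = x powr (\<delta> + 1) * g x" for x
    have [measurable]: "h \<in> borel_measurable borel" unfolding h_def[abs_def] by measurable
    have h0: "0 \<le> h x" for x using g0 by (simp add: h_def)
    have hp: "h x powr p / x = (x powr (\<delta> + 1 - 1 / p) * g x) powr p" if "x > 0" for x
    proof -
      have "(x powr (\<delta> + 1 - 1 / p)) powr p = (x powr (\<delta> + 1)) powr p / x"
      proof -
        have "(\<delta> + 1 - 1 / p) * p = (\<delta> + 1) * p - 1" using p by (simp add: field_simps)
        then show ?thesis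
          using powr_diff[of x "(\<delta> + 1) * p" 1] that unfolding powr_powr by simp
      qed
      then show ?thesis using g0 by (simp add: h_def powr_mult)
    qed
    have A': "(\<integral>\<^sup>+x. ennreal (indicator {0<..} x * (h x powr p / x)) \<partial>lborel) = ennreal A"
      unfolding A(2)[symmetric] by (intro nn_integral_cong) (auto simp: indicator_def hp)
    define \<rho> where "\<rho> y = y powr (- \<delta>) * r y" for y
    define G where "G y = (\<integral>\<^sup>+x. ennreal (h x powr p * w y x) \<partial>lborel)" for y
    have \<rho>0: "0 \<le> \<rho> y" if "y > 0" for y using r that by (simp add: \<rho>_def)
    have jensen: "ennreal (\<rho> y powr p) \<le> ennreal (J powr (p - 1)) * G y" if y: "y > 0" for y
      unfolding G_def
    proof (rule weighted_jensen)
      show "(\<integral>\<^sup>+x. ennreal (w y x) \<partial>lborel) = ennreal J"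
        using mass[OF y] by (simp add: w_def N_def)
      have "ennreal (\<rho> y) = ennreal (y powr (- \<delta>)) * ennreal (r y)"
        using r y by (simp add: \<rho>_def ennreal_mult)
      also have "\<dots> \<le> ennreal (y powr (- \<delta>)) *
        (\<integral>\<^sup>+x. ennreal (indicator {0<..} x * g x * min ((x * y) powr \<sigma>) ((x * y) powr \<tau>)) \<partial>lborel)"
        using r y by (intro mult_left_mono) auto
      also have "\<dots> = (\<integral>\<^sup>+x. ennreal (y powr (- \<delta>)) *
         ennreal (indicator {0<..} x * g x * min ((x * y) powr \<sigma>) ((x * y) powr \<tau>)) \<partial>lborel)"
        by (rule nn_integral_cmult[symmetric]) measurable
      also have "\<dots> = (\<integral>\<^sup>+x. ennreal (h x * w y x) \<partial>lborel)"
      proof (intro nn_integral_cong)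
        fix x
        show "ennreal (y powr (- \<delta>)) * ennreal (indicator {0<..} x * g x * min ((x * y) powr \<sigma>) ((x * y) powr \<tau>))
           = ennreal (h x * w y x)"
        proof (cases "x > 0")
          case True
          have e: "(x * y) powr e = (x * y) powr \<delta> * (x * y) powr (e - \<delta>)" for e
            by (simp add: powr_add[symmetric])
          have "min ((x * y) powr \<sigma>) ((x * y) powr \<tau>) = (x * y) powr \<delta> * N (x * y)"
            unfolding N_def e[of \<sigma>] e[of \<tau>] by (simp add: min_mult_distrib_left)
          then have "y powr (- \<delta>) * (g x * min ((x * y) powr \<sigma>) ((x * y) powr \<tau>))
              = (y powr (- \<delta>) * (x * y) powr \<delta>) * (g x * N (x * y))"
            by (simp add: mult_ac)
          also have "y powr (- \<delta>) * (x * y) powr \<delta> = x powr \<delta>"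
            using True y by (simp add: powr_mult powr_minus field_simps)
          also have "x powr \<delta> * (g x * N (x * y)) = h x * w y x"
            using True by (simp add: h_def w_def powr_add)
          finally have "y powr (- \<delta>) * (g x * min ((x * y) powr \<sigma>) ((x * y) powr \<tau>)) = h x * w y x" .
          then show ?thesis using True g0 by (simp add: ennreal_mult[symmetric])
        qed (simp add: w_def)
      qed
      finally show "ennreal (\<rho> y) \<le> (\<integral>\<^sup>+x. ennreal (h x * w y x) \<partial>lborel)" .
    qed (use y w0 h0 p J \<rho>0 in \<open>auto simp: w_def\<close>)
    have GA: "G y \<le> ennreal A" if y: "y > 0" for y
      unfolding G_def A'[symmetric]
    proof (intro nn_integral_mono ennreal_leI)
      fix x
      show "h x powr p * w y x \<le> indicator {0<..} x * (h x powr p / x)"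
      proof (cases "x > 0")
        case True
        have "h x powr p * N (x * y) \<le> h x powr p * 1" using N[of "x * y"] True y by (intro mult_left_mono) auto
        then show ?thesis using True by (simp add: w_def divide_right_mono)
      qed (simp add: w_def)
    qed
    have point: "ennreal (\<rho> y powr q) \<le> ennreal ((J powr (p - 1) * A) powr (q / p - 1) * J powr (p - 1)) * G y"
      if y: "y > 0" for y
    proof -
      obtain b where b: "G y = ennreal b" "0 \<le> b"
        using GA[OF y] by (cases "G y") (auto simp: top_unique)
      then have b3: "b \<le> A" using GA[OF y] A(1) by simp
      have 1: "\<rho> y powr p \<le> J powr (p - 1) * b"
        using jensen[OF y] b J by (simp add: ennreal_mult[symmetric])
      also have "\<dots> \<le> J powr (p - 1) * A" using b3 by (intro mult_left_mono) auto
      finally have 2: "\<rho> y powr p \<le> J powr (p - 1) * A" .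
      have "\<rho> y powr q = (\<rho> y powr p) powr (q / p)" using p by (simp add: powr_powr)
      also have "\<dots> \<le> (J powr (p - 1) * A) powr (q / p - 1) * \<rho> y powr p"
        using 2 p by (intro powr_interpolate) auto
      also have "\<dots> \<le> (J powr (p - 1) * A) powr (q / p - 1) * (J powr (p - 1) * b)"
        using 1 by (intro mult_left_mono) auto
      finally show ?thesis unfolding b(1) using b(2)
        by (simp add: ennreal_mult[symmetric] mult.assoc ennreal_leI)
    qed
    define c where "c = (J powr (p - 1) * A) powr (q / p - 1) * J powr (p - 1)"
    have c0: "c \<ge> 0" by (simp add: c_def)
    have [measurable]: "G \<in> borel_measurable borel"
      unfolding G_def[abs_def] by measurable
    have "(\<integral>\<^sup>+y. ennreal (indicator {0<..} y * (y powr (- (\<delta> + 1 / q)) * r y) powr q) \<partial>lborel)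
       \<le> (\<integral>\<^sup>+y. ennreal c * (ennreal (indicator {0<..} y / y) * G y) \<partial>lborel)"
    proof (rule nn_integral_mono)
      fix y :: real
      show "ennreal (indicator {0<..} y * (y powr (- (\<delta> + 1 / q)) * r y) powr q)
        \<le> ennreal c * (ennreal (indicator {0<..} y / y) * G y)"
      proof (cases "y > 0")
        case True
        have "y powr (- (\<delta> + 1 / q)) = y powr (- \<delta>) * y powr (- (1 / q))"
          by (simp add: powr_add[symmetric])
        then have "(y powr (- (\<delta> + 1 / q)) * r y) powr q = (\<rho> y * y powr (- (1 / q))) powr q"
          by (simp add: \<rho>_def mult_ac)
        also have "\<dots> = \<rho> y powr q * (1 / y)"
        proof -
          have "(y powr (- (1 / q))) powr q = y powr (-1)" using p unfolding powr_powr by simp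
          also have "\<dots> = 1 / y" using True by (simp add: powr_minus_divide)
          finally show ?thesis using \<rho>0[OF True] by (simp only: powr_mult)
        qed
        finally have "ennreal ((y powr (- (\<delta> + 1 / q)) * r y) powr q) = ennreal (1 / y) * ennreal (\<rho> y powr q)"
          using True by (simp add: ennreal_mult[symmetric])
        also have "\<dots> \<le> ennreal (1 / y) * (ennreal c * G y)"
          unfolding c_def by (intro mult_left_mono point True) auto
        finally show ?thesis using True by (simp add: mult_ac)
      qed simp
    qed
    also have "\<dots> = ennreal c * (\<integral>\<^sup>+y. ennreal (indicator {0<..} y / y) * G y \<partial>lborel)"
      by (rule nn_integral_cmult) measurable
    also have "(\<integral>\<^sup>+y. ennreal (indicator {0<..} y / y) * G y \<partial>lborel)
      = (\<integral>\<^sup>+y. (\<integral>\<^sup>+x. ennreal (indicator {0<..} y / y) * ennreal (h x powr p * w y x) \<partial>lborel) \<partial>lborel)"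
      unfolding G_def by (intro nn_integral_cong nn_integral_cmult[symmetric]) measurable
    also have "\<dots> = (\<integral>\<^sup>+x. (\<integral>\<^sup>+y. ennreal (indicator {0<..} y / y) * ennreal (h x powr p * w y x) \<partial>lborel) \<partial>lborel)"
      by (rule lborel_pair.Fubini') measurable
    also have "\<dots> = (\<integral>\<^sup>+x. ennreal (indicator {0<..} x * (h x powr p / x)) * ennreal J \<partial>lborel)"
    proof (intro nn_integral_cong)
      fix x
      have "(\<integral>\<^sup>+y. ennreal (indicator {0<..} y / y) * ennreal (h x powr p * w y x) \<partial>lborel)
        = (\<integral>\<^sup>+y. ennreal (indicator {0<..} x * (h x powr p / x)) * ennreal (w x y) \<partial>lborel)"
      proof (intro nn_integral_cong)
        fix y
        show "ennreal (indicator {0<..} y / y) * ennreal (h x powr p * w y x)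
          = ennreal (indicator {0<..} x * (h x powr p / x)) * ennreal (w x y)"
          using N(1)[of "x * y"] by (auto simp: w_def indicator_def ennreal_mult[symmetric] mult_ac)
      qed
      also have "\<dots> = ennreal (indicator {0<..} x * (h x powr p / x)) * (\<integral>\<^sup>+y. ennreal (w x y) \<partial>lborel)"
        by (rule nn_integral_cmult) measurable
      also have "\<dots> = ennreal (indicator {0<..} x * (h x powr p / x)) * ennreal J"
        using mass[of x] by (cases "x > 0") (simp_all add: w_def N_def)
      finally show "(\<integral>\<^sup>+y. ennreal (indicator {0<..} y / y) * ennreal (h x powr p * w y x) \<partial>lborel)
        = ennreal (indicator {0<..} x * (h x powr p / x)) * ennreal J" .
    qed
    also have "\<dots> = ennreal A * ennreal J"
      unfolding A'[symmetric] by (rule nn_integral_multc) measurable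
    also have "ennreal c * (ennreal A * ennreal J) = ennreal (c * (A * J))"
      using c0 A(1) J by (simp add: ennreal_mult[symmetric])
    also have "c * (A * J) = C * A powr (q / p)"
    proof -
      have "A powr (q / p) = A powr (q / p - 1) * A" using A(1) p by (cases "A = 0") (auto simp: powr_diff)
      then show ?thesis using A(1) by (simp add: c_def C_def powr_mult)
    qed
    finally show ?thesis .
  qed
  show ?thesis using C main by blast
qed

section \<open>Domination of the transform by a positive operator\<close>

text \<open>
Cauchy's criterion at infinity with an explicit modulus, which survives as a bound on the limit.
\<close>

lemma tendsto_at_top_of_tail_bound:
  fixes J :: "real \<Rightarrow> 'a::banach"
  assumes J: "\<And>s t. a \<le> s \<Longrightarrow> s \<le> t \<Longrightarrow> norm (J t - J s) \<le> R s"
    and R: "(R \<longlongrightarrow> 0) at_top"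
  obtains L where "(J \<longlongrightarrow> L) at_top" "norm (L - J a) \<le> R a"
proof -
  have Rn: "(\<lambda>n. R (a + real n)) \<longlonglongrightarrow> 0"
    by (rule filterlim_compose[OF R]) (intro filterlim_tendsto_add_at_top[OF tendsto_const] filterlim_real_sequentially)
  have "Cauchy (\<lambda>n. J (a + real n))"
  proof (rule CauchyI)
    fix e :: real assume "e > 0"
    then obtain N where N: "\<And>n. n \<ge> N \<Longrightarrow> R (a + real n) < e"
      using order_tendstoD(2)[OF Rn] unfolding eventually_sequentially by metis
    have "norm (J (a + real m) - J (a + real n)) < e" if "N \<le> m" "N \<le> n" for m n
    proof (cases "m \<le> n")
      case True
      then have "norm (J (a + real n) - J (a + real m)) \<le> R (a + real m)" by (intro J) auto
      then show ?thesis using N[OF that(1)] by (simp add: norm_minus_commute)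
    next
      case False
      then have "norm (J (a + real m) - J (a + real n)) \<le> R (a + real n)" by (intro J) auto
      then show ?thesis using N[OF that(2)] by simp
    qed
    then show "\<exists>M. \<forall>m\<ge>M. \<forall>n\<ge>M. norm (J (a + real m) - J (a + real n)) < e" by blast
  qed
  then obtain L where L: "(\<lambda>n. J (a + real n)) \<longlonglongrightarrow> L"
    using Cauchy_convergent convergent_def by blast
  have le: "norm (L - J s) \<le> R s" if "a \<le> s" for s
  proof (rule tendsto_upperbound)
    show "((\<lambda>n. norm (J (a + real n) - J s)) \<longlongrightarrow> norm (L - J s)) sequentially"
      by (intro tendsto_intros L)
    obtain N where "s - a \<le> real N" using real_arch_simple by blast
    then show "eventually (\<lambda>n. norm (J (a + real n) - J s) \<le> R s) sequentially"
      using that by (intro eventually_sequentiallyI[of N] J) auto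
  qed simp
  have "((\<lambda>s. J s - L) \<longlongrightarrow> 0) at_top"
  proof (rule Lim_null_comparison[OF _ R])
    show "eventually (\<lambda>s. norm (J s - L) \<le> R s) at_top"
      using eventually_ge_at_top[of a] by eventually_elim (metis le norm_minus_commute)
  qed
  then have "(J \<longlongrightarrow> L) at_top" by (rule LIM_zero_cancel)
  then show thesis using le[of a] by (intro that) auto
qed

text \<open>
The order of the Struve kernel up to \<open>1\<close>, and of its non-oscillating part from there on.
\<close>

definition power_kernel :: "real \<Rightarrow> real \<Rightarrow> real" where
  "power_kernel \<alpha> s = min (s powr (\<alpha> + 3/2)) (s powr (\<alpha> - 1/2))"

lemma power_kernel_le_1: "0 < s \<Longrightarrow> s \<le> 1 \<Longrightarrow> power_kernel \<alpha> s = s powr (\<alpha> + 3/2)"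
  unfolding power_kernel_def by (intro min_absorb1 powr_mono') auto

lemma power_kernel_ge_1: "1 \<le> s \<Longrightarrow> power_kernel \<alpha> s = s powr (\<alpha> - 1/2)"
  unfolding power_kernel_def by (intro min_absorb2 powr_mono) auto

lemma power_kernel_nonneg: "0 \<le> power_kernel \<alpha> s"
  by (simp add: power_kernel_def)

text \<open>
Integration by parts gains a factor \<open>1 / s\<close>. The condition \<open>\<alpha> > -1/2\<close> is what makes \<open>1 / s\<close>
smaller than \<open>s powr (\<alpha> - 1/2)\<close> at infinity; the constant allows for starting at \<open>1 / lam\<close> instead of \<open>1\<close>.
\<close>

lemma inverse_le_power_kernel:
  assumes "\<alpha> > -1/2" "lam > 1" "1 / lam \<le> s"
  shows "1 / s \<le> lam powr (\<alpha> + 5/2) * power_kernel \<alpha> s"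
proof -
  have s: "s > 0" using assms by (auto intro: less_le_trans[of 0 "1 / lam"])
  have l1: "1 \<le> lam powr (\<alpha> + 5/2)" using assms by (intro ge_one_powr_ge_zero) auto
  show ?thesis
  proof (cases "s \<le> 1")
    case True
    have "s powr (-1) * 1 \<le> s powr (-1) * (lam * s) powr (\<alpha> + 5/2)"
      using assms s by (intro mult_left_mono ge_one_powr_ge_zero) (auto simp: field_simps)
    also have "\<dots> = lam powr (\<alpha> + 5/2) * s powr (-1 + (\<alpha> + 5/2))"
      using s assms by (simp only: powr_mult powr_add) (simp add: mult_ac)
    also have "-1 + (\<alpha> + 5/2) = \<alpha> + 3/2" by simp
    finally show ?thesis using s True by (simp add: power_kernel_le_1 powr_minus_divide)
  next
    case False
    have "s powr (-1) \<le> s powr (\<alpha> - 1/2)" using False assms by (intro powr_mono) auto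
    also have "\<dots> \<le> lam powr (\<alpha> + 5/2) * s powr (\<alpha> - 1/2)" using l1 mult_right_mono[OF l1, of "s powr (\<alpha> - 1/2)"] by simp
    finally show ?thesis using s False by (simp add: power_kernel_ge_1 powr_minus_divide)
  qed
qed

text \<open>
The two conditions of admissibility match the two branches of the power kernel; moving the break point
from \<open>1\<close> to \<open>1 / y\<close> is harmless because the kernel is the smaller of its branches.
\<close>

lemma admissible_finite:
  assumes "admissible \<alpha> f" "y > 0"
    and [measurable]: "(\<lambda>x. if 0 < x then f x else 0) \<in> borel_measurable borel"
  shows "(\<integral>\<^sup>+x. ennreal (indicator {0<..} x * norm (f x) * power_kernel \<alpha> (x * y)) \<partial>lborel) < \<infinity>"
proof -
  define g where "g x = (if 0 < x then f x else 0)" for x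
  have [measurable]: "g \<in> borel_measurable borel" unfolding g_def[abs_def] by fact
  define I1 I2 where "I1 = (\<integral>\<^sup>+x\<in>{0<..<1}. ennreal (x powr (\<alpha> + 3/2) * norm (f x)) \<partial>lborel)"
    and "I2 = (\<integral>\<^sup>+x\<in>{1<..}. ennreal (x powr (\<alpha> - 1/2) * norm (f x)) \<partial>lborel)"
  have I1: "I1 = (\<integral>\<^sup>+x\<in>{0<..<1}. ennreal (x powr (\<alpha> + 3/2) * norm (g x)) \<partial>lborel)"
    unfolding I1_def by (intro nn_integral_cong) (auto simp: g_def indicator_def)
  have I2: "I2 = (\<integral>\<^sup>+x\<in>{1<..}. ennreal (x powr (\<alpha> - 1/2) * norm (g x)) \<partial>lborel)"
    unfolding I2_def by (intro nn_integral_cong) (auto simp: g_def indicator_def)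
  have fin: "I1 + I2 < \<infinity>" using assms(1) by (simp add: admissible_def I1_def I2_def)
  have "(\<integral>\<^sup>+x. ennreal (indicator {0<..} x * norm (f x) * power_kernel \<alpha> (x * y)) \<partial>lborel)
    \<le> (\<integral>\<^sup>+x. ennreal (y powr (\<alpha> + 3/2)) * (ennreal (x powr (\<alpha> + 3/2) * norm (g x)) * indicator {0<..<1} x)
         + ennreal (y powr (\<alpha> - 1/2)) * (ennreal (x powr (\<alpha> - 1/2) * norm (g x)) * indicator {1<..} x) \<partial>lborel)"
  proof (rule nn_integral_mono_AE)
    show "AE x in lborel. ennreal (indicator {0<..} x * norm (f x) * power_kernel \<alpha> (x * y))
      \<le> ennreal (y powr (\<alpha> + 3/2)) * (ennreal (x powr (\<alpha> + 3/2) * norm (g x)) * indicator {0<..<1} x)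
         + ennreal (y powr (\<alpha> - 1/2)) * (ennreal (x powr (\<alpha> - 1/2) * norm (g x)) * indicator {1<..} x)"
      using AE_lborel_singleton[of "1::real"]
    proof eventually_elim
      fix x :: real assume x1: "x \<noteq> 1"
      consider "x \<le> 0" | "0 < x" "x < 1" | "1 < x" using x1 by linarith
      then show "ennreal (indicator {0<..} x * norm (f x) * power_kernel \<alpha> (x * y))
      \<le> ennreal (y powr (\<alpha> + 3/2)) * (ennreal (x powr (\<alpha> + 3/2) * norm (g x)) * indicator {0<..<1} x)
         + ennreal (y powr (\<alpha> - 1/2)) * (ennreal (x powr (\<alpha> - 1/2) * norm (g x)) * indicator {1<..} x)"
      proof cases
        case 2
        have "norm (f x) * power_kernel \<alpha> (x * y) \<le> norm (f x) * (x * y) powr (\<alpha> + 3/2)"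
          unfolding power_kernel_def by (intro mult_left_mono) auto
        also have "\<dots> = y powr (\<alpha> + 3/2) * (x powr (\<alpha> + 3/2) * norm (g x))"
          using 2 by (simp add: powr_mult g_def)
        finally show ?thesis using 2 by (simp add: ennreal_mult[symmetric] ennreal_leI)
      next
        case 3
        have "norm (f x) * power_kernel \<alpha> (x * y) \<le> norm (f x) * (x * y) powr (\<alpha> - 1/2)"
          unfolding power_kernel_def by (intro mult_left_mono) auto
        also have "\<dots> = y powr (\<alpha> - 1/2) * (x powr (\<alpha> - 1/2) * norm (g x))"
          using 3 by (simp add: powr_mult g_def)
        finally show ?thesis using 3 by (simp add: ennreal_mult[symmetric] ennreal_leI)
      qed simp
    qed
  qed
  also have "\<dots> = ennreal (y powr (\<alpha> + 3/2)) * I1 + ennreal (y powr (\<alpha> - 1/2)) * I2"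
    unfolding I1 I2 by (subst nn_integral_add) (auto simp: nn_integral_cmult)
  also have "\<dots> < \<infinity>" using fin by (auto simp: ennreal_mult_less_top)
  finally show ?thesis .
qed

text \<open>
For general monotone \<open>f\<close> the oscillating part of the kernel contributes no more than the other parts, so
the transform is dominated by a positive integral operator. The integral is cut at \<open>a = 1 / y\<close>. Before
\<open>a\<close>, and for the dominated part of the kernel after \<open>a\<close>, the integrand \<open>k1\<close> is dominated by \<open>H\<close>, which
admissibility makes integrable. The oscillating part \<open>k2\<close> after \<open>a\<close> is only improperly integrable: on
\<open>[s,t]\<close> its integral is at most a multiple of \<open>1 / y\<close> times \<open>\<bar>f s\<bar>\<close> plus the variation, hence, by the tail
bound for general monotone functions, a multiple of \<open>1 / y\<close> times the integral of \<open>\<bar>f x\<bar> / x\<close> over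
\<open>x \<ge> s / lam\<close>. There \<open>1 / (x y)\<close> is at most a multiple of the power kernel. This yields both the
convergence of the improper integral and the bound.
\<close>

lemma struve_transform_bound:
  assumes \<alpha>: "\<alpha> > -1/2" and GMc: "C\<^sub>0 > 1" "lam > 1"
  shows "\<exists>D>0. \<forall>f y. general_monotone C\<^sub>0 lam f \<and> admissible \<alpha> f \<and> 0 < y \<longrightarrow>
    ennreal (norm (struve_transform \<alpha> f y))
      \<le> ennreal D * (\<integral>\<^sup>+x. ennreal (indicator {0<..} x * norm (f x) * power_kernel \<alpha> (x * y)) \<partial>lborel)"
proof -
  define K where "K = struve_kernel \<alpha>"
  obtain B1 b s0 where B1: "B1 > 0"
    and K0: "\<And>s. 0 < s \<Longrightarrow> s \<le> 1 \<Longrightarrow> \<bar>K s\<bar> \<le> B1 * s powr (\<alpha> + 3/2)"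
    unfolding K_def by (rule struve_kernel_near_0[OF \<alpha>]) simp
  obtain \<phi> \<Phi> B2 where B2: "B2 > 0" and \<phi>: "continuous_on {0<..} \<phi>"
    and "\<forall>s>0. (\<Phi> has_real_derivative \<phi> s) (at s)" "\<forall>s\<ge>1. \<bar>\<Phi> s\<bar> \<le> B2"
    and "\<forall>s\<ge>1. \<bar>struve_kernel \<alpha> s - \<phi> s\<bar> \<le> B2 * s powr (\<alpha> - 1/2)"
    by (rule struve_kernel_split[OF \<alpha>]) (rule that)
  then have \<Phi>: "\<And>s. s > 0 \<Longrightarrow> (\<Phi> has_real_derivative \<phi> s) (at s)"
      "\<And>s. s \<ge> 1 \<Longrightarrow> \<bar>\<Phi> s\<bar> \<le> B2"
    and \<psi>: "\<And>s. s \<ge> 1 \<Longrightarrow> \<bar>K s - \<phi> s\<bar> \<le> B2 * s powr (\<alpha> - 1/2)"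
    by (simp_all add: K_def)
  obtain D4 where D4: "D4 > 0" and tail: "\<And>f x b. general_monotone C\<^sub>0 lam f \<Longrightarrow> 0 < x \<Longrightarrow> x \<le> b \<Longrightarrow>
    ennreal (norm (f x)) + total_var f x b \<le> ennreal D4 * (\<integral>\<^sup>+t\<in>{x / lam..}. ennreal (norm (f t) / t) \<partial>lborel)"
    using general_monotone_tail_bound[OF GMc] by blast
  \<comment> \<open>Extending by zero makes the kernels total measurable functions.\<close>
  define K' where "K' s = (if s \<in> {0<..} then K s else 0)" for s
  define \<phi>' where "\<phi>' s = (if s \<in> {0<..} then \<phi> s else 0)" for s
  have [measurable]: "K' \<in> borel_measurable borel" "\<phi>' \<in> borel_measurable borel"
    unfolding K'_def[abs_def] \<phi>'_def[abs_def] K_def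
    by (intro borel_measurable_continuous_on_if continuous_on_struve_kernel \<phi> \<alpha>; simp)+
  have [measurable]: "power_kernel \<alpha> \<in> borel_measurable borel"
    unfolding power_kernel_def[abs_def] by measurable
  define c where "c = 2 * B2 * D4 * lam powr (\<alpha> + 5/2)"
  have c0: "c > 0" using B2 D4 GMc by (simp add: c_def)
  have main: "ennreal (norm (struve_transform \<alpha> f y))
      \<le> ennreal (B1 + B2 + c) * (\<integral>\<^sup>+x. ennreal (indicator {0<..} x * norm (f x) * power_kernel \<alpha> (x * y)) \<partial>lborel)"
    if GM: "general_monotone C\<^sub>0 lam f" and ad: "admissible \<alpha> f" and y: "0 < y" for f y
  proof -
    have bv: "locally_bounded_variation f" using GM by (simp add: general_monotone_def)
    define g where "g x = (if 0 < x then f x else 0)" for x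
    have [measurable]: "g \<in> borel_measurable borel"
      using borel_measurable_locally_bounded_variation[OF bv] by (simp add: g_def[abs_def])
    define H where "H x = indicator {0<..} x * norm (g x) * power_kernel \<alpha> (x * y)" for x
    have [measurable]: "H \<in> borel_measurable borel" unfolding H_def[abs_def] by measurable
    have H0: "H x \<ge> 0" for x by (simp add: H_def power_kernel_nonneg)
    have Hf: "H x = indicator {0<..} x * norm (f x) * power_kernel \<alpha> (x * y)" for x
      by (simp add: H_def g_def indicator_def)
    have Hfin: "(\<integral>\<^sup>+x. ennreal (H x) \<partial>lborel) < \<infinity>"
      using admissible_finite[OF ad y borel_measurable_locally_bounded_variation[OF bv]] by (simp add: Hf)
    have Hint: "integrable lborel H"
      by (rule integrableI_nonneg) (use H0 Hfin in auto)
    define F where "F = integral\<^sup>L lborel H"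
    have F: "(\<integral>\<^sup>+x. ennreal (H x) \<partial>lborel) = ennreal F"
      unfolding F_def by (rule nn_integral_eq_integral[OF Hint]) (use H0 in auto)
    have F0: "F \<ge> 0" unfolding F_def using H0 by (simp add: integral_nonneg_AE)
    define a where "a = 1 / y"
    have a: "a > 0" using y by (simp add: a_def)
    have ay: "1 \<le> x * y \<longleftrightarrow> a \<le> x" "x * y < 1 \<longleftrightarrow> x < a" for x using y by (auto simp: a_def field_simps)
    define k1 where "k1 x = g x * complex_of_real (if x < a then K' (x * y) else K' (x * y) - \<phi>' (x * y))" for x
    define k2 where "k2 x = g x * complex_of_real (\<phi>' (x * y))" for x
    have [measurable]: "k1 \<in> borel_measurable borel" "k2 \<in> borel_measurable borel"
      unfolding k1_def[abs_def] k2_def[abs_def] by measurable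
    have k1H: "norm (k1 x) \<le> (B1 + B2) * H x" for x
    proof -
      consider "x \<le> 0" | "0 < x" "x < a" | "0 < x" "a \<le> x" by linarith
      then show ?thesis
      proof cases
        case 1
        then show ?thesis by (simp add: k1_def g_def H_def)
      next
        case 2
        have xy: "0 < x * y" "x * y \<le> 1" using 2 y ay(2)[of x] by auto
        have "norm (k1 x) = norm (g x) * \<bar>K (x * y)\<bar>"
          using 2 xy by (simp add: k1_def K'_def norm_mult)
        also have "\<dots> \<le> norm (g x) * ((B1 + B2) * power_kernel \<alpha> (x * y))"
          using K0[OF xy] B2 power_kernel_le_1[OF xy, of \<alpha>]
          by (intro mult_left_mono) (auto simp: distrib_right intro: order_trans)
        finally show ?thesis using 2 by (simp add: H_def mult_ac)
      next
        case 3
        have xy: "0 < x * y" "1 \<le> x * y" using 3 y ay(1)[of x] by auto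
        have "norm (k1 x) = norm (g x) * \<bar>K (x * y) - \<phi> (x * y)\<bar>"
          using 3 xy by (simp add: k1_def K'_def \<phi>'_def norm_mult flip: of_real_diff)
        also have "\<dots> \<le> norm (g x) * ((B1 + B2) * power_kernel \<alpha> (x * y))"
          using \<psi>[OF xy(2)] B1 power_kernel_ge_1[OF xy(2), of \<alpha>]
          by (intro mult_left_mono) (auto simp: distrib_right intro: order_trans)
        finally show ?thesis using 3 by (simp add: H_def mult_ac)
      qed
    qed
    have k1int: "integrable lborel k1"
      by (rule Bochner_Integration.integrable_bound[OF integrable_mult_right[OF Hint, of "B1 + B2"]])
        (use k1H H0 B1 B2 in auto)
    define P where "P = integral\<^sup>L lborel k1"
    have P: "norm P \<le> (B1 + B2) * F"
    proof -
      have "norm P \<le> (\<integral>x. (B1 + B2) * H x \<partial>lborel)"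
        unfolding P_def by (rule Bochner_Integration.integral_norm_bound_integral[OF k1int])
          (use k1H Hint in auto)
      then show ?thesis by (simp add: F_def)
    qed
    have k1lim: "((\<lambda>T. \<integral>x. indicator {0<..<T} x *\<^sub>R k1 x \<partial>lborel) \<longlongrightarrow> P) at_top"
      unfolding P_def
    proof (rule integral_dominated_convergence_at_top[where w = "\<lambda>x. norm (k1 x)"])
      show "integrable lborel (\<lambda>x. norm (k1 x))" using k1int by simp
      show "\<forall>\<^sub>F T in at_top. AE x in lborel. norm (indicator {0<..<T} x *\<^sub>R k1 x) \<le> norm (k1 x)"
        by (auto simp: indicator_def)
      show "AE x in lborel. ((\<lambda>T. indicator {0<..<T} x *\<^sub>R k1 x) \<longlongrightarrow> k1 x) at_top"
      proof (rule AE_I2)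
        fix x
        have "\<forall>\<^sub>F T in at_top. indicator {0<..<T} x *\<^sub>R k1 x = k1 x"
          using eventually_gt_at_top[of x] by eventually_elim (auto simp: indicator_def k1_def g_def)
        then show "((\<lambda>T. indicator {0<..<T} x *\<^sub>R k1 x) \<longlongrightarrow> k1 x) at_top" by (rule tendsto_eventually)
      qed
    qed auto
    have tvfin: "total_var f s t < \<infinity>" if "a \<le> s" "s \<le> t" for s t
    proof -
      have "total_var f s t \<le> total_var f s (t + 1)" by (rule total_var_mono) auto
      also have "\<dots> < \<infinity>" using bv that a unfolding locally_bounded_variation_def by simp
      finally show ?thesis .
    qed
    have \<phi>c: "continuous_on {s..t} (\<lambda>x. \<phi> (x * y))" if "a \<le> s" for s t
      using that a y by (intro continuous_on_compose2[OF \<phi>] continuous_intros) (auto intro: less_le_trans)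
    have k2int: "set_integrable lborel {s..t} k2" if st: "a \<le> s" for s t
    proof (cases "s \<le> t")
      case True
      define v where "v = (\<lambda>x. enn2real (total_var f s x))"
      have v: "norm (f z - f x) \<le> v z - v x" if "s \<le> x" "x \<le> z" "z \<le> t" for x z
        using variation_function[OF tvfin[OF st True] that] by (simp add: v_def)
      have "compact ((\<lambda>x. \<phi> (x * y)) ` {s..t})" by (intro compact_continuous_image \<phi>c st) auto
      then obtain Q where Q: "Q > 0" "\<And>x. x \<in> {s..t} \<Longrightarrow> \<bar>\<phi> (x * y)\<bar> \<le> Q"
        using compact_imp_bounded[of "(\<lambda>x. \<phi> (x * y)) ` {s..t}"] unfolding bounded_pos by auto
      have "norm (k2 x) \<le> (norm (f s) + (v t - v s)) * Q" if x: "x \<in> {s..t}" for x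
      proof -
        have "norm (f x - f s) \<le> v x - v s" using x by (intro v) auto
        moreover have "0 \<le> v t - v x" using order_trans[OF norm_ge_zero v[of x t]] x by auto
        ultimately have "norm (f x) \<le> norm (f s) + (v t - v s)"
          using norm_triangle_sub[of "f x" "f s"] by linarith
        moreover have "norm (k2 x) = norm (f x) * \<bar>\<phi> (x * y)\<bar>"
          using x st a y by (auto simp: k2_def g_def \<phi>'_def norm_mult)
        moreover from calculation(1) have "0 \<le> norm (f s) + (v t - v s)"
          using norm_ge_zero[of "f x"] by linarith
        ultimately show ?thesis
          using Q(2)[OF x] by (simp add: mult_mono)
      qed
      then show ?thesis unfolding set_integrable_def
        using True
        by (intro integrableI_bounded_set_indicator[where B = "(norm (f s) + (v t - v s)) * Q"]) auto
    next
      case False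
      then show ?thesis by (simp add: set_integrable_def)
    qed
    define J where "J T = (LINT x:{a..T}|lborel. k2 x)" for T
    have JHK: "J T = integral {a..T} k2" "k2 integrable_on {s..T}" if "a \<le> s" for s T
      using set_borel_integral_eq_integral[OF k2int[of a T]] set_borel_integral_eq_integral[OF k2int[of s T]] that
      by (auto simp: J_def)
    define R where "R T = c * (\<integral>x. indicator {T / lam..} x * H x \<partial>lborel)" for T
    have Hind: "integrable lborel (\<lambda>x. indicator {T / lam..} x * H x)" for T
      using integrable_mult_indicator[OF _ Hint, of "{T / lam..}"] by simp
    have Jtail: "norm (J t - J s) \<le> R s" if st: "a \<le> s" "s \<le> t" for s t
    proof -
      have s0: "s > 0" using a st by linarith
      define v where "v = (\<lambda>x. enn2real (total_var f s x))"
      have v: "norm (f z - f x) \<le> v z - v x" if "s \<le> x" "x \<le> z" "z \<le> t" for x z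
        using variation_function[OF tvfin[OF st] that] by (simp add: v_def)
      have v0: "v x \<ge> 0" for x by (simp add: v_def)
      have eqk: "k2 x = f x * complex_of_real (\<phi> (x * y))" if "x \<in> {s..t}" for x
        using that s0 y by (simp add: k2_def g_def \<phi>'_def)
      have iss: "(\<lambda>x. f x * complex_of_real (\<phi> (x * y))) integrable_on {s..t}"
        using JHK(2)[OF st(1), of t] by (subst integrable_cong[symmetric]) (use eqk in auto)
      have "integral {a..s} k2 + integral {s..t} k2 = integral {a..t} k2"
        using st JHK(2)[of a t] by (intro Henstock_Kurzweil_Integration.integral_combine) auto
      then have "J t - J s = integral {s..t} k2"
        using JHK(1)[of a] by (metis add_diff_cancel_left' order_refl)
      also have "\<dots> = integral {s..t} (\<lambda>x. f x * complex_of_real (\<phi> (x * y)))"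
        by (intro integral_cong eqk)
      also have "norm \<dots> \<le> 2 * (B2 / y) * (norm (f s) + (v t - v s))"
      proof (rule bounded_variation_oscillation[where \<Phi> = "\<lambda>x. \<Phi> (x * y) / y"])
        show "continuous_on {s..t} (\<lambda>x. \<phi> (x * y))" by (rule \<phi>c[OF st(1)])
        fix x assume x: "x \<in> {s..t}"
        then have xy: "x * y > 0" "x * y \<ge> 1" using s0 y st ay(1)[of x] by auto
        have "((\<lambda>x. \<Phi> (x * y)) has_real_derivative \<phi> (x * y) * y) (at x)"
          by (rule DERIV_chain2[where f = \<Phi> and g = "\<lambda>x. x * y", OF \<Phi>(1)[OF xy(1)]])
            (auto intro!: derivative_eq_intros)
        from DERIV_cdivide[OF this, of y]
        show "((\<lambda>x. \<Phi> (x * y) / y) has_real_derivative \<phi> (x * y)) (at x)" using y by simp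
        show "\<bar>\<Phi> (x * y) / y\<bar> \<le> B2 / y" using \<Phi>(2)[OF xy(2)] y by (simp add: abs_divide divide_right_mono)
      qed (use st v iss in auto)
      also have "\<dots> \<le> 2 * (B2 / y) * (norm (f s) + v t)"
        using B2 y v0 by (intro mult_left_mono) auto
      finally have 1: "norm (J t - J s) \<le> 2 * (B2 / y) * (norm (f s) + v t)" .
      define I where "I = (\<integral>x. indicator {s / lam..} x * H x \<partial>lborel)"
      have I0: "I \<ge> 0" unfolding I_def using H0 by (intro integral_nonneg_AE) auto
      have "(\<integral>\<^sup>+t\<in>{s / lam..}. ennreal (norm (f t) / t) \<partial>lborel)
        \<le> (\<integral>\<^sup>+x. ennreal (y * lam powr (\<alpha> + 5/2)) * ennreal (indicator {s / lam..} x * H x) \<partial>lborel)"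
      proof (rule nn_integral_mono)
        fix x
        show "ennreal (norm (f x) / x) * indicator {s / lam..} x
          \<le> ennreal (y * lam powr (\<alpha> + 5/2)) * ennreal (indicator {s / lam..} x * H x)"
        proof (cases "x \<in> {s / lam..}")
          case True
          have x0: "x > 0" using True s0 GMc by (auto intro: less_le_trans[of 0 "s / lam"])
          have "1 / lam \<le> x * y"
          proof -
            have "a / lam \<le> s / lam" using st GMc by (intro divide_right_mono) auto
            then have "a / lam \<le> x" using True by auto
            then have "a / lam * y \<le> x * y" using y by (intro mult_right_mono) auto
            then show ?thesis using y by (simp add: a_def)
          qed
          from inverse_le_power_kernel[OF \<alpha> GMc(2) this]
          have "norm (f x) * y * (1 / (x * y)) \<le> norm (f x) * y * (lam powr (\<alpha> + 5/2) * power_kernel \<alpha> (x * y))"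
            using y by (intro mult_left_mono) auto
          then have "norm (f x) / x \<le> y * lam powr (\<alpha> + 5/2) * H x"
            using x0 y by (simp add: Hf mult_ac)
          then show ?thesis using True y H0[of x]
            by (simp add: ennreal_mult[symmetric] ennreal_leI)
        qed simp
      qed
      also have "\<dots> = ennreal (y * lam powr (\<alpha> + 5/2)) * ennreal (\<integral>x. indicator {s / lam..} x * H x \<partial>lborel)"
        by (subst nn_integral_cmult, measurable, subst nn_integral_eq_integral[OF Hind])
          (use H0 in auto)
      finally have tl: "(\<integral>\<^sup>+t\<in>{s / lam..}. ennreal (norm (f t) / t) \<partial>lborel)
        \<le> ennreal (y * lam powr (\<alpha> + 5/2)) * ennreal I" by (simp only: I_def)
      have "ennreal (norm (J t - J s)) \<le> ennreal (2 * (B2 / y) * (norm (f s) + v t))"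
        by (rule ennreal_leI[OF 1])
      also have "\<dots> = ennreal (2 * (B2 / y)) * (ennreal (norm (f s)) + ennreal (v t))"
        using B2 y v0 by (subst ennreal_mult) (auto simp: ennreal_plus)
      also have "ennreal (v t) = total_var f s t" using tvfin[OF st] by (simp add: v_def)
      also have "ennreal (2 * (B2 / y)) * (ennreal (norm (f s)) + total_var f s t)
          \<le> ennreal (2 * (B2 / y)) * (ennreal D4 * (ennreal (y * lam powr (\<alpha> + 5/2)) * ennreal I))"
        by (intro mult_left_mono order_trans[OF tail[OF GM s0 st(2)]] tl) auto
      also have "\<dots> = ennreal (R s)"
        using B2 D4 y GMc I0 by (simp add: ennreal_mult[symmetric] R_def I_def c_def field_simps)
      finally have "ennreal (norm (J t - J s)) \<le> ennreal (R s)" .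
      moreover have "R s \<ge> 0" using c0 I0 by (simp add: R_def I_def)
      ultimately show ?thesis by simp
    qed
    \<comment> \<open>Tails of a convergent integral.\<close>
    have R0: "(R \<longlongrightarrow> 0) at_top"
    proof -
      have "((\<lambda>T. \<integral>x. indicator {T / lam..} x * H x \<partial>lborel) \<longlongrightarrow> (integral\<^sup>L lborel (\<lambda>x::real. 0))) at_top"
      proof (rule integral_dominated_convergence_at_top[where w = H])
        show "\<forall>\<^sub>F T in at_top. AE x in lborel. norm (indicator {T / lam..} x * H x) \<le> H x"
          using H0 by (auto simp: indicator_def)
        show "AE x in lborel. ((\<lambda>T. indicator {T / lam..} x * H x) \<longlongrightarrow> 0) at_top"
        proof (rule AE_I2)
          fix x
          have "\<forall>\<^sub>F T in at_top. indicator {T / lam..} x * H x = 0"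
            using eventually_gt_at_top[of "lam * x"]
            by eventually_elim (use GMc in \<open>auto simp: indicator_def field_simps\<close>)
          then show "((\<lambda>T. indicator {T / lam..} x * H x) \<longlongrightarrow> 0) at_top" by (rule tendsto_eventually)
        qed
      qed (use Hint in auto)
      then show ?thesis unfolding R_def by (auto intro!: tendsto_mult_right_zero)
    qed
    obtain L where L: "(J \<longlongrightarrow> L) at_top" "norm (L - J a) \<le> R a"
      by (rule tendsto_at_top_of_tail_bound[OF Jtail R0])
    have "J a = 0" using JHK(1)[of a a] by simp
    moreover have "R a \<le> c * F"
      unfolding R_def F_def using c0 H0
      by (intro mult_left_mono integral_mono Hind Hint) (auto simp: indicator_def)
    ultimately have L2: "norm L \<le> c * F" using L(2) by simp
    have eq: "(LINT x:{0<..<T}|lborel. complex_of_real ((x * y) powr (1/2)) * f x * complex_of_real (struve_H \<alpha> (x * y)))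
      = (\<integral>x. indicator {0<..<T} x *\<^sub>R k1 x \<partial>lborel) + J T" if T: "T > a" for T
    proof -
      have "(LINT x:{0<..<T}|lborel. complex_of_real ((x * y) powr (1/2)) * f x * complex_of_real (struve_H \<alpha> (x * y)))
        = (\<integral>x. indicator {0<..<T} x *\<^sub>R k1 x + indicator {a..T} x *\<^sub>R k2 x \<partial>lborel)"
        unfolding set_lebesgue_integral_def
      proof (rule integral_cong_AE)
        have *: "indicator {0<..<T} x *\<^sub>R (complex_of_real ((x * y) powr (1/2)) * f x * complex_of_real (struve_H \<alpha> (x * y)))
          = indicator {0<..<T} x *\<^sub>R (g x * complex_of_real (K' (x * y)))" for x
          using y by (auto simp: indicator_def g_def K'_def K_def struve_kernel_def)
        show "(\<lambda>x. indicator {0<..<T} x *\<^sub>R (complex_of_real ((x * y) powr (1/2)) * f x * complex_of_real (struve_H \<alpha> (x * y)))) \<in> borel_measurable lborel"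
          unfolding * by measurable
        show "AE x in lborel. indicator {0<..<T} x *\<^sub>R (complex_of_real ((x * y) powr (1/2)) * f x * complex_of_real (struve_H \<alpha> (x * y)))
          = indicator {0<..<T} x *\<^sub>R k1 x + indicator {a..T} x *\<^sub>R k2 x"
          unfolding * using AE_lborel_singleton[of T]
          by eventually_elim (use T a in \<open>auto simp: indicator_def k1_def k2_def algebra_simps\<close>)
      qed measurable
      also have "\<dots> = (\<integral>x. indicator {0<..<T} x *\<^sub>R k1 x \<partial>lborel) + (\<integral>x. indicator {a..T} x *\<^sub>R k2 x \<partial>lborel)"
        using k2int[of a T] integrable_mult_indicator[OF _ k1int, of "{0<..<T}"]
        by (intro Bochner_Integration.integral_add) (auto simp: set_integrable_def)
      finally show ?thesis by (simp add: J_def set_lebesgue_integral_def)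
    qed
    have "((\<lambda>T. LINT x:{0<..<T}|lborel. complex_of_real ((x * y) powr (1/2)) * f x * complex_of_real (struve_H \<alpha> (x * y)))
       \<longlongrightarrow> P + L) at_top"
    proof (rule Lim_transform_eventually[OF tendsto_add[OF k1lim L(1)]])
      show "\<forall>\<^sub>F T in at_top. (\<integral>x. indicator {0<..<T} x *\<^sub>R k1 x \<partial>lborel) + J T
        = (LINT x:{0<..<T}|lborel. complex_of_real ((x * y) powr (1/2)) * f x * complex_of_real (struve_H \<alpha> (x * y)))"
        using eventually_gt_at_top[of a] by eventually_elim (simp add: eq)
    qed
    then have "struve_transform \<alpha> f y = P + L"
      unfolding struve_transform_def by (rule tendsto_Lim[OF trivial_limit_at_top_linorder])
    then have "norm (struve_transform \<alpha> f y) \<le> (B1 + B2 + c) * F"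
      using P L2 norm_triangle_ineq[of P L] by (simp add: algebra_simps)
    then have "ennreal (norm (struve_transform \<alpha> f y)) \<le> ennreal ((B1 + B2 + c) * F)" by (rule ennreal_leI)
    also have "\<dots> = ennreal (B1 + B2 + c) * ennreal F"
      using B1 B2 c0 F0 by (intro ennreal_mult) auto
    finally show ?thesis unfolding F[symmetric] Hf .
  qed
  show ?thesis
    by (rule exI[of _ "B1 + B2 + c"]) (use main B1 B2 c0 in auto)
qed

section \<open>The transform of the indicator of a dyadic block\<close>

lemma nn_integral_inverse_exp_interval:
  fixes a M :: real
  assumes "a > 0" "M \<ge> 0"
  shows "(\<integral>\<^sup>+x. ennreal (1 / x) * indicator {a..a * exp M} x \<partial>lborel) = ennreal M"
proof -
  have "(\<integral>\<^sup>+x. ennreal (1 / x) * indicator {a..a * exp M} x \<partial>lborel) = ennreal (ln (a * exp M) - ln a)"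
    using assms by (intro nn_integral_FTC_Icc) (auto intro!: derivative_eq_intros less_le_trans[of 0 a])
  then show ?thesis using assms by (simp add: ln_mult)
qed

text \<open>
Near the relevant end of the half-line \<open>x powr e\<close> is at least a multiple of \<open>1 / x\<close>, whose integral over
\<open>[a, a * exp M]\<close> is \<open>M\<close> for every \<open>a > 0\<close>; the two ends differ only in the direction in which the
interval extends from \<open>a\<close>.
\<close>

lemma powr_integral_diverges:
  fixes e a :: real and S :: "real set"
  assumes a: "a > 0"
    and S: "e \<le> -1 \<and> {0<..a} \<subseteq> S \<or> -1 \<le> e \<and> {a..} \<subseteq> S"
  shows "(\<integral>\<^sup>+x. ennreal (x powr e) * indicator S x \<partial>lborel) = \<infinity>"
proof -
  have ge: "ennreal (a powr (e + 1) * M) \<le> (\<integral>\<^sup>+x. ennreal (x powr e) * indicator S x \<partial>lborel)" if M: "M \<ge> 0" for M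
  proof -
    define L where "L \<longleftrightarrow> e \<le> -1 \<and> {0<..a} \<subseteq> S"
    \<comment> \<open>The left end point of the interval on which 1 / x has integral M.\<close>
    define b where "b = (if L then a * exp (- M) else a)"
    have b: "b > 0" "b * exp M = (if L then a else a * exp M)"
      using a by (auto simp: b_def exp_minus)
    have bM: "b \<le> b * exp M" using b(1) M by simp
    have "ennreal (a powr (e + 1) * M) = (\<integral>\<^sup>+x. ennreal (a powr (e + 1)) * (ennreal (1 / x) * indicator {b..b * exp M} x) \<partial>lborel)"
      using nn_integral_inverse_exp_interval[OF b(1) M] M
      by (subst nn_integral_cmult) (auto simp: ennreal_mult)
    also have "\<dots> \<le> (\<integral>\<^sup>+x. ennreal (x powr e) * indicator S x \<partial>lborel)"
    proof (rule nn_integral_mono)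
      fix x
      show "ennreal (a powr (e + 1)) * (ennreal (1 / x) * indicator {b..b * exp M} x) \<le> ennreal (x powr e) * indicator S x"
      proof (cases "x \<in> {b..b * exp M}")
        case True
        have x: "x > 0" using True b by auto
        have "x \<in> S \<and> a powr (e + 1) \<le> x powr (e + 1)"
        proof (cases L)
          case c: True
          then have "x \<le> a" using True b by simp
          then show ?thesis using c x by (auto simp: L_def intro!: powr_mono2')
        next
          case c: False
          then have "a \<le> x" using True by (simp add: b_def)
          moreover have "-1 \<le> e" "{a..} \<subseteq> S" using c S by (auto simp: L_def)
          ultimately show ?thesis using a by (auto intro!: powr_mono2)
        qed
        then have "a powr (e + 1) * (1 / x) \<le> x powr (e + 1) * (1 / x)" "x \<in> S"
          using x by (auto intro!: divide_right_mono)
        moreover have "x powr (e + 1) * (1 / x) = x powr e" using x by (simp add: powr_add)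
        ultimately show ?thesis using True x by (simp add: ennreal_mult[symmetric] ennreal_leI)
      qed simp
    qed
    finally show ?thesis .
  qed
  show ?thesis
  proof (rule ccontr)
    assume "\<not> ?thesis"
    then obtain r where r: "(\<integral>\<^sup>+x. ennreal (x powr e) * indicator S x \<partial>lborel) = ennreal r" "r \<ge> 0"
      by (cases "(\<integral>\<^sup>+x. ennreal (x powr e) * indicator S x \<partial>lborel)") auto
    have pos: "a powr (e + 1) > 0" using a by simp
    have "a powr (e + 1) * ((r + 1) / a powr (e + 1)) \<le> r"
      using ge[of "(r + 1) / a powr (e + 1)"] r pos by simp
    then show False using pos by simp
  qed
qed

lemma bounded_powers_imp_zero:
  fixes e C :: real
  assumes "\<And>R. R > 0 \<Longrightarrow> R powr e \<le> C"
  shows "e = 0"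
proof (rule ccontr)
  assume e: "e \<noteq> 0"
  have "((\<bar>C\<bar> + 1) powr (1 / e)) powr e \<le> C" by (rule assms) auto
  then show False using e by (simp add: powr_powr)
qed

text \<open>
The indicator is the difference of two nondecreasing step functions with one unit jump each.
\<close>

lemma total_var_interval_indicator:
  assumes "u \<le> v"
  shows "total_var (indicator {u..v}) a b \<le> 2"
  unfolding total_var_def
proof (rule SUP_least, clarify)
  fix n :: nat and t :: "nat \<Rightarrow> real" assume t: "mono t"
  define g h where "g x = (if u \<le> x then 1 else 0 :: real)" and "h x = (if v < x then 1 else 0 :: real)" for x
  have le: "norm (indicator {u..v} (t (Suc i)) - indicator {u..v} (t i) :: complex)
      \<le> (g (t (Suc i)) - g (t i)) + (h (t (Suc i)) - h (t i))" for i
  proof -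
    have "t i \<le> t (Suc i)" using t by (simp add: mono_def)
    then show ?thesis using assms by (auto simp: g_def h_def indicator_def)
  qed
  have "(\<Sum>i<n. norm (indicator {u..v} (t (Suc i)) - indicator {u..v} (t i) :: complex))
    \<le> (\<Sum>i<n. (g (t (Suc i)) - g (t i)) + (h (t (Suc i)) - h (t i)))"
    by (intro sum_mono le)
  also have "\<dots> = (g (t n) - g (t 0)) + (h (t n) - h (t 0))"
    unfolding sum.distrib sum_lessThan_telescope[of "\<lambda>i. g (t i)"] sum_lessThan_telescope[of "\<lambda>i. h (t i)"] ..
  also have "\<dots> \<le> 2" by (simp add: g_def h_def)
  finally have "ennreal (\<Sum>i<n. norm (indicator {u..v} (t (Suc i)) - indicator {u..v} (t i) :: complex)) \<le> ennreal 2"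
    by (rule ennreal_leI)
  then show "(\<Sum>i<n. ennreal (norm (indicator {u..v} (t (Suc i)) - indicator {u..v} (t i) :: complex))) \<le> 2"
    by (simp add: sum_ennreal)
qed

text \<open>
The constants do not depend on \<open>R\<close>. If \<open>f\<close>, the indicator, is not constant on \<open>[x, 2 * x]\<close>, then
\<open>R / 2 \<le> x \<le> 2 * R\<close>, and \<open>[x / 4, 4 * x]\<close> contains the whole block, whose mass is \<open>R\<close>.
\<close>

lemma general_monotone_interval_indicator:
  assumes R: "R > 0"
  shows "general_monotone 4 4 (indicator {R..2 * R})"
  unfolding general_monotone_def locally_bounded_variation_def
proof (intro conjI allI impI)
  fix a b :: real
  have "total_var (indicator {R..2 * R}) a b \<le> 2" using R by (intro total_var_interval_indicator) auto
  then show "total_var (indicator {R..2 * R}) a b < \<infinity>" by (simp add: order_le_less_trans)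
next
  fix x :: real assume x: "0 < x"
  show "total_var (indicator {R..2 * R}) x (2 * x)
    \<le> ennreal (4 / x) * (\<integral>\<^sup>+t\<in>{x / 4..4 * x}. ennreal (norm (indicator {R..2 * R} t :: complex)) \<partial>lborel)"
  proof (cases "2 * x < R \<or> 2 * R < x")
    case True
    have "total_var (indicator {R..2 * R}) x (2 * x) \<le> 0"
      unfolding total_var_def
    proof (rule SUP_least, clarify)
      fix n :: nat and t :: "nat \<Rightarrow> real" assume "range t \<subseteq> {x..2 * x}"
      then have r: "x \<le> t i" "t i \<le> 2 * x" for i by (auto simp: image_subset_iff)
      have "t i \<notin> {R..2 * R}" for i using True r[of i] by auto
      then show "(\<Sum>i<n. ennreal (norm (indicator {R..2 * R} (t (Suc i)) - indicator {R..2 * R} (t i) :: complex))) \<le> 0"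
        by simp
    qed
    then show ?thesis by simp
  next
    case False
    have "total_var (indicator {R..2 * R}) x (2 * x) \<le> 2"
      using R by (intro total_var_interval_indicator) auto
    also have "2 = ennreal 2" by simp
    also have "\<dots> \<le> ennreal (4 / x * R)"
      using False x by (intro ennreal_leI) (auto simp: field_simps)
    also have "\<dots> = ennreal (4 / x) * (\<integral>\<^sup>+t. indicator {R..2 * R} t \<partial>lborel)"
      using R x by (simp add: ennreal_mult[symmetric])
    also have "\<dots> \<le> ennreal (4 / x) * (\<integral>\<^sup>+t\<in>{x / 4..4 * x}. ennreal (norm (indicator {R..2 * R} t :: complex)) \<partial>lborel)"
      using False x R by (intro mult_left_mono nn_integral_mono) (auto simp: indicator_def)
    finally show ?thesis .
  qed
qed

lemma admissible_interval_indicator: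
  assumes R: "R > 0"
  shows "admissible \<alpha> (indicator {R..2 * R})"
proof -
  have fin: "(\<integral>\<^sup>+x\<in>S. ennreal (x powr e * norm (indicator {R..2 * R} x :: complex)) \<partial>lborel) < \<infinity>" for S e
  proof -
    have "(\<integral>\<^sup>+x\<in>S. ennreal (x powr e * norm (indicator {R..2 * R} x :: complex)) \<partial>lborel)
      \<le> (\<integral>\<^sup>+x. ennreal (R powr e + (2 * R) powr e) * indicator {R..2 * R} x \<partial>lborel)"
    proof (rule nn_integral_mono)
      fix x
      have "x powr e \<le> R powr e + (2 * R) powr e" if "R \<le> x" "x \<le> 2 * R"
      proof (cases "e \<ge> 0")
        case True
        then have "x powr e \<le> (2 * R) powr e" using that R by (intro powr_mono2) auto
        then show ?thesis by (simp add: add_increasing)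
      next
        case False
        then have "x powr e \<le> R powr e" using that R by (intro powr_mono2') auto
        then show ?thesis by (simp add: add_increasing2)
      qed
      then show "ennreal (x powr e * norm (indicator {R..2 * R} x :: complex)) * indicator S x
        \<le> ennreal (R powr e + (2 * R) powr e) * indicator {R..2 * R} x"
        by (auto simp: indicator_def intro!: ennreal_leI simp del: ennreal_plus)
    qed
    also have "\<dots> < \<infinity>"
      using R by (subst nn_integral_cmult_indicator) (auto simp: ennreal_mult_less_top)
    finally show ?thesis .
  qed
  then show ?thesis unfolding admissible_def by (simp add: fin[unfolded infinity_ennreal_def])
qed

text \<open>
The transform of the indicator of \<open>[1,2]\<close>. The kernel is cut off so that the integrand is measurable
for every real \<open>y\<close>.
\<close>

definition block_transform :: "real \<Rightarrow> real \<Rightarrow> real" where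
  "block_transform \<alpha> y = (LBINT x. indicator {1..2} x * (if x * y > 0 then struve_kernel \<alpha> (x * y) else 0))"

lemma borel_measurable_struve_kernel:
  assumes "\<alpha> > -1/2"
  shows "(\<lambda>s. if 0 < s then struve_kernel \<alpha> s else 0) \<in> borel_measurable borel"
  using borel_measurable_continuous_on_if[OF _ continuous_on_struve_kernel[OF assms] continuous_on_const[of _ 0]]
  by simp

lemma borel_measurable_block_transform:
  assumes "\<alpha> > -1/2"
  shows "block_transform \<alpha> \<in> borel_measurable borel"
proof -
  define K where "K s = (if 0 < s then struve_kernel \<alpha> s else 0)" for s
  have [measurable]: "K \<in> borel_measurable borel"
    using borel_measurable_struve_kernel[OF assms] by (simp add: K_def[abs_def])
  show ?thesis unfolding block_transform_def[abs_def] K_def[symmetric] by measurable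
qed

text \<open>
The integrals over \<open>(0,T)\<close> are constant for \<open>T > 2 * R\<close>, and dilation reduces the block to \<open>[1,2]\<close>.
\<close>

lemma struve_transform_interval_indicator:
  assumes \<alpha>: "\<alpha> > -1/2" and R: "R > 0" and y: "y > 0"
  shows "struve_transform \<alpha> (indicator {R..2 * R}) y = complex_of_real (R * block_transform \<alpha> (R * y))"
proof -
  define K where "K s = (if 0 < s then struve_kernel \<alpha> s else 0)" for s
  have [measurable]: "K \<in> borel_measurable borel"
    using borel_measurable_struve_kernel[OF \<alpha>] by (simp add: K_def[abs_def])
  have "(LINT x:{0<..<T}|lborel. complex_of_real ((x * y) powr (1/2)) * indicator {R..2 * R} x * complex_of_real (struve_H \<alpha> (x * y)))
     = complex_of_real (R * block_transform \<alpha> (R * y))" if T: "T > 2 * R" for T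
  proof -
    have "(LINT x:{0<..<T}|lborel. complex_of_real ((x * y) powr (1/2)) * indicator {R..2 * R} x * complex_of_real (struve_H \<alpha> (x * y)))
      = (\<integral>x. complex_of_real (indicator {R..2 * R} x * K (x * y)) \<partial>lborel)"
      unfolding set_lebesgue_integral_def using T R y
      by (intro Bochner_Integration.integral_cong) (auto simp: indicator_def K_def struve_kernel_def zero_less_mult_iff)
    also have "\<dots> = complex_of_real (\<integral>x. indicator {R..2 * R} x * K (x * y) \<partial>lborel)"
      by (rule integral_complex_of_real)
    also have "(\<integral>x. indicator {R..2 * R} x * K (x * y) \<partial>lborel)
      = \<bar>R\<bar> *\<^sub>R (\<integral>x. indicator {R..2 * R} (0 + R * x) * K ((0 + R * x) * y) \<partial>lborel)"
      using R by (intro lborel_integral_real_affine) auto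
    also have "(\<integral>x. indicator {R..2 * R} (0 + R * x) * K ((0 + R * x) * y) \<partial>lborel) = block_transform \<alpha> (R * y)"
      unfolding block_transform_def K_def using R
      by (intro Bochner_Integration.integral_cong) (auto simp: indicator_def mult_ac)
    finally show ?thesis using R by simp
  qed
  then have "eventually (\<lambda>T. (LINT x:{0<..<T}|lborel. complex_of_real ((x * y) powr (1/2)) * indicator {R..2 * R} x * complex_of_real (struve_H \<alpha> (x * y)))
     = complex_of_real (R * block_transform \<alpha> (R * y))) at_top"
    using eventually_gt_at_top[of "2 * R"] by (rule eventually_mono[rotated])
  then have "((\<lambda>T. LINT x:{0<..<T}|lborel. complex_of_real ((x * y) powr (1/2)) * indicator {R..2 * R} x * complex_of_real (struve_H \<alpha> (x * y)))
     \<longlongrightarrow> complex_of_real (R * block_transform \<alpha> (R * y))) at_top"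
    by (rule tendsto_eventually)
  then show ?thesis unfolding struve_transform_def by (rule tendsto_Lim[OF trivial_limit_at_top_linorder])
qed

lemma block_transform_eq_integral:
  assumes \<alpha>: "\<alpha> > -1/2" and y: "y > 0"
  shows "block_transform \<alpha> y = integral {1..2} (\<lambda>x. struve_kernel \<alpha> (x * y))"
    and "(\<lambda>x. struve_kernel \<alpha> (x * y)) integrable_on {1..2}"
proof -
  have c: "continuous_on {1..2} (\<lambda>x. struve_kernel \<alpha> (x * y))"
    using y by (intro continuous_on_compose2[OF continuous_on_struve_kernel[OF \<alpha>]] continuous_intros) auto
  have "block_transform \<alpha> y = (LINT x:{1..2}|lborel. struve_kernel \<alpha> (x * y))"
    unfolding block_transform_def set_lebesgue_integral_def using y
    by (intro Bochner_Integration.integral_cong) (auto simp: indicator_def)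
  also have "\<dots> = integral {1..2} (\<lambda>x. struve_kernel \<alpha> (x * y))"
    by (intro set_borel_integral_eq_integral borel_integrable_atLeastAtMost' c)
  finally show "block_transform \<alpha> y = integral {1..2} (\<lambda>x. struve_kernel \<alpha> (x * y))" .
  show "(\<lambda>x. struve_kernel \<alpha> (x * y)) integrable_on {1..2}" by (rule integrable_continuous_real[OF c])
qed

lemma block_transform_near_0:
  assumes \<alpha>: "\<alpha> > -1/2"
  obtains b y0 where "b > 0" "y0 > 0" "\<forall>y. 0 < y \<and> y \<le> y0 \<longrightarrow> b * y powr (\<alpha> + 3/2) \<le> block_transform \<alpha> y"
proof -
  obtain B b s0 where b: "B > 0" "b > 0" "s0 > 0"
    "\<forall>s. 0 < s \<and> s \<le> 1 \<longrightarrow> \<bar>struve_kernel \<alpha> s\<bar> \<le> B * s powr (\<alpha> + 3/2)"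
    "\<forall>s. 0 < s \<and> s \<le> s0 \<longrightarrow> b * s powr (\<alpha> + 3/2) \<le> struve_kernel \<alpha> s"
    by (rule struve_kernel_near_0[OF \<alpha>])
  have "b * y powr (\<alpha> + 3/2) \<le> block_transform \<alpha> y" if y: "0 < y" "y \<le> s0 / 2" for y
  proof -
    have "integral {1..2} (\<lambda>x::real. b * y powr (\<alpha> + 3/2)) \<le> integral {1..2} (\<lambda>x. struve_kernel \<alpha> (x * y))"
    proof (rule Henstock_Kurzweil_Integration.integral_le)
      fix x :: real assume x: "x \<in> {1..2}"
      have "b * y powr (\<alpha> + 3/2) \<le> b * (x * y) powr (\<alpha> + 3/2)"
        using x y b \<alpha> by (intro mult_left_mono powr_mono2) auto
      also have "x * y \<le> 2 * (s0 / 2)" using x y by (intro mult_mono) auto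
      then have "b * (x * y) powr (\<alpha> + 3/2) \<le> struve_kernel \<alpha> (x * y)" using b(5) x y by auto
      finally show "b * y powr (\<alpha> + 3/2) \<le> struve_kernel \<alpha> (x * y)" .
    qed (use block_transform_eq_integral[OF \<alpha> y(1)] in auto)
    then show ?thesis using block_transform_eq_integral(1)[OF \<alpha> y(1)] by simp
  qed
  then show thesis using b by (intro that[of b "s0 / 2"]) auto
qed

text \<open>
The kernel is \<open>c s powr (\<alpha> - 1/2) + r - w''\<close> with \<open>w'' = r - w\<close>. Integrated over \<open>[1,2]\<close>, the first
term is of exact order \<open>y powr (\<alpha> - 1/2)\<close>. The last one is a difference of values of \<open>w' / y\<close> and, like
the integral of \<open>r\<close>, is \<open>O(\<rho> y / y)\<close>; this is of smaller order because \<open>\<alpha> > -1/2\<close>.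
\<close>

lemma block_transform_near_infinity:
  assumes \<alpha>: "\<alpha> > -1/2"
  obtains b y0 where "b > 0" "y0 > 0" "\<forall>y\<ge>y0. b * y powr (\<alpha> - 1/2) \<le> block_transform \<alpha> y"
proof -
  define \<rho> where "\<rho> s = max 1 (s powr (\<alpha> - 1/2))" for s :: real
  obtain c w w1 r B where cB: "c > 0" "B > 0"
    and asym: "\<forall>s>0. struve_kernel \<alpha> s = c * s powr (\<alpha> - 1/2) + w s"
    "\<forall>s>0. (w has_real_derivative w1 s) (at s)"
    "\<forall>s>0. (w1 has_real_derivative - w s + r s) (at s)"
    "continuous_on {0<..} r"
    "\<forall>s\<ge>1. \<bar>w s\<bar> \<le> B * max 1 (s powr (\<alpha> - 1/2))"
    "\<forall>s\<ge>1. \<bar>w1 s\<bar> \<le> B * max 1 (s powr (\<alpha> - 1/2))"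
    "\<forall>s\<ge>1. \<bar>r s\<bar> \<le> B * max 1 (s powr (\<alpha> - 1/2)) / s\<^sup>2"
    by (rule struve_kernel_asymptotics[OF \<alpha>]) (rule that)
  define \<kappa> m where "\<kappa> = max 1 (2 powr (\<alpha> - 1/2))" and "m = min 1 (2 powr (\<alpha> - 1/2))"
  have \<kappa>m: "\<kappa> \<ge> 1" "m > 0" by (auto simp: \<kappa>_def m_def)
  have xp: "m \<le> x powr (\<alpha> - 1/2)" "x powr (\<alpha> - 1/2) \<le> \<kappa>" if "1 \<le> x" "x \<le> 2" for x
  proof -
    have "1 \<le> x powr (\<alpha> - 1/2) \<and> x powr (\<alpha> - 1/2) \<le> 2 powr (\<alpha> - 1/2)
      \<or> 2 powr (\<alpha> - 1/2) \<le> x powr (\<alpha> - 1/2) \<and> x powr (\<alpha> - 1/2) \<le> 1"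
    proof (cases "\<alpha> \<ge> 1/2")
      case True
      then show ?thesis using that powr_mono2[of "\<alpha> - 1/2" 1 x] powr_mono2[of "\<alpha> - 1/2" x 2] by auto
    next
      case False
      then show ?thesis using that powr_mono2'[of "\<alpha> - 1/2" 1 x] powr_mono2'[of "\<alpha> - 1/2" x 2] by auto
    qed
    then show "m \<le> x powr (\<alpha> - 1/2)" "x powr (\<alpha> - 1/2) \<le> \<kappa>" by (auto simp: m_def \<kappa>_def)
  qed
  \<comment> \<open>Dilation by a factor in [1,2] changes rho by at most the factor kappa.\<close>
  have \<rho>x: "\<rho> (x * y) \<le> \<kappa> * \<rho> y" if "1 \<le> x" "x \<le> 2" "0 < y" for x y
  proof -
    have "x powr (\<alpha> - 1/2) * y powr (\<alpha> - 1/2) \<le> \<kappa> * \<rho> y"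
      using xp[OF that(1,2)] \<kappa>m by (intro mult_mono) (auto simp: \<rho>_def)
    moreover have "1 * 1 \<le> \<kappa> * \<rho> y" using \<kappa>m by (intro mult_mono) (auto simp: \<rho>_def)
    ultimately show ?thesis using that by (simp add: \<rho>_def powr_mult)
  qed
  have main: "c * m * y powr (\<alpha> - 1/2) - 3 * B * \<kappa> * \<rho> y / y \<le> block_transform \<alpha> y" if y: "y \<ge> 1" for y
  proof -
    have y0: "y > 0" using y by simp
    define D where "D = (w1 (2 * y) / y - w1 y / y)"
    \<comment> \<open>The second derivative of w integrates to boundary values.\<close>
    have i1: "((\<lambda>x. - w (x * y) + r (x * y)) has_integral D) {1..2}"
    proof -
      have "((\<lambda>x. - w (x * y) + r (x * y)) has_integral (w1 (2 * y) / y - w1 (1 * y) / y)) {1..2}"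
      proof (rule fundamental_theorem_of_calculus)
        fix x :: real assume x: "x \<in> {1..2}"
        then have xy: "x * y > 0" using y0 by simp
        have "((\<lambda>x. w1 (x * y)) has_real_derivative (- w (x * y) + r (x * y)) * y) (at x)"
          by (rule DERIV_chain2[where f = w1 and g = "\<lambda>x. x * y", OF asym(3)[rule_format, OF xy]])
            (auto intro!: derivative_eq_intros)
        from DERIV_cdivide[OF this, of y]
        have "((\<lambda>x. w1 (x * y) / y) has_real_derivative (- w (x * y) + r (x * y))) (at x)" using y0 by simp
        then show "((\<lambda>x. w1 (x * y) / y) has_vector_derivative - w (x * y) + r (x * y)) (at x within {1..2})"
          by (simp add: has_real_derivative_iff_has_vector_derivative has_vector_derivative_at_within)
      qed simp
      then show ?thesis by (simp add: D_def)
    qed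
    have i2: "((\<lambda>x. struve_kernel \<alpha> (x * y)) has_integral block_transform \<alpha> y) {1..2}"
      using block_transform_eq_integral[OF \<alpha> y0] by (simp add: has_integral_integral)
    define E where "E = B * \<kappa> * \<rho> y / y"
    have \<rho>0: "\<rho> y \<ge> 1" by (simp add: \<rho>_def)
    have "integral {1..2} (\<lambda>x::real. c * m * y powr (\<alpha> - 1/2) - E)
      \<le> integral {1..2} (\<lambda>x. struve_kernel \<alpha> (x * y) + (- w (x * y) + r (x * y)))"
    proof (rule Henstock_Kurzweil_Integration.integral_le)
      show "(\<lambda>x. struve_kernel \<alpha> (x * y) + (- w (x * y) + r (x * y))) integrable_on {1..2}"
        using has_integral_add[OF i2 i1] by blast
      fix x :: real assume x: "x \<in> {1..2}"
      have "1 * y \<le> x * y" using x y by (intro mult_right_mono) auto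
      then have xy: "y \<le> x * y" by simp
      then have xy1: "1 \<le> x * y" using y by linarith
      note xy = xy xy1
      have "struve_kernel \<alpha> (x * y) + (- w (x * y) + r (x * y)) = c * (x * y) powr (\<alpha> - 1/2) + r (x * y)"
        using asym(1) xy by simp
      moreover have "c * m * y powr (\<alpha> - 1/2) \<le> c * (x * y) powr (\<alpha> - 1/2)"
        using xp(1)[of x] x cB y0 by (simp add: powr_mult mult_right_mono)
      moreover have "\<bar>r (x * y)\<bar> \<le> E"
      proof -
        have "\<bar>r (x * y)\<bar> \<le> B * \<rho> (x * y) / (x * y)\<^sup>2" using asym(7) xy by (simp add: \<rho>_def)
        also have "\<dots> \<le> B * (\<kappa> * \<rho> y) / (x * y)\<^sup>2"
          using \<rho>x[of x y] x y0 cB by (intro divide_right_mono mult_left_mono) auto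
        also have "\<dots> \<le> B * (\<kappa> * \<rho> y) / y"
        proof (rule divide_left_mono)
          have "1 * y \<le> (x * y) * (x * y)" using xy y0 by (intro mult_mono) auto
          then show "y \<le> (x * y)\<^sup>2" by (simp add: power2_eq_square)
          show "0 \<le> B * (\<kappa> * \<rho> y)" using cB \<kappa>m \<rho>0 by simp
        qed (use y0 x in auto)
        finally show ?thesis by (simp add: E_def mult_ac)
      qed
      ultimately show "c * m * y powr (\<alpha> - 1/2) - E \<le> struve_kernel \<alpha> (x * y) + (- w (x * y) + r (x * y))"
        by linarith
    qed (rule integrable_const_ivl)
    also have "\<dots> = block_transform \<alpha> y + D" by (intro integral_unique has_integral_add i1 i2)
    finally have "c * m * y powr (\<alpha> - 1/2) - E \<le> block_transform \<alpha> y + D" by simp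
    moreover have "\<bar>w1 (2 * y) / y\<bar> \<le> E" "\<bar>w1 y / y\<bar> \<le> E"
    proof -
      have "\<bar>w1 (2 * y)\<bar> \<le> B * \<rho> (2 * y)" "\<bar>w1 y\<bar> \<le> B * \<rho> (1 * y)"
        using asym(6) y by (auto simp: \<rho>_def)
      moreover have "B * \<rho> (2 * y) \<le> B * (\<kappa> * \<rho> y)" "B * \<rho> (1 * y) \<le> B * (\<kappa> * \<rho> y)"
        using \<rho>x[of 2 y] \<rho>x[of 1 y] y0 cB by (intro mult_left_mono; simp)+
      ultimately have "\<bar>w1 (2 * y)\<bar> \<le> B * \<kappa> * \<rho> y" "\<bar>w1 y\<bar> \<le> B * \<kappa> * \<rho> y" by (simp_all add: mult.assoc)
      then show "\<bar>w1 (2 * y) / y\<bar> \<le> E" "\<bar>w1 y / y\<bar> \<le> E"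
        using y0 by (auto simp: E_def abs_divide divide_right_mono)
    qed
    ultimately have "c * m * y powr (\<alpha> - 1/2) - 3 * E \<le> block_transform \<alpha> y" unfolding D_def by linarith
    then show ?thesis by (simp add: E_def)
  qed
  have "((\<lambda>y. 3 * B * \<kappa> * max (y powr (- (\<alpha> + 1/2))) (y powr (-1))) \<longlongrightarrow> 3 * B * \<kappa> * max 0 0) at_top"
    using \<alpha> by (intro tendsto_intros tendsto_max tendsto_neg_powr filterlim_ident) auto
  then have "eventually (\<lambda>y. 3 * B * \<kappa> * max (y powr (- (\<alpha> + 1/2))) (y powr (-1)) < c * m / 2) at_top"
    using cB \<kappa>m by (intro order_tendstoD(2)) auto
  then obtain Y where Y: "\<And>y. y \<ge> Y \<Longrightarrow> 3 * B * \<kappa> * max (y powr (- (\<alpha> + 1/2))) (y powr (-1)) < c * m / 2"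
    unfolding eventually_at_top_linorder by blast
  show thesis
  proof (rule that[of "c * m / 2" "max 1 Y"])
    show "c * m / 2 > 0" using cB \<kappa>m by simp
    show "\<forall>y\<ge>max 1 Y. c * m / 2 * y powr (\<alpha> - 1/2) \<le> block_transform \<alpha> y"
    proof (intro allI impI)
      fix y assume y: "max 1 Y \<le> y"
      then have y1: "y \<ge> 1" "y > 0" by auto
      have "\<rho> y / y = max (y powr (- (\<alpha> + 1/2))) (y powr (-1)) * y powr (\<alpha> - 1/2)"
      proof -
        have "y powr (- (\<alpha> + 1/2)) * y powr (\<alpha> - 1/2) = 1 / y"
          using y1 by (simp add: powr_minus_divide flip: powr_add)
        moreover have "y powr (-1) * y powr (\<alpha> - 1/2) = y powr (\<alpha> - 1/2) / y"
          using y1 by (simp add: powr_minus_divide)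
        ultimately show ?thesis
          using y1 by (simp add: max_mult_distrib_right \<rho>_def max_divide_distrib_right)
      qed
      then have "3 * B * \<kappa> * \<rho> y / y = (3 * B * \<kappa> * max (y powr (- (\<alpha> + 1/2))) (y powr (-1))) * y powr (\<alpha> - 1/2)"
        unfolding times_divide_eq_right[symmetric, of _ "\<rho> y"] by (simp only: mult.assoc)
      also have "\<dots> \<le> c * m / 2 * y powr (\<alpha> - 1/2)"
        using Y[of y] y by (intro mult_right_mono) auto
      finally have "3 * B * \<kappa> * \<rho> y / y \<le> c * m / 2 * y powr (\<alpha> - 1/2)" .
      moreover have "c * m * y powr (\<alpha> - 1/2) = 2 * (c * m / 2 * y powr (\<alpha> - 1/2))" by simp
      ultimately show "c * m / 2 * y powr (\<alpha> - 1/2) \<le> block_transform \<alpha> y"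
        using main[OF y1(1)] by (simp only:)
    qed
  qed simp
qed

section \<open>The weighted norm inequality\<close>

lemma Lp_norm_ennreal:
  assumes "(\<integral>\<^sup>+x\<in>{0<..}. ennreal (norm (g x) powr p) \<partial>lborel) = ennreal A" "0 \<le> A"
  shows "Lp_norm p g = ennreal (A powr (1 / p))"
  using assms by (simp add: Lp_norm_def)

text \<open>
After the pointwise domination of the transform by the power kernel, the claim is the Hardy type
inequality with \<open>\<delta> = \<beta> - 1 / q\<close>; the bounds on \<open>\<beta>\<close> turn into
\<open>\<alpha> - 1/2 < \<delta> < \<alpha> + 3/2\<close>. The constant \<open>D\<close> of the domination is moved into the input function \<open>g\<close>: a
factor can be taken out of an integral only if the integrand is measurable, which is known for \<open>f\<close>, but
has not been shown for the transform.
\<close>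

lemma struve_transform_inequality_sufficient:
  fixes p q \<alpha> \<beta> \<gamma> :: real
  assumes p: "1 < p" "p \<le> q" and \<alpha>: "\<alpha> > -1/2" and c: "C\<^sub>0 > 1" "lam > 1"
    and eq: "\<beta> = \<gamma> + 1 / q - (1 - 1 / p)"
    and rng: "1 / q + \<alpha> - 1/2 < \<beta>" "\<beta> < 1 / q + \<alpha> + 3/2"
  shows "\<exists>C>0. \<forall>f. general_monotone C\<^sub>0 lam f \<and> admissible \<alpha> f \<longrightarrow>
            Lp_norm q (\<lambda>y. complex_of_real (y powr (-\<beta>)) * struve_transform \<alpha> f y)
              \<le> ennreal C * Lp_norm p (\<lambda>x. complex_of_real (x powr \<gamma>) * f x)"
proof -
  define \<delta> where "\<delta> = \<beta> - 1 / q"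
  have \<delta>: "\<alpha> - 1/2 < \<delta>" "\<delta> < \<alpha> + 3/2" "\<delta> + 1 - 1 / p = \<gamma>" "\<delta> + 1 / q = \<beta>"
    using rng eq by (auto simp: \<delta>_def)
  obtain C1 where C1: "C1 > 0" and young: "\<And>g r A. g \<in> borel_measurable borel \<Longrightarrow> (\<forall>x. 0 \<le> g x) \<Longrightarrow> 0 \<le> A \<Longrightarrow>
     (\<integral>\<^sup>+x. ennreal (indicator {0<..} x * (x powr \<gamma> * g x) powr p) \<partial>lborel) = ennreal A \<Longrightarrow>
     (\<forall>y>0. 0 \<le> r y \<and> ennreal (r y) \<le>
        (\<integral>\<^sup>+x. ennreal (indicator {0<..} x * g x * min ((x * y) powr (\<alpha> + 3/2)) ((x * y) powr (\<alpha> - 1/2))) \<partial>lborel)) \<Longrightarrow>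
     (\<integral>\<^sup>+y. ennreal (indicator {0<..} y * (y powr (- \<beta>) * r y) powr q) \<partial>lborel)
        \<le> ennreal (C1 * A powr (q / p))"
    using power_weight_kernel_inequality[OF p \<delta>(1,2)] unfolding \<delta>(3,4) by blast
  obtain D where D: "D > 0" and bound: "\<And>f y. general_monotone C\<^sub>0 lam f \<Longrightarrow> admissible \<alpha> f \<Longrightarrow> 0 < y \<Longrightarrow>
    ennreal (norm (struve_transform \<alpha> f y))
      \<le> ennreal D * (\<integral>\<^sup>+x. ennreal (indicator {0<..} x * norm (f x) * power_kernel \<alpha> (x * y)) \<partial>lborel)"
    using struve_transform_bound[OF \<alpha> c] by blast
  have q: "q > 0" using p by simp
  define C where "C = D * C1 powr (1 / q)"
  have C: "C > 0" using C1 D by (simp add: C_def)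
  have main: "Lp_norm q (\<lambda>y. complex_of_real (y powr (-\<beta>)) * struve_transform \<alpha> f y)
              \<le> ennreal C * Lp_norm p (\<lambda>x. complex_of_real (x powr \<gamma>) * f x)"
    if GM: "general_monotone C\<^sub>0 lam f" and ad: "admissible \<alpha> f" for f
  proof (cases "(\<integral>\<^sup>+x\<in>{0<..}. ennreal (norm (complex_of_real (x powr \<gamma>) * f x) powr p) \<partial>lborel) = \<infinity>")
    case True
    then have "Lp_norm p (\<lambda>x. complex_of_real (x powr \<gamma>) * f x) = \<infinity>"
      by (simp add: Lp_norm_def)
    then show ?thesis using C by (simp add: ennreal_mult_top)
  next
    case False
    then obtain A where A: "(\<integral>\<^sup>+x\<in>{0<..}. ennreal (norm (complex_of_real (x powr \<gamma>) * f x) powr p) \<partial>lborel) = ennreal A" "0 \<le> A"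
      by (cases "(\<integral>\<^sup>+x\<in>{0<..}. ennreal (norm (complex_of_real (x powr \<gamma>) * f x) powr p) \<partial>lborel)") auto
    define g where "g x = D * norm (if 0 < x then f x else 0)" for x
    have f[measurable]: "(\<lambda>x. if 0 < x then f x else 0) \<in> borel_measurable borel"
      using borel_measurable_locally_bounded_variation[of f] GM by (auto simp: general_monotone_def)
    have g: "g \<in> borel_measurable borel" unfolding g_def[abs_def] by measurable
    have g0: "\<forall>x. 0 \<le> g x" using D by (simp add: g_def)
    define r where "r y = norm (struve_transform \<alpha> f y)" for y
    define A' where "A' = D powr p * A"
    have A': "A' \<ge> 0" using A by (simp add: A'_def)
    have gA: "(\<integral>\<^sup>+x. ennreal (indicator {0<..} x * (x powr \<gamma> * g x) powr p) \<partial>lborel) = ennreal A'"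
    proof -
      have "(\<integral>\<^sup>+x. ennreal (indicator {0<..} x * (x powr \<gamma> * g x) powr p) \<partial>lborel)
        = (\<integral>\<^sup>+x. ennreal (D powr p) * ennreal (indicator {0<..} x * (x powr \<gamma> * norm (if 0 < x then f x else 0)) powr p) \<partial>lborel)"
        using D by (intro nn_integral_cong) (auto simp: g_def indicator_def powr_mult mult_ac ennreal_mult[symmetric])
      also have "\<dots> = ennreal (D powr p) * (\<integral>\<^sup>+x. ennreal (indicator {0<..} x * (x powr \<gamma> * norm (if 0 < x then f x else 0)) powr p) \<partial>lborel)"
        by (rule nn_integral_cmult) measurable
      also have "(\<integral>\<^sup>+x. ennreal (indicator {0<..} x * (x powr \<gamma> * norm (if 0 < x then f x else 0)) powr p) \<partial>lborel) = ennreal A"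
        unfolding A(1)[symmetric] by (intro nn_integral_cong) (auto simp: indicator_def norm_mult)
      finally show ?thesis using A(2) by (simp add: A'_def ennreal_mult)
    qed
    have "\<forall>y>0. 0 \<le> r y \<and> ennreal (r y) \<le>
        (\<integral>\<^sup>+x. ennreal (indicator {0<..} x * g x * min ((x * y) powr (\<alpha> + 3/2)) ((x * y) powr (\<alpha> - 1/2))) \<partial>lborel)"
    proof (intro allI impI conjI)
      fix y :: real assume y: "0 < y"
      show "0 \<le> r y" by (simp add: r_def)
      define h where "h x = indicator {0<..} x * norm (if 0 < x then f x else 0) * power_kernel \<alpha> (x * y)" for x
      have [measurable]: "h \<in> borel_measurable borel"
        unfolding h_def[abs_def] power_kernel_def[abs_def] by measurable
      have "ennreal (r y) \<le> ennreal D * (\<integral>\<^sup>+x. ennreal (indicator {0<..} x * norm (f x) * power_kernel \<alpha> (x * y)) \<partial>lborel)"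
        unfolding r_def by (rule bound[OF GM ad y])
      also have "(\<integral>\<^sup>+x. ennreal (indicator {0<..} x * norm (f x) * power_kernel \<alpha> (x * y)) \<partial>lborel) = (\<integral>\<^sup>+x. ennreal (h x) \<partial>lborel)"
        by (intro nn_integral_cong) (auto simp: h_def indicator_def)
      also have "ennreal D * (\<integral>\<^sup>+x. ennreal (h x) \<partial>lborel) = (\<integral>\<^sup>+x. ennreal D * ennreal (h x) \<partial>lborel)"
        by (rule nn_integral_cmult[symmetric]) measurable
      also have "\<dots> = (\<integral>\<^sup>+x. ennreal (indicator {0<..} x * g x * min ((x * y) powr (\<alpha> + 3/2)) ((x * y) powr (\<alpha> - 1/2))) \<partial>lborel)"
        using D by (intro nn_integral_cong) (simp add: h_def g_def power_kernel_def ennreal_mult[symmetric] mult_ac)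
      finally show "ennreal (r y) \<le> (\<integral>\<^sup>+x. ennreal (indicator {0<..} x * g x * min ((x * y) powr (\<alpha> + 3/2)) ((x * y) powr (\<alpha> - 1/2))) \<partial>lborel)" .
    qed
    from young[OF g g0 A' gA this]
    have Y: "(\<integral>\<^sup>+y. ennreal (indicator {0<..} y * (y powr (- \<beta>) * r y) powr q) \<partial>lborel) \<le> ennreal (C1 * A' powr (q / p))" .
    have rq: "(\<integral>\<^sup>+y\<in>{0<..}. ennreal (norm (complex_of_real (y powr (-\<beta>)) * struve_transform \<alpha> f y) powr q) \<partial>lborel)
      = (\<integral>\<^sup>+y. ennreal (indicator {0<..} y * (y powr (- \<beta>) * r y) powr q) \<partial>lborel)"
      by (intro nn_integral_cong) (auto simp: r_def indicator_def norm_mult)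
    obtain N where N: "(\<integral>\<^sup>+y. ennreal (indicator {0<..} y * (y powr (- \<beta>) * r y) powr q) \<partial>lborel) = ennreal N" "0 \<le> N"
      using Y by (cases "(\<integral>\<^sup>+y. ennreal (indicator {0<..} y * (y powr (- \<beta>) * r y) powr q) \<partial>lborel)") (auto simp: top_unique)
    have NC: "N \<le> C1 * A' powr (q / p)" using Y unfolding N(1) using C1 by (subst (asm) ennreal_le_iff) auto
    have "Lp_norm q (\<lambda>y. complex_of_real (y powr (-\<beta>)) * struve_transform \<alpha> f y) = ennreal (N powr (1 / q))"
      by (rule Lp_norm_ennreal) (use rq N in auto)
    also have "\<dots> \<le> ennreal ((C1 * A' powr (q / p)) powr (1 / q))"
      using NC N(2) q by (intro ennreal_leI powr_mono2) auto
    also have "(C1 * A' powr (q / p)) powr (1 / q) = C * A powr (1 / p)"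
    proof -
      have "(A' powr (q / p)) powr (1 / q) = A' powr (1 / p)" using q by (simp add: powr_powr)
      also have "\<dots> = D * A powr (1 / p)" using D p by (simp add: A'_def powr_mult powr_powr)
      finally show ?thesis by (simp add: powr_mult C_def)
    qed
    also have "ennreal (C * A powr (1 / p)) = ennreal C * Lp_norm p (\<lambda>x. complex_of_real (x powr \<gamma>) * f x)"
      using C by (subst Lp_norm_ennreal[OF A]) (simp add: ennreal_mult)
    finally show ?thesis .
  qed
  show ?thesis using C main by blast
qed

text \<open>
The integral is a power of \<open>R\<close> times the integral over \<open>[1,2]\<close>, by dilation.
\<close>

lemma Lp_norm_interval_indicator:
  fixes p \<gamma> :: real
  assumes p: "p > 0"
  obtains G where "G > 0" "\<forall>R>0. Lp_norm p (\<lambda>x. complex_of_real (x powr \<gamma>) * indicator {R..2 * R} x) = ennreal (G * R powr (\<gamma> + 1 / p))"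
proof -
  define e where "e = \<gamma> * p"
  define n where "n x = indicator {1..2} x * x powr e" for x :: real
  have [measurable]: "n \<in> borel_measurable borel" unfolding n_def[abs_def] by measurable
  have cont: "continuous_on {1..2} (\<lambda>x::real. x powr e)" by (intro continuous_intros) auto
  have int: "integrable lborel n"
    using borel_integrable_atLeastAtMost'[OF cont] by (simp add: set_integrable_def n_def[abs_def])
  define I where "I = integral\<^sup>L lborel n"
  have n0: "n x \<ge> 0" for x by (simp add: n_def)
  have nI: "(\<integral>\<^sup>+x. ennreal (n x) \<partial>lborel) = ennreal I"
    unfolding I_def by (rule nn_integral_eq_integral[OF int]) (use n0 in auto)
  have I: "I > 0"
  proof -
    define m where "m = min 1 (2 powr e)"
    have m: "m > 0" by (simp add: m_def)
    have "m \<le> x powr e" if "1 \<le> x" "x \<le> 2" for x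
    proof (cases "e \<ge> 0")
      case True
      then show ?thesis using that ge_one_powr_ge_zero[of x e] by (simp add: m_def)
    next
      case False
      then have "2 powr e \<le> x powr e" using that by (intro powr_mono2') auto
      then show ?thesis by (simp add: m_def)
    qed
    then have "(\<integral>\<^sup>+x. ennreal m * indicator {1..2::real} x \<partial>lborel) \<le> (\<integral>\<^sup>+x. ennreal (n x) \<partial>lborel)"
      by (intro nn_integral_mono) (auto simp: n_def indicator_def intro!: ennreal_leI)
    then have "ennreal m \<le> ennreal I"
      unfolding nI by (subst (asm) nn_integral_cmult_indicator) auto
    then show ?thesis using m by (simp add: ennreal_le_iff2)
  qed
  have "Lp_norm p (\<lambda>x. complex_of_real (x powr \<gamma>) * indicator {R..2 * R} x) = ennreal (I powr (1 / p) * R powr (\<gamma> + 1 / p))"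
    if R: "R > 0" for R
  proof -
    have "(\<integral>\<^sup>+x\<in>{0<..}. ennreal (norm (complex_of_real (x powr \<gamma>) * indicator {R..2 * R} x) powr p) \<partial>lborel)
      = (\<integral>\<^sup>+x. ennreal (indicator {R..2 * R} x * x powr e) \<partial>lborel)"
      using R by (intro nn_integral_cong) (auto simp: indicator_def e_def powr_powr)
    also have "\<dots> = ennreal \<bar>R\<bar> * (\<integral>\<^sup>+x. ennreal (indicator {R..2 * R} (0 + R * x) * (0 + R * x) powr e) \<partial>lborel)"
      using R by (intro nn_integral_real_affine) auto
    also have "(\<integral>\<^sup>+x. ennreal (indicator {R..2 * R} (0 + R * x) * (0 + R * x) powr e) \<partial>lborel)
      = (\<integral>\<^sup>+x. ennreal (R powr e) * ennreal (n x) \<partial>lborel)"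
      using R by (intro nn_integral_cong) (auto simp: n_def indicator_def powr_mult ennreal_mult[symmetric])
    also have "\<dots> = ennreal (R powr e) * ennreal I"
      unfolding nI[symmetric] by (rule nn_integral_cmult) measurable
    also have "ennreal \<bar>R\<bar> * (ennreal (R powr e) * ennreal I) = ennreal (I * R powr (e + 1))"
      using R I by (simp add: ennreal_mult[symmetric] powr_add mult_ac)
    finally have "Lp_norm p (\<lambda>x. complex_of_real (x powr \<gamma>) * indicator {R..2 * R} x) = ennreal ((I * R powr (e + 1)) powr (1 / p))"
      by (rule Lp_norm_ennreal) (use I in auto)
    also have "(I * R powr (e + 1)) powr (1 / p) = I powr (1 / p) * (R powr (e + 1)) powr (1 / p)"
      by (rule powr_mult)
    also have "(R powr (e + 1)) powr (1 / p) = R powr (\<gamma> + 1 / p)"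
      unfolding powr_powr using p by (simp add: e_def field_simps)
    finally show ?thesis .
  qed
  moreover have "I powr (1 / p) > 0" using I by simp
  ultimately show thesis by (intro that[of "I powr (1 / p)"]) auto
qed

text \<open>
It suffices to test with the indicators of \<open>[R, 2 * R]\<close>, which lie in one class of general monotone
functions and have finite weighted norms for every \<open>\<gamma>\<close>. Their transforms are dilates of one function, so
both sides are multiples of powers of \<open>R\<close>, and the inequality for all \<open>R > 0\<close> forces the two exponents to
agree. That the left-hand side is finite means that \<open>y powr (- \<beta>)\<close> times the transform of a block is in
\<open>L\<^sup>q\<close>; as that transform is at least of order \<open>y powr (\<alpha> + 3/2)\<close> at zero and \<open>y powr (\<alpha> - 1/2)\<close> at
infinity, the two bounds on \<open>\<beta>\<close> follow.
\<close>

lemma struve_transform_inequality_necessary: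
  fixes p q \<alpha> \<beta> \<gamma> :: real
  assumes p: "1 < p" "p \<le> q" and \<alpha>: "\<alpha> > -1/2" and C: "C > 0"
    and ineq: "\<And>f. general_monotone 4 4 f \<Longrightarrow> admissible \<alpha> f \<Longrightarrow>
            Lp_norm q (\<lambda>y. complex_of_real (y powr (-\<beta>)) * struve_transform \<alpha> f y)
              \<le> ennreal C * Lp_norm p (\<lambda>x. complex_of_real (x powr \<gamma>) * f x)"
  shows "\<beta> = \<gamma> + 1 / q - (1 - 1 / p)" "1 / q + \<alpha> - 1/2 < \<beta>" "\<beta> < 1 / q + \<alpha> + 3/2"
proof -
  have q: "q > 0" "p > 0" using p by auto
  obtain G where G: "G > 0" and Gn: "\<forall>R>0. Lp_norm p (\<lambda>x. complex_of_real (x powr \<gamma>) * indicator {R..2 * R} x) = ennreal (G * R powr (\<gamma> + 1 / p))"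
    by (rule Lp_norm_interval_indicator[OF q(2)])
  have T[measurable]: "block_transform \<alpha> \<in> borel_measurable borel" by (rule borel_measurable_block_transform[OF \<alpha>])
  define t where "t y = indicator {0<..} y * (y powr (- \<beta>) * \<bar>block_transform \<alpha> y\<bar>) powr q" for y
  have [measurable]: "t \<in> borel_measurable borel" unfolding t_def[abs_def] by measurable
  have t0: "t y \<ge> 0" for y by (simp add: t_def)
  define N where "N = (\<integral>\<^sup>+y. ennreal (t y) \<partial>lborel)"
  define e where "e = \<beta> * q + q - 1"
  have scale: "(\<integral>\<^sup>+y\<in>{0<..}. ennreal (norm (complex_of_real (y powr (-\<beta>)) * struve_transform \<alpha> (indicator {R..2 * R}) y) powr q) \<partial>lborel)
      = ennreal (R powr e) * N" if R: "R > 0" for R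
  proof -
    have "N = ennreal \<bar>R\<bar> * (\<integral>\<^sup>+y. ennreal (t (0 + R * y)) \<partial>lborel)"
      unfolding N_def using R by (intro nn_integral_real_affine) auto
    then have "ennreal (R powr e) * N = ennreal (R powr e * R) * (\<integral>\<^sup>+y. ennreal (t (0 + R * y)) \<partial>lborel)"
      using R by (simp add: ennreal_mult mult.assoc)
    also have "\<dots> = (\<integral>\<^sup>+y. ennreal (R powr e * R) * ennreal (t (0 + R * y)) \<partial>lborel)"
      by (rule nn_integral_cmult[symmetric]) measurable
    also have "\<dots> = (\<integral>\<^sup>+y\<in>{0<..}. ennreal (norm (complex_of_real (y powr (-\<beta>)) * struve_transform \<alpha> (indicator {R..2 * R}) y) powr q) \<partial>lborel)"
    proof (intro nn_integral_cong)
      fix y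
      show "ennreal (R powr e * R) * ennreal (t (0 + R * y))
        = ennreal (norm (complex_of_real (y powr (-\<beta>)) * struve_transform \<alpha> (indicator {R..2 * R}) y) powr q) * indicator {0<..} y"
      proof (cases "y > 0")
        case True
        have Re: "R powr e * R = R powr (\<beta> * q) * R powr q"
          using R powr_add[of R e 1] powr_add[of R "\<beta> * q" q] by (simp add: e_def)
        have "R powr (\<beta> * q) * (R * y) powr (- \<beta> * q) = y powr (- \<beta> * q)"
          using R True by (simp add: powr_mult powr_minus)
        moreover have "t (0 + R * y) = (R * y) powr (- \<beta> * q) * \<bar>block_transform \<alpha> (R * y)\<bar> powr q"
          using R True by (simp add: t_def powr_mult powr_powr)
        ultimately have "(R powr e * R) * t (0 + R * y) = y powr (- \<beta> * q) * (R powr q * \<bar>block_transform \<alpha> (R * y)\<bar> powr q)"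
          unfolding Re by (metis (no_types, lifting) mult.assoc mult.commute)
        also have "\<dots> = norm (complex_of_real (y powr (-\<beta>)) * struve_transform \<alpha> (indicator {R..2 * R}) y) powr q"
          unfolding struve_transform_interval_indicator[OF \<alpha> R True]
          using R by (simp add: norm_mult powr_mult powr_powr abs_mult)
        finally show ?thesis using True R t0 by (simp add: ennreal_mult[symmetric])
      qed (use R in \<open>simp add: t_def zero_less_mult_iff\<close>)
    qed
    finally show ?thesis ..
  qed
  have tested: "Lp_norm q (\<lambda>y. complex_of_real (y powr (-\<beta>)) * struve_transform \<alpha> (indicator {R..2 * R}) y)
      \<le> ennreal (C * (G * R powr (\<gamma> + 1 / p)))" if R: "R > 0" for R
    using ineq[OF general_monotone_interval_indicator[OF R] admissible_interval_indicator[OF R]] Gn R C G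
    by (simp add: ennreal_mult)
  have Nfin: "N \<noteq> \<infinity>"
  proof
    assume "N = \<infinity>"
    then have "Lp_norm q (\<lambda>y. complex_of_real (y powr (-\<beta>)) * struve_transform \<alpha> (indicator {1..2 * 1}) y) = \<infinity>"
      using scale[of 1] by (simp add: Lp_norm_def)
    then show False using tested[of 1] by (simp add: top_unique)
  qed
  \<comment> \<open>A lower bound by a power of y on S makes that power integrable there.\<close>
  have diverge: "\<not> (\<integral>\<^sup>+y. ennreal (y powr d) * indicator S y \<partial>lborel) = \<infinity>"
    if S: "S \<in> sets borel" "S \<subseteq> {0<..}" and b: "b > 0" "\<And>y. y \<in> S \<Longrightarrow> b * y powr s \<le> block_transform \<alpha> y"
      and d: "d = (s - \<beta>) * q" for S b s d
  proof
    assume inf: "(\<integral>\<^sup>+y. ennreal (y powr d) * indicator S y \<partial>lborel) = \<infinity>"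
    have "(\<integral>\<^sup>+y. ennreal (b powr q) * (ennreal (y powr d) * indicator S y) \<partial>lborel) \<le> N"
      unfolding N_def
    proof (rule nn_integral_mono)
      fix y
      show "ennreal (b powr q) * (ennreal (y powr d) * indicator S y) \<le> ennreal (t y)"
      proof (cases "y \<in> S")
        case True
        then have y: "y > 0" using S by auto
        have "b powr q * y powr d = (y powr (- \<beta>) * (b * y powr s)) powr q"
        proof -
          have "y powr (- \<beta> * q) * y powr (s * q) = y powr d"
            unfolding d by (simp add: powr_add[symmetric] left_diff_distrib)
          then show ?thesis unfolding powr_mult powr_powr by (simp add: mult_ac)
        qed
        also have "\<dots> \<le> (y powr (- \<beta>) * \<bar>block_transform \<alpha> y\<bar>) powr q"
          using b(1) b(2)[OF True] q by (intro powr_mono2 mult_left_mono mult_nonneg_nonneg) auto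
        finally show ?thesis using True y by (simp add: t_def ennreal_mult[symmetric] ennreal_leI)
      qed simp
    qed
    moreover have "(\<integral>\<^sup>+y. ennreal (b powr q) * (ennreal (y powr d) * indicator S y) \<partial>lborel) = \<infinity>"
      using S b by (subst nn_integral_cmult) (auto simp: inf[unfolded infinity_ennreal_def] ennreal_mult_top)
    ultimately show False using Nfin by (simp add: top_unique)
  qed
  obtain b0 y0 where b0: "b0 > 0" "y0 > 0" "\<forall>y. 0 < y \<and> y \<le> y0 \<longrightarrow> b0 * y powr (\<alpha> + 3/2) \<le> block_transform \<alpha> y"
    by (rule block_transform_near_0[OF \<alpha>])
  obtain b1 y1 where b1: "b1 > 0" "y1 > 0" "\<forall>y\<ge>y1. b1 * y powr (\<alpha> - 1/2) \<le> block_transform \<alpha> y"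
    by (rule block_transform_near_infinity[OF \<alpha>])
  have sub: "{0<..y0} \<subseteq> {0<..}" "{y1..} \<subseteq> {0<..}" using b1(2) by auto
  have "\<not> (\<alpha> + 3/2 - \<beta>) * q \<le> -1"
    using diverge[of "{0<..y0}" b0 "\<alpha> + 3/2" "(\<alpha> + 3/2 - \<beta>) * q"]
      powr_integral_diverges[OF b0(2), of "(\<alpha> + 3/2 - \<beta>) * q" "{0<..y0}"] b0 sub by auto
  then have "-1 / q < \<alpha> + 3/2 - \<beta>" by (simp only: pos_divide_less_eq[OF q(1)] not_le)
  then show "\<beta> < 1 / q + \<alpha> + 3/2" by simp
  have "\<not> -1 \<le> (\<alpha> - 1/2 - \<beta>) * q"
    using diverge[of "{y1..}" b1 "\<alpha> - 1/2" "(\<alpha> - 1/2 - \<beta>) * q"]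
      powr_integral_diverges[OF b1(2), of "(\<alpha> - 1/2 - \<beta>) * q" "{y1..}"] b1 sub by auto
  then have "\<alpha> - 1/2 - \<beta> < -1 / q" by (simp only: pos_less_divide_eq[OF q(1)] not_le)
  then show "1 / q + \<alpha> - 1/2 < \<beta>" by simp
  obtain n where n: "N = ennreal n" "n \<ge> 0" using Nfin by (cases N) auto
  have "N \<noteq> 0"
  proof
    assume "N = 0"
    then have "emeasure lborel {y \<in> space lborel. ennreal (t y) \<noteq> 0} = 0"
      unfolding N_def by (subst (asm) nn_integral_0_iff) auto
    moreover have "{0<..y0} \<subseteq> {y \<in> space lborel. ennreal (t y) \<noteq> 0}"
    proof
      fix y assume y: "y \<in> {0<..y0}"
      have "0 < b0 * y powr (\<alpha> + 3/2)" using y b0 by simp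
      also have "\<dots> \<le> block_transform \<alpha> y" using y b0 by auto
      finally show "y \<in> {y \<in> space lborel. ennreal (t y) \<noteq> 0}"
        using y by (simp add: t_def ennreal_eq_0_iff)
    qed
    then have "emeasure lborel {0<..y0} \<le> emeasure lborel {y \<in> space lborel. ennreal (t y) \<noteq> 0}"
      by (intro emeasure_mono) measurable
    ultimately show False using b0 by simp
  qed
  then have "n > 0" using n by (cases "n = 0") auto
  have "R powr (\<beta> + 1 - 1 / q - (\<gamma> + 1 / p)) \<le> C * G / n powr (1 / q)" if R: "R > 0" for R
  proof -
    have "Lp_norm q (\<lambda>y. complex_of_real (y powr (-\<beta>)) * struve_transform \<alpha> (indicator {R..2 * R}) y)
      = ennreal ((R powr e * n) powr (1 / q))"
      by (rule Lp_norm_ennreal) (use scale[OF R] n in \<open>auto simp: ennreal_mult\<close>)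
    with tested[OF R] have "(R powr e * n) powr (1 / q) \<le> C * (G * R powr (\<gamma> + 1 / p))"
      using C G by (simp add: ennreal_le_iff)
    also have "(R powr e * n) powr (1 / q) = R powr (\<beta> + 1 - 1 / q) * n powr (1 / q)"
    proof -
      have "e * (1 / q) = \<beta> + 1 - 1 / q" using q by (simp add: e_def field_simps)
      then show ?thesis unfolding powr_mult powr_powr by simp
    qed
    finally have le: "R powr (\<beta> + 1 - 1 / q) * n powr (1 / q) \<le> C * (G * R powr (\<gamma> + 1 / p))" .
    have "u / v \<le> C * G / m" if "u * m \<le> C * (G * v)" "v > 0" "m > 0" for u v m :: real
      using that by (simp add: field_simps)
    from this[OF le] show ?thesis
      unfolding powr_diff[of R "\<beta> + 1 - 1 / q" "\<gamma> + 1 / p"] using R \<open>n > 0\<close> by simp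
  qed
  then have "\<beta> + 1 - 1 / q - (\<gamma> + 1 / p) = 0" by (rule bounded_powers_imp_zero)
  then show "\<beta> = \<gamma> + 1 / q - (1 - 1 / p)" by simp
qed

theorem theorem6p10:
  fixes p q \<alpha> \<beta> \<gamma> :: real
  assumes "1 < p" and "p \<le> q" and "\<alpha> > -1/2"
  shows "(\<forall>C\<^sub>0>1. \<forall>lam>1. \<exists>C>0. \<forall>f. general_monotone C\<^sub>0 lam f \<and> admissible \<alpha> f \<longrightarrow>
            Lp_norm q (\<lambda>y. complex_of_real (y powr (-\<beta>)) * struve_transform \<alpha> f y)
              \<le> ennreal C * Lp_norm p (\<lambda>x. complex_of_real (x powr \<gamma>) * f x))
         \<longleftrightarrow> \<beta> = \<gamma> + 1 / q - 1 / conj_exponent p \<and>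
             1 / q + \<alpha> - 1/2 < \<beta> \<and> \<beta> < 1 / q + \<alpha> + 3/2"
  (is "?ineq \<longleftrightarrow> ?cond")
proof -
  have conj: "1 / conj_exponent p = 1 - 1 / p"
    using assms(1) by (simp add: conj_exponent_def field_simps)
  show ?thesis
  proof
    assume ?ineq
    then obtain C where "C > 0" "\<And>f. general_monotone 4 4 f \<Longrightarrow> admissible \<alpha> f \<Longrightarrow>
            Lp_norm q (\<lambda>y. complex_of_real (y powr (-\<beta>)) * struve_transform \<alpha> f y)
              \<le> ennreal C * Lp_norm p (\<lambda>x. complex_of_real (x powr \<gamma>) * f x)"
      by (auto dest!: spec[of _ "4::real"])
    from struve_transform_inequality_necessary[OF assms this] show ?cond
      unfolding conj by simp
  next
    assume ?cond
    then show ?ineq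
      unfolding conj using struve_transform_inequality_sufficient[OF assms] by blast
  qed
qed

end
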